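(* For every $n\in\mathbb N$, the chain complexes $\Sigma^+$ and $\Sigma^-$ are homotopy equivalent in $\mathcal K(\mathcal H_n)$.
   Context: Let $k$ be a field of characteristic zero. Khovanov's Heisenberg category: $\mathcal H'$ is the additive $k$-linear monoidal category generated by two objects $Q_+,Q_-$. Its morphisms are $k$-linear combinations of oriented planar string diagrams up to isotopy rel boundary (read bottom to top; $Q_+$ is an upward strand, $Q_-$ a downward strand), generated by the crossing of two upward strands and the four oriented cups and caps (so $Q_+,Q_-$ are biadjoint), modulo: (i) the double crossing of two upward strands is the identity; (ii) the braid relation for three upward strands; (iii) the double crossing $Q_+Q_-\to Q_-Q_+\to Q_+Q_-$ is the identity; (iv) the double crossing $Q_-Q_+\to Q_+Q_-\to Q_-Q_+$ is the identity minus the composite of the cap $Q_-Q_+\to\mathsf 1$ followed by the cup $\mathsf 1\to Q_-Q_+$; (v) a counterclockwise circle equals $1$; (vi) an upward strand with a curl on its left is zero. $\mathcal H$ is the Karoubi envelope of $\mathcal H'$. Write $\mathsf P=Q_+$, $\mathsf Q=Q_-$, juxtaposition for $\otimes$, $\mathsf 1$ for the unit. Relations (i),(ii) give algebra maps $k[S_m]\to\mathrm{End}(\mathsf P^{\otimes m})$ and $k[S_m]\to\mathrm{End}(\mathsf Q^{\otimes m})$. For $\lambda\vdash m$, $\mathsf P^\lambda$ and $\mathsf Q^\lambda$ are the images in $\mathsf P^{\otimes m}$, $\mathsf Q^{\otimes m}$ of the Young idempotent $e_\lambda$ of the row-ordered standard tableau of shape $\lambda$ (the idempotent scalar multiple of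 row symmetrizer times column antisymmetrizer). $\lambda^t$ is the transposed partition. Complexes: differentials lower homological degree by one. The complexes $\Sigma^\pm$: $\Sigma^-$ has term $\bigoplus_{\lambda\vdash m}\mathsf P^\lambda\mathsf Q^{\lambda^t}$ in homological degree $m\ge0$, with differential $\mathsf d^-$ whose component $\mathsf P^\lambda\mathsf Q^{\lambda^t}\to\mathsf P^\mu\mathsf Q^{\mu^t}$ ($\mu\vdash m-1$) is zero unless $\lambda$ is obtained from $\mu$ by adding a box, in which case it is (a nonzero multiple of) $\mathsf P^\lambda\mathsf Q^{\lambda^t}\to\mathsf P^\mu\mathsf P\mathsf Q\mathsf Q^{\mu^t}\to\mathsf P^\mu\mathsf Q^{\mu^t}$, where $\mathsf P^\lambda\to\mathsf P^\mu\mathsf P$ and $\mathsf Q^{\lambda^t}\to\mathsf Q\mathsf Q^{\mu^t}$ are the split inclusions coming from symmetric group algebras (Pieri rule) and the last map is the cap $\mathsf P\mathsf Q\to\mathsf 1$. $\Sigma^+$ has term $\bigoplus_{\lambda\vdash m}\mathsf P^\lambda\mathsf Q^{\lambda^t}$ in homological degree $-m$, $m\ge0$, with differential $\mathsf d^+$ having components $\mathsf P^\mu\mathsf Q^{\mu^t}\to\mathsf P^\mu\mathsf P\mathsf Q\mathsf Q^{\mu^t}\to\mathsf P^\lambda\mathsf Q^{\lambda^t}$ (cup $\mathsf 1\to\mathsf P\mathsf Q$ followed by the split projections) for $\lambda=\mu+\square$, and zero otherwise. The scalars are chosen so that $\mathsf d^\pm\circ\mathsf d^\pm=0$. A concrete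 realization: let $\varepsilon_m=\frac1{m!}\sum_{w\in S_m}\mathrm{sgn}(w)\,w\otimes\bar w$ on $\mathsf P^{\otimes m}\mathsf Q^{\otimes m}$, where $\bar w$ is the left-right mirror image of the permutation diagram $w$ on $\mathsf Q^{\otimes m}$; its image is isomorphic to $\bigoplus_{\lambda\vdash m}\mathsf P^\lambda\mathsf Q^{\lambda^t}$, and $\mathsf d^-$ (resp. $\mathsf d^+$) is induced by capping off (resp. creating by a cup) the two innermost strands. For $n\in\mathbb N$, $\mathcal H_n$ is defined as $\bigoplus_m(k[S_m],k[S_n])\text{-bimod}$, and equivalently described (the form used for statements about complexes over $\mathcal H$) as the category with the same objects and morphisms as $\mathcal H$, except that every morphism factoring through an object of the form $\mathsf M\otimes\mathsf Q^{\otimes n}$, $\mathsf M\in\mathcal H$, is set to zero. A relation between complexes over $\mathcal H$ "in $\mathcal K(\mathcal H_n)$" refers to their images in this quotient, where $\Sigma^\pm$ have only finitely many nonzero terms. *)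

theory Defs
  imports Complex_Main "HOL-Combinatorics.Permutations"
begin

section \<open>Diagrams and the generating category\<close>

text \<open>Objects are words in the signs \<open>Up\<close> (the object \<open>P\<close>, that is \<open>Q\<^sub>+\<close>) and \<open>Down\<close>
  (the object \<open>Q\<close>, that is \<open>Q\<^sub>-\<close>); the tensor product is concatenation.\<close>

datatype orient = Up | Down
type_synonym word = "orient list"

abbreviation Ppow :: "nat \<Rightarrow> word" where "Ppow m \<equiv> replicate m Up"
abbreviation Qpow :: "nat \<Rightarrow> word" where "Qpow m \<equiv> replicate m Down"

text \<open>\<open>CapPQ : P Q \<rightarrow> 1\<close> and \<open>CupPQ : 1 \<rightarrow> P Q\<close> are the clockwise cap and cup,
  \<open>CapQP\<close> and \<open>CupQP\<close> the counterclockwise ones.\<close>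

datatype generator = Crossing | CapPQ | CapQP | CupPQ | CupQP

primrec gen_dom :: "generator \<Rightarrow> word" where
  "gen_dom Crossing = [Up, Up]"
| "gen_dom CapPQ = [Up, Down]"
| "gen_dom CapQP = [Down, Up]"
| "gen_dom CupPQ = []"
| "gen_dom CupQP = []"

primrec gen_cod :: "generator \<Rightarrow> word" where
  "gen_cod Crossing = [Up, Up]"
| "gen_cod CapPQ = []"
| "gen_cod CapQP = []"
| "gen_cod CupPQ = [Up, Down]"
| "gen_cod CupQP = [Down, Up]"

text \<open>Formal expressions for morphisms. \<open>Compose g f\<close> is \<open>g \<circ> f\<close>, i.e. \<open>g\<close> stacked on top of \<open>f\<close>.\<close>

datatype 'k diag =
    Gen generator
  | Ident word
  | Compose "'k diag" "'k diag"  (infixr "\<bullet>" 68)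
  | Tensor "'k diag" "'k diag"  (infixr "\<diamondop>" 72)
  | ZeroD word word
  | Plus "'k diag" "'k diag"
  | Scale 'k "'k diag"

inductive typed :: "'k diag \<Rightarrow> word \<Rightarrow> word \<Rightarrow> bool" where
  "typed (Gen g) (gen_dom g) (gen_cod g)"
| "typed (Ident u) u u"
| "typed f u v \<Longrightarrow> typed g v w \<Longrightarrow> typed (g \<bullet> f) u w"
| "typed f u v \<Longrightarrow> typed g u' v' \<Longrightarrow> typed (f \<diamondop> g) (u @ u') (v @ v')"
| "typed (ZeroD u v) u v"
| "typed f u v \<Longrightarrow> typed g u v \<Longrightarrow> typed (Plus f g) u v"
| "typed f u v \<Longrightarrow> typed (Scale c f) u v"

abbreviation idP :: "'k diag" where "idP \<equiv> Ident [Up]"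
abbreviation idQ :: "'k diag" where "idQ \<equiv> Ident [Down]"

text \<open>The crossings of other orientations are rotations of the upward crossing.\<close>

definition cross_PQ_QP :: "'k diag" where
  "cross_PQ_QP = (idQ \<diamondop> idP \<diamondop> Gen CapPQ) \<bullet> (idQ \<diamondop> Gen Crossing \<diamondop> idQ) \<bullet> (Gen CupQP \<diamondop> idP \<diamondop> idQ)"

definition cross_QP_PQ :: "'k diag" where
  "cross_QP_PQ = (Gen CapQP \<diamondop> idP \<diamondop> idQ) \<bullet> (idQ \<diamondop> Gen Crossing \<diamondop> idQ) \<bullet> (idQ \<diamondop> idP \<diamondop> Gen CupPQ)"

definition cross_down :: "'k diag" where
  "cross_down =
     ((Gen CapQP \<bullet> (idQ \<diamondop> Gen CapQP \<diamondop> idP)) \<diamondop> idQ \<diamondop> idQ)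
     \<bullet> (idQ \<diamondop> idQ \<diamondop> Gen Crossing \<diamondop> idQ \<diamondop> idQ)
     \<bullet> (idQ \<diamondop> idQ \<diamondop> ((idP \<diamondop> Gen CupPQ \<diamondop> idQ) \<bullet> Gen CupPQ))"

definition cross_down' :: "'k diag" where
  "cross_down' =
     (idQ \<diamondop> idQ \<diamondop> (Gen CapPQ \<bullet> (idP \<diamondop> Gen CapPQ \<diamondop> idQ)))
     \<bullet> (idQ \<diamondop> idQ \<diamondop> Gen Crossing \<diamondop> idQ \<diamondop> idQ)
     \<bullet> (((idQ \<diamondop> Gen CupQP \<diamondop> idP) \<bullet> Gen CupQP) \<diamondop> idQ \<diamondop> idQ)"

text \<open>Planar isotopy rel boundary, beyond the axioms of a strict monoidal category, amounts to
  the four zigzag identities for the cups and caps and to the cyclicity of the crossing: its two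
  rotations by a half turn agree. (A strict monoidal category with these relations is the same as
  isotopy classes of diagrams.) The remaining rules are the local relations.\<close>

inductive local_rel :: "'k::field_char_0 diag \<Rightarrow> 'k diag \<Rightarrow> bool" where
  zigzag1: "local_rel ((Gen CapPQ \<diamondop> idP) \<bullet> (idP \<diamondop> Gen CupQP)) idP"
| zigzag2: "local_rel ((idP \<diamondop> Gen CapQP) \<bullet> (Gen CupPQ \<diamondop> idP)) idP"
| zigzag3: "local_rel ((Gen CapQP \<diamondop> idQ) \<bullet> (idQ \<diamondop> Gen CupPQ)) idQ"
| zigzag4: "local_rel ((idQ \<diamondop> Gen CapPQ) \<bullet> (Gen CupQP \<diamondop> idQ)) idQ"
| cyclic: "local_rel cross_down cross_down'"
| double_up: "local_rel (Gen Crossing \<bullet> Gen Crossing) (Ident [Up, Up])"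
| braid: "local_rel
    ((Gen Crossing \<diamondop> idP) \<bullet> (idP \<diamondop> Gen Crossing) \<bullet> (Gen Crossing \<diamondop> idP))
    ((idP \<diamondop> Gen Crossing) \<bullet> (Gen Crossing \<diamondop> idP) \<bullet> (idP \<diamondop> Gen Crossing))"
| double_PQ: "local_rel (cross_QP_PQ \<bullet> cross_PQ_QP) (Ident [Up, Down])"
| double_QP: "local_rel (cross_PQ_QP \<bullet> cross_QP_PQ)
    (Plus (Ident [Down, Up]) (Scale (- 1) (Gen CupQP \<bullet> Gen CapQP)))"
| circle: "local_rel (Gen CapQP \<bullet> Gen CupQP) (Ident [])"
| left_curl: "local_rel
    ((Gen CapQP \<diamondop> idP) \<bullet> (idQ \<diamondop> Gen Crossing) \<bullet> (Gen CupQP \<diamondop> idP)) (ZeroD [Up] [Up])"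

text \<open>Equality of morphisms \<open>u \<rightarrow> v\<close>: the congruence generated by the axioms of a strict
  \<open>k\<close>-linear monoidal category and the local relations.\<close>

inductive diag_eq :: "word \<Rightarrow> word \<Rightarrow> 'k::field_char_0 diag \<Rightarrow> 'k diag \<Rightarrow> bool" where
  refl: "typed f u v \<Longrightarrow> diag_eq u v f f"
| sym: "diag_eq u v f g \<Longrightarrow> diag_eq u v g f"
| trans: "diag_eq u v f g \<Longrightarrow> diag_eq u v g h \<Longrightarrow> diag_eq u v f h"
| cong_compose: "diag_eq u v f f' \<Longrightarrow> diag_eq v w g g' \<Longrightarrow> diag_eq u w (g \<bullet> f) (g' \<bullet> f')"
| cong_tensor: "diag_eq u v f f' \<Longrightarrow> diag_eq u' v' g g' \<Longrightarrow>
    diag_eq (u @ u') (v @ v') (f \<diamondop> g) (f' \<diamondop> g')"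
| cong_plus: "diag_eq u v f f' \<Longrightarrow> diag_eq u v g g' \<Longrightarrow> diag_eq u v (Plus f g) (Plus f' g')"
| cong_scale: "diag_eq u v f f' \<Longrightarrow> diag_eq u v (Scale c f) (Scale c f')"

| compose_assoc: "typed f u v \<Longrightarrow> typed g v w \<Longrightarrow> typed h w x \<Longrightarrow>
    diag_eq u x ((h \<bullet> g) \<bullet> f) (h \<bullet> (g \<bullet> f))"
| compose_id_left: "typed f u v \<Longrightarrow> diag_eq u v (Ident v \<bullet> f) f"
| compose_id_right: "typed f u v \<Longrightarrow> diag_eq u v (f \<bullet> Ident u) f"
| tensor_assoc: "typed f u u' \<Longrightarrow> typed g v v' \<Longrightarrow> typed h w w' \<Longrightarrow>
    diag_eq (u @ v @ w) (u' @ v' @ w') ((f \<diamondop> g) \<diamondop> h) (f \<diamondop> (g \<diamondop> h))"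
| tensor_unit_left: "typed f u v \<Longrightarrow> diag_eq u v (Ident [] \<diamondop> f) f"
| tensor_unit_right: "typed f u v \<Longrightarrow> diag_eq u v (f \<diamondop> Ident []) f"
| tensor_id: "diag_eq (u @ v) (u @ v) (Ident u \<diamondop> Ident v) (Ident (u @ v))"
| interchange: "typed f u v \<Longrightarrow> typed g v w \<Longrightarrow> typed f' u' v' \<Longrightarrow> typed g' v' w' \<Longrightarrow>
    diag_eq (u @ u') (w @ w') ((g \<bullet> f) \<diamondop> (g' \<bullet> f')) ((g \<diamondop> g') \<bullet> (f \<diamondop> f'))"

| plus_assoc: "typed f u v \<Longrightarrow> typed g u v \<Longrightarrow> typed h u v \<Longrightarrow>
    diag_eq u v (Plus (Plus f g) h) (Plus f (Plus g h))"
| plus_commute: "typed f u v \<Longrightarrow> typed g u v \<Longrightarrow> diag_eq u v (Plus f g) (Plus g f)"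
| plus_zero: "typed f u v \<Longrightarrow> diag_eq u v (Plus (ZeroD u v) f) f"
| scale_plus: "typed f u v \<Longrightarrow> typed g u v \<Longrightarrow>
    diag_eq u v (Scale c (Plus f g)) (Plus (Scale c f) (Scale c g))"
| scale_add: "typed f u v \<Longrightarrow> diag_eq u v (Scale (a + b) f) (Plus (Scale a f) (Scale b f))"
| scale_mult: "typed f u v \<Longrightarrow> diag_eq u v (Scale (a * b) f) (Scale a (Scale b f))"
| scale_one: "typed f u v \<Longrightarrow> diag_eq u v (Scale 1 f) f"
| scale_zero: "typed f u v \<Longrightarrow> diag_eq u v (Scale 0 f) (ZeroD u v)"
| compose_plus_left: "typed f u v \<Longrightarrow> typed g v w \<Longrightarrow> typed g' v w \<Longrightarrow>
    diag_eq u w (Plus g g' \<bullet> f) (Plus (g \<bullet> f) (g' \<bullet> f))"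
| compose_plus_right: "typed f u v \<Longrightarrow> typed f' u v \<Longrightarrow> typed g v w \<Longrightarrow>
    diag_eq u w (g \<bullet> Plus f f') (Plus (g \<bullet> f) (g \<bullet> f'))"
| compose_scale_left: "typed f u v \<Longrightarrow> typed g v w \<Longrightarrow>
    diag_eq u w (Scale c g \<bullet> f) (Scale c (g \<bullet> f))"
| compose_scale_right: "typed f u v \<Longrightarrow> typed g v w \<Longrightarrow>
    diag_eq u w (g \<bullet> Scale c f) (Scale c (g \<bullet> f))"
| tensor_plus_left: "typed f u v \<Longrightarrow> typed f' u v \<Longrightarrow> typed g u' v' \<Longrightarrow>
    diag_eq (u @ u') (v @ v') (Plus f f' \<diamondop> g) (Plus (f \<diamondop> g) (f' \<diamondop> g))"
| tensor_plus_right: "typed f u v \<Longrightarrow> typed g u' v' \<Longrightarrow> typed g' u' v' \<Longrightarrow>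
    diag_eq (u @ u') (v @ v') (f \<diamondop> Plus g g') (Plus (f \<diamondop> g) (f \<diamondop> g'))"
| tensor_scale_left: "typed f u v \<Longrightarrow> typed g u' v' \<Longrightarrow>
    diag_eq (u @ u') (v @ v') (Scale c f \<diamondop> g) (Scale c (f \<diamondop> g))"
| tensor_scale_right: "typed f u v \<Longrightarrow> typed g u' v' \<Longrightarrow>
    diag_eq (u @ u') (v @ v') (f \<diamondop> Scale c g) (Scale c (f \<diamondop> g))"

| relation: "local_rel f g \<Longrightarrow> typed f u v \<Longrightarrow> typed g u v \<Longrightarrow> diag_eq u v f g"

section \<open>Preadditive categories, additive hull, Karoubi envelope\<close>

text \<open>Morphisms are representatives; \<open>eqv X Y f g\<close> says that \<open>f\<close> and \<open>g\<close> represent the same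
  morphism \<open>X \<rightarrow> Y\<close>. \<open>cmp X Y Z g f\<close> is the composite of \<open>f : X \<rightarrow> Y\<close> and \<open>g : Y \<rightarrow> Z\<close>.\<close>

record ('o, 'm) precat =
  ob :: "'o set"
  hom :: "'o \<Rightarrow> 'o \<Rightarrow> 'm set"
  eqv :: "'o \<Rightarrow> 'o \<Rightarrow> 'm \<Rightarrow> 'm \<Rightarrow> bool"
  ident :: "'o \<Rightarrow> 'm"
  cmp :: "'o \<Rightarrow> 'o \<Rightarrow> 'o \<Rightarrow> 'm \<Rightarrow> 'm \<Rightarrow> 'm"
  add :: "'m \<Rightarrow> 'm \<Rightarrow> 'm"
  zero :: "'o \<Rightarrow> 'o \<Rightarrow> 'm"

definition additive_hull :: "('o, 'm) precat \<Rightarrow> ('o list, nat \<Rightarrow> nat \<Rightarrow> 'm) precat" where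
  "additive_hull C = \<lparr>
     ob = lists (ob C),
     hom = (\<lambda>xs ys. {A. \<forall>i<length ys. \<forall>j<length xs. A i j \<in> hom C (xs ! j) (ys ! i)}),
     eqv = (\<lambda>xs ys A B. \<forall>i<length ys. \<forall>j<length xs. eqv C (xs ! j) (ys ! i) (A i j) (B i j)),
     ident = (\<lambda>xs i j. if i = j then ident C (xs ! i) else zero C (xs ! j) (xs ! i)),
     cmp = (\<lambda>xs ys zs B A i j.
       foldr (\<lambda>l. add C (cmp C (xs ! j) (ys ! l) (zs ! i) (B i l) (A l j)))
         [0..<length ys] (zero C (xs ! j) (zs ! i))),
     add = (\<lambda>A B i j. add C (A i j) (B i j)),
     zero = (\<lambda>xs ys i j. zero C (xs ! j) (ys ! i)) \<rparr>"

definition karoubi :: "('o, 'm) precat \<Rightarrow> ('o \<times> 'm, 'm) precat" where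
  "karoubi C = \<lparr>
     ob = {(X, e). X \<in> ob C \<and> e \<in> hom C X X \<and> eqv C X X (cmp C X X X e e) e},
     hom = (\<lambda>(X, e) (Y, e'). {f \<in> hom C X Y. eqv C X Y (cmp C X Y Y e' (cmp C X X Y f e)) f}),
     eqv = (\<lambda>(X, _) (Y, _). eqv C X Y),
     ident = snd,
     cmp = (\<lambda>(X, _) (Y, _) (Z, _). cmp C X Y Z),
     add = add C,
     zero = (\<lambda>(X, _) (Y, _). zero C X Y) \<rparr>"

text \<open>The quotient of an additive category in which all morphisms factoring through an object
  of \<open>S\<close> become zero. If \<open>S\<close> is closed under direct sums, as below, these morphisms already form
  an ideal.\<close>

definition quot_objects :: "('o, 'm) precat \<Rightarrow> 'o set \<Rightarrow> ('o, 'm) precat" where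
  "quot_objects C S = C\<lparr> eqv := \<lambda>X Y f g.
     \<exists>Z\<in>S. \<exists>a\<in>hom C X Z. \<exists>b\<in>hom C Z Y. eqv C X Y f (add C g (cmp C X Z Y b a)) \<rparr>"

section \<open>Complexes and homotopy equivalence\<close>

text \<open>The differential \<open>diff i\<close> goes from degree \<open>i\<close> to degree \<open>i - 1\<close>.\<close>

record ('o, 'm) complexes =
  obj_at :: "int \<Rightarrow> 'o"
  diff :: "int \<Rightarrow> 'm"

definition is_complex :: "('o, 'm) precat \<Rightarrow> ('o, 'm) complexes \<Rightarrow> bool" where
  "is_complex C X \<longleftrightarrow> (\<forall>i. obj_at X i \<in> ob C \<and> diff X i \<in> hom C (obj_at X i) (obj_at X (i - 1)) \<and>
     eqv C (obj_at X i) (obj_at X (i - 2))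
       (cmp C (obj_at X i) (obj_at X (i - 1)) (obj_at X (i - 2)) (diff X (i - 1)) (diff X i))
       (zero C (obj_at X i) (obj_at X (i - 2))))"

definition chain_map ::
  "('o, 'm) precat \<Rightarrow> ('o, 'm) complexes \<Rightarrow> ('o, 'm) complexes \<Rightarrow> (int \<Rightarrow> 'm) \<Rightarrow> bool" where
  "chain_map C X Y f \<longleftrightarrow> (\<forall>i. f i \<in> hom C (obj_at X i) (obj_at Y i) \<and>
     eqv C (obj_at X i) (obj_at Y (i - 1))
       (cmp C (obj_at X i) (obj_at Y i) (obj_at Y (i - 1)) (diff Y i) (f i))
       (cmp C (obj_at X i) (obj_at X (i - 1)) (obj_at Y (i - 1)) (f (i - 1)) (diff X i)))"

definition homotopic ::
  "('o, 'm) precat \<Rightarrow> ('o, 'm) complexes \<Rightarrow> ('o, 'm) complexes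
    \<Rightarrow> (int \<Rightarrow> 'm) \<Rightarrow> (int \<Rightarrow> 'm) \<Rightarrow> bool" where
  "homotopic C X Y f g \<longleftrightarrow>
     (\<exists>h. \<forall>i. h i \<in> hom C (obj_at X i) (obj_at Y (i + 1)) \<and>
       eqv C (obj_at X i) (obj_at Y i) (f i)
         (add C (g i) (add C
           (cmp C (obj_at X i) (obj_at Y (i + 1)) (obj_at Y i) (diff Y (i + 1)) (h i))
           (cmp C (obj_at X i) (obj_at X (i - 1)) (obj_at Y i) (h (i - 1)) (diff X i)))))"

definition homotopy_equivalent ::
  "('o, 'm) precat \<Rightarrow> ('o, 'm) complexes \<Rightarrow> ('o, 'm) complexes \<Rightarrow> bool" where
  "homotopy_equivalent C X Y \<longleftrightarrow> is_complex C X \<and> is_complex C Y \<and>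
     (\<exists>f g. chain_map C X Y f \<and> chain_map C Y X g \<and>
       homotopic C X X (\<lambda>i. cmp C (obj_at X i) (obj_at Y i) (obj_at X i) (g i) (f i))
         (\<lambda>i. ident C (obj_at X i)) \<and>
       homotopic C Y Y (\<lambda>i. cmp C (obj_at Y i) (obj_at X i) (obj_at Y i) (f i) (g i))
         (\<lambda>i. ident C (obj_at Y i)))"

section \<open>Khovanov's Heisenberg category and its quotients\<close>

definition diagrams :: "(word, 'k::field_char_0 diag) precat" where
  "diagrams = \<lparr>
     ob = UNIV,
     hom = (\<lambda>u v. {f. typed f u v}),
     eqv = diag_eq,
     ident = Ident,
     cmp = (\<lambda>_ _ _ g f. g \<bullet> f),
     add = Plus,
     zero = ZeroD \<rparr>"

type_synonym 'k heis_mor = "nat \<Rightarrow> nat \<Rightarrow> 'k diag"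
type_synonym 'k heis_ob = "word list \<times> 'k heis_mor"

definition heis :: "('k::field_char_0 heis_ob, 'k heis_mor) precat" where
  "heis = karoubi (additive_hull diagrams)"

text \<open>The object \<open>M \<otimes> Q\<^sup>n\<close> of the Karoubi envelope.\<close>

definition tensor_Qpow :: "'k heis_ob \<Rightarrow> nat \<Rightarrow> 'k heis_ob" where
  "tensor_Qpow M n =
     (map (\<lambda>u. u @ Qpow n) (fst M), \<lambda>i j. snd M i j \<diamondop> Ident (Qpow n))"

definition heis_n :: "nat \<Rightarrow> ('k::field_char_0 heis_ob, 'k heis_mor) precat" where
  "heis_n n = quot_objects heis {tensor_Qpow M n | M. M \<in> ob heis}"

section \<open>The complexes\<close>

text \<open>Strands of \<open>P\<^sup>m\<close> are numbered from the left and those of \<open>Q\<^sup>m\<close> from the right, both from \<open>0\<close>.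
  This makes \<open>perm_down\<close> the left-right mirror image of \<open>perm_up\<close>. By the relations, the morphism
  represented does not depend on the expression of a permutation in simple transpositions.\<close>

definition simple_word :: "nat \<Rightarrow> (nat \<Rightarrow> nat) \<Rightarrow> nat list" where
  "simple_word m w = (SOME ks. (\<forall>k\<in>set ks. Suc k < m) \<and>
     w = foldr (\<lambda>k p. transpose k (Suc k) \<circ> p) ks id)"

definition perm_up :: "nat \<Rightarrow> (nat \<Rightarrow> nat) \<Rightarrow> 'k diag" where
  "perm_up m w = foldr
     (\<lambda>k t. (Ident (Ppow k) \<diamondop> Gen Crossing \<diamondop> Ident (Ppow (m - k - 2))) \<bullet> t)
     (simple_word m w) (Ident (Ppow m))"

definition perm_down :: "nat \<Rightarrow> (nat \<Rightarrow> nat) \<Rightarrow> 'k diag" where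
  "perm_down m w = foldr
     (\<lambda>k t. (Ident (Qpow (m - k - 2)) \<diamondop> cross_down \<diamondop> Ident (Qpow k)) \<bullet> t)
     (simple_word m w) (Ident (Qpow m))"

text \<open>The sum over a finite set, in an unspecified order.\<close>

definition diag_sum :: "word \<Rightarrow> word \<Rightarrow> ('a \<Rightarrow> 'k diag) \<Rightarrow> 'a set \<Rightarrow> 'k diag" where
  "diag_sum u v F A = foldr (\<lambda>x. Plus (F x)) (SOME xs. distinct xs \<and> set xs = A) (ZeroD u v)"

definition PQ :: "nat \<Rightarrow> word" where
  "PQ m = Ppow m @ Qpow m"

definition eps :: "nat \<Rightarrow> 'k::field_char_0 diag" where
  "eps m = Scale (1 / fact m)
     (diag_sum (PQ m) (PQ m) (\<lambda>w. Scale (of_int (sign w)) (perm_up m w \<diamondop> perm_down m w))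
       {w. w permutes {..<m}})"

definition inner_cap :: "nat \<Rightarrow> 'k diag" where
  "inner_cap m = Ident (Ppow m) \<diamondop> Gen CapPQ \<diamondop> Ident (Qpow m)"

definition inner_cup :: "nat \<Rightarrow> 'k diag" where
  "inner_cup m = Ident (Ppow m) \<diamondop> Gen CupPQ \<diamondop> Ident (Qpow m)"

text \<open>The image of \<open>eps m\<close>, which is isomorphic to the direct sum of the \<open>P\<^sup>\<lambda> Q\<^sup>\<mu>\<close> for
  partitions \<open>\<lambda>\<close> of \<open>m\<close> with transpose \<open>\<mu>\<close>. The empty direct sum is the zero object.\<close>

definition sigma_obj :: "nat \<Rightarrow> 'k::field_char_0 heis_ob" where
  "sigma_obj m = ([PQ m], \<lambda>_ _. eps m)"

definition zero_obj :: "'k heis_ob" where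
  "zero_obj = ([], \<lambda>_ _. ZeroD [] [])"

definition sigma_minus :: "('k::field_char_0 heis_ob, 'k heis_mor) complexes" where
  "sigma_minus = \<lparr>
     obj_at = (\<lambda>i. if i \<ge> 0 then sigma_obj (nat i) else zero_obj),
     diff = (\<lambda>i _ _. if i \<ge> 1 then eps (nat i - 1) \<bullet> inner_cap (nat i - 1) \<bullet> eps (nat i)
                     else ZeroD [] []) \<rparr>"

definition sigma_plus :: "('k::field_char_0 heis_ob, 'k heis_mor) complexes" where
  "sigma_plus = \<lparr>
     obj_at = (\<lambda>i. if i \<le> 0 then sigma_obj (nat (- i)) else zero_obj),
     diff = (\<lambda>i _ _. if i \<le> 0 then eps (nat (- i) + 1) \<bullet> inner_cup (nat (- i)) \<bullet> eps (nat (- i))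
                     else ZeroD [] []) \<rparr>"

end

theory Submission
  imports Defs
begin

text \<open>
  Let \<open>c\<close> be the clockwise circle, an endomorphism of the unit object. Placing it to the right of
  \<open>P\<^sup>m Q\<^sup>m\<close> commutes with both differentials, and the Laplacian \<open>d\<^sup>- d\<^sup>+ + d\<^sup>+ d\<^sup>-\<close> (suitably scaled)
  equals \<open>c\<close>. So with \<open>e = (1 - c) (1 - c/2) \<dots> (1 - c/(n - 1))\<close> and \<open>c q = 1 - e\<close>, the maps \<open>- d\<^sup>+ q\<close>
  and \<open>- d\<^sup>- q\<close> are homotopies from \<open>e\<close> to the identity of \<open>\<Sigma>\<^sup>-\<close> and \<open>\<Sigma>\<^sup>+\<close>. Sliding the circle
  through one strand \<open>Q\<close> replaces \<open>c\<close> by \<open>c + 1\<close>, so \<open>Q e\<close> is a multiple of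
  \<open>c (c - 1) \<dots> (c - n + 2) Q\<close>, which factors through \<open>n\<close> strands \<open>Q\<close>; hence \<open>e\<close> vanishes in the quotient
  except in degree 0. The equivalence is the identity of the unit object in one direction and \<open>e\<close>
  in the other.
\<close>

section \<open>Diagrams as linear operators\<close>

text \<open>The Laplacian is \<open>c\<close> because antisymmetrizers satisfy (m + 1) A' = A - m A
  s A, where s is the last simple transposition. Placed between a cup and a cap, the first summand
  leaves a circle in the middle of P^m Q^m; this is c - m, since it crosses m strands Q on its way
  to the right end. In the second summand the double crossing relation for Q P turns cap s cup into
  cup cap - 1, whose -1 compensates the -m. The polynomial e answers two demands. It has constant
  term 1, so that 1 - e is divisible by c. After the shift by the last strand Q its roots are 0,
  ..., n - 2, because k nested circles evaluate to c (c - 1) ... (c - k + 1) and visibly pass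
  through Q^k; the last strand Q supplies the n-th. An obstacle of form is that equations between
  diagrams live in many hom spaces and hold only modulo a generated congruence. Letting all diagrams
  act on one space makes ring arithmetic available.\<close>

primrec src :: "'k diag \<Rightarrow> word" where
  "src (Gen g) = gen_dom g"
| "src (Ident u) = u"
| "src (g \<bullet> f) = src f"
| "src (f \<diamondop> g) = src f @ src g"
| "src (ZeroD u v) = u"
| "src (Plus f g) = src f"
| "src (Scale c f) = src f"

primrec tgt :: "'k diag \<Rightarrow> word" where
  "tgt (Gen g) = gen_cod g"
| "tgt (Ident u) = u"
| "tgt (g \<bullet> f) = tgt g"
| "tgt (f \<diamondop> g) = tgt f @ tgt g"
| "tgt (ZeroD u v) = v"
| "tgt (Plus f g) = tgt f"
| "tgt (Scale c f) = tgt f"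

text \<open>Together with \<open>src\<close> and \<open>tgt\<close> this makes typing computable by
  simplification (\<open>typed_iff\<close>): a well-typed expression determines both of its
  words.\<close>

primrec wt :: "'k diag \<Rightarrow> bool" where
  "wt (Gen g) = True"
| "wt (Ident u) = True"
| "wt (g \<bullet> f) = (wt g \<and> wt f \<and> tgt f = src g)"
| "wt (f \<diamondop> g) = (wt f \<and> wt g)"
| "wt (ZeroD u v) = True"
| "wt (Plus f g) = (wt f \<and> wt g \<and> src f = src g \<and> tgt f = tgt g)"
| "wt (Scale c f) = wt f"

lemma typed_wt: "typed f u v \<Longrightarrow> wt f \<and> src f = u \<and> tgt f = v"
  by (induction rule: typed.induct) auto

lemma wt_typed: "wt f \<Longrightarrow> typed f (src f) (tgt f)"
  by (induction f) (auto intro: typed.intros)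

lemma typed_iff: "typed f u v \<longleftrightarrow> wt f \<and> src f = u \<and> tgt f = v"
  using typed_wt wt_typed by blast

lemma diag_eq_typed: "diag_eq u v f g \<Longrightarrow> typed f u v \<and> typed g u v"
  by (induction rule: diag_eq.induct) (auto simp: typed_iff)

declare diag_eq.trans [trans]

text \<open>The congruence has no rules for composing or scaling zero morphisms. Writing zero as a
  multiple by the scalar 0 lets the linearity rules supply them.\<close>

lemma ZeroD_eq_Scale: "diag_eq u v (ZeroD u v) (Scale 0 (ZeroD u v))"
  by (rule diag_eq.sym, rule diag_eq.scale_zero, rule typed.intros)

lemma ZeroD_eq_Scale': "diag_eq u v (ZeroD u v) (Scale c (ZeroD u v))"
proof -
  have "diag_eq u v (Scale c (ZeroD u v)) (Scale c (Scale 0 (ZeroD u v)))"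
    by (rule diag_eq.cong_scale, rule ZeroD_eq_Scale)
  also have "diag_eq u v \<dots> (Scale (c * 0) (ZeroD u v))"
    by (rule diag_eq.sym, rule diag_eq.scale_mult, rule typed.intros)
  also have "diag_eq u v \<dots> (ZeroD u v)"
    using diag_eq.scale_zero[of "ZeroD u v" u v] by (simp add: typed.intros)
  finally show ?thesis by (rule diag_eq.sym)
qed

lemma compose_ZeroD:
  assumes "typed (g :: 'k::field_char_0 diag) v w"
  shows "diag_eq u w (g \<bullet> ZeroD u v) (ZeroD u w)"
proof -
  have "diag_eq u w (g \<bullet> ZeroD u v) (g \<bullet> Scale 0 (ZeroD u v))"
    by (rule diag_eq.cong_compose[OF ZeroD_eq_Scale diag_eq.refl[OF assms]])
  also have "diag_eq u w (g \<bullet> Scale 0 (ZeroD u v)) (Scale 0 (g \<bullet> ZeroD u v))"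
    using assms by (intro diag_eq.compose_scale_right) (auto simp: typed_iff)
  also have "diag_eq u w (Scale 0 (g \<bullet> ZeroD u v)) (ZeroD u w)"
    using assms by (intro diag_eq.scale_zero) (auto simp: typed_iff)
  finally show ?thesis .
qed

lemma plus_Scale_minus:
  assumes "typed (f :: 'k::field_char_0 diag) u v"
  shows "diag_eq u v (Plus (Scale (-1) f) f) (ZeroD u v)"
proof -
  have "diag_eq u v (Plus (Scale (-1) f) f) (Plus (Scale (-1) f) (Scale 1 f))"
    using assms by (intro diag_eq.cong_plus diag_eq.refl diag_eq.sym[OF diag_eq.scale_one])
      (auto simp: typed_iff)
  also have "diag_eq u v \<dots> (Scale (-1 + 1) f)"
    using assms by (intro diag_eq.sym[OF diag_eq.scale_add])
  also have "diag_eq u v \<dots> (ZeroD u v)"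
    using diag_eq.scale_zero[OF assms] by simp
  finally show ?thesis .
qed

text \<open>Vectors are families of morphism classes, one for every pair of words. Diagrams act on them
  faithfully by postcomposition, which turns equations between diagrams of all types into equations
  in one ring (without assuming \<open>0 \<noteq> 1\<close>, which would require a model of the relations).\<close>

definition fam_eq :: "(word \<Rightarrow> word \<Rightarrow> 'k::field_char_0 diag) \<Rightarrow> (word \<Rightarrow> word \<Rightarrow> 'k diag) \<Rightarrow> bool" where
  "fam_eq x y \<longleftrightarrow> (\<forall>u v. diag_eq u v (x u v) (y u v))"

\<comment> \<open>Reflexivity fails at families with an ill-typed entry, hence a partial
  equivalence.\<close>
quotient_type (overloaded) 'k fam = "word \<Rightarrow> word \<Rightarrow> 'k::field_char_0 diag" /
  partial: fam_eq
proof (rule part_equivpI)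
  show "\<exists>x. fam_eq x (x :: word \<Rightarrow> word \<Rightarrow> 'k diag)"
    unfolding fam_eq_def by (rule exI[of _ ZeroD]) (auto intro: diag_eq.refl typed.intros)
  show "symp (fam_eq :: _ \<Rightarrow> (word \<Rightarrow> word \<Rightarrow> 'k diag) \<Rightarrow> _)"
    unfolding fam_eq_def by (auto intro!: sympI intro: diag_eq.sym)
  show "transp (fam_eq :: _ \<Rightarrow> (word \<Rightarrow> word \<Rightarrow> 'k diag) \<Rightarrow> _)"
    unfolding fam_eq_def by (intro transpI) (blast intro: diag_eq.trans)
qed

lemma fam_eq_typed: "fam_eq x y \<Longrightarrow> typed (x u v) u v" "fam_eq x y \<Longrightarrow> typed (y u v) u v"
  unfolding fam_eq_def using diag_eq_typed by blast+

lemma fam_eqD: "fam_eq x y \<Longrightarrow> diag_eq u v (x u v) (y u v)"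
  by (simp add: fam_eq_def)

instantiation fam :: (field_char_0) ab_group_add
begin

lift_definition zero_fam :: "'a fam" is "\<lambda>u v. ZeroD u v"
  unfolding fam_eq_def by (auto intro: diag_eq.refl typed.intros)
lift_definition plus_fam :: "'a fam \<Rightarrow> 'a fam \<Rightarrow> 'a fam" is
  "\<lambda>x y u v. Plus (x u v) (y u v)"
  by (auto intro: diag_eq.cong_plus simp: fam_eq_def)
lift_definition uminus_fam :: "'a fam \<Rightarrow> 'a fam" is
  "\<lambda>x u v. Scale (-1) (x u v)"
  by (auto intro: diag_eq.cong_scale simp: fam_eq_def)
definition minus_fam :: "'a fam \<Rightarrow> 'a fam \<Rightarrow> 'a fam" where
  "minus_fam x y = x + (- y)"

instance
proof
  fix x y z :: "'a fam"
  show "x + y + z = x + (y + z)"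
    by (transfer, unfold fam_eq_def) (meson diag_eq.plus_assoc diag_eq_typed)
  show "x + y = y + x"
    by (transfer, unfold fam_eq_def) (meson diag_eq.plus_commute diag_eq_typed)
  show "0 + x = x"
    by (transfer, unfold fam_eq_def) (meson diag_eq.plus_zero diag_eq_typed)
  show "- x + x = 0"
    by (transfer, unfold fam_eq_def) (meson plus_Scale_minus diag_eq_typed)
  show "x - y = x + - y"
    by (simp add: minus_fam_def)
qed

end

lift_definition scale_fam :: "'k::field_char_0 \<Rightarrow> 'k fam \<Rightarrow> 'k fam" is
  "\<lambda>c x u v. Scale c (x u v)"
  by (auto intro: diag_eq.cong_scale simp: fam_eq_def)

lemma scale_fam_add_right: "scale_fam c (x + y) = scale_fam c x + scale_fam c y"
  by (transfer, unfold fam_eq_def) (meson diag_eq.scale_plus diag_eq_typed)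
lemma scale_fam_add_left: "scale_fam (a + b) x = scale_fam a x + scale_fam b x"
  by (transfer, unfold fam_eq_def) (meson diag_eq.scale_add diag_eq_typed)
lemma scale_fam_mult: "scale_fam (a * b) x = scale_fam a (scale_fam b x)"
  by (transfer, unfold fam_eq_def) (meson diag_eq.scale_mult diag_eq_typed)
lemma scale_fam_one: "scale_fam 1 x = x"
  by (transfer, unfold fam_eq_def) (meson diag_eq.scale_one diag_eq_typed)
lemma scale_fam_zero: "scale_fam 0 x = 0"
  by (transfer, unfold fam_eq_def) (meson diag_eq.scale_zero diag_eq_typed)

text \<open>Like a matrix unit: the entries with target \<open>src f\<close> are moved to target
  \<open>tgt f\<close>, all others are dropped. Ill-typed expressions act as zero, which is why
  \<open>op_of_compose\<close> and \<open>op_of_Scale\<close> hold without typing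
  hypotheses.\<close>

lift_definition act :: "'k::field_char_0 diag \<Rightarrow> 'k fam \<Rightarrow> 'k fam" is
  "\<lambda>f x u v. if wt f \<and> tgt f = v then f \<bullet> x u (src f) else ZeroD u v"
  by (auto intro!: diag_eq.cong_compose diag_eq.refl wt_typed typed.intros simp: fam_eq_def)

text \<open>Additivity gives left distributivity of composition, homogeneity makes the scalars
  central.\<close>

typedef (overloaded) 'k oper = "{F :: 'k::field_char_0 fam \<Rightarrow> 'k fam.
    (\<forall>x y. F (x + y) = F x + F y) \<and> (\<forall>c x. F (scale_fam c x) = scale_fam c (F x))}"
  by (rule exI[of _ id]) auto

setup_lifting type_definition_oper

instantiation oper :: (field_char_0) "{ring, monoid_mult}"
begin

lift_definition zero_oper :: "'a oper" is "\<lambda>_. 0"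
  by (metis add_0 scale_fam_zero scale_fam_mult mult_zero_right)
lift_definition one_oper :: "'a oper" is "\<lambda>x. x"
  by auto
lift_definition plus_oper :: "'a oper \<Rightarrow> 'a oper \<Rightarrow> 'a oper" is "\<lambda>F G x. F x + G x"
  by (auto simp: scale_fam_add_right algebra_simps)
lift_definition uminus_oper :: "'a oper \<Rightarrow> 'a oper" is "\<lambda>F x. - F x"
proof -
  fix F :: "'a fam \<Rightarrow> 'a fam"
  assume "(\<forall>x y. F (x + y) = F x + F y) \<and> (\<forall>c x. F (scale_fam c x) = scale_fam c (F x))"
  moreover have "scale_fam c (- x) = - scale_fam c x" for c :: 'a and x
    by (metis (full_types) add.right_inverse add_eq_0_iff scale_fam_add_right scale_fam_zero
        scale_fam_mult mult_zero_right)
  ultimately show "(\<forall>x y. - F (x + y) = - F x + - F y) \<and>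
      (\<forall>c x. - F (scale_fam c x) = scale_fam c (- F x))"
    by auto
qed
definition minus_oper :: "'a oper \<Rightarrow> 'a oper \<Rightarrow> 'a oper" where
  "minus_oper F G = F + (- G)"
lift_definition times_oper :: "'a oper \<Rightarrow> 'a oper \<Rightarrow> 'a oper" is "\<lambda>F G x. F (G x)"
  by auto

instance
proof
  fix F G H :: "'a oper"
  note [simp] = Rep_oper_inject[symmetric] zero_oper.rep_eq one_oper.rep_eq plus_oper.rep_eq
    uminus_oper.rep_eq times_oper.rep_eq fun_eq_iff
  have [simp]: "Rep_oper F (x + y) = Rep_oper F x + Rep_oper F y" for x y
    using Rep_oper[of F] by auto
  show "F + G + H = F + (G + H)" "F + G = G + F" by (simp_all add: algebra_simps)
  show "0 + F = F" "- F + F = 0" "1 * F = F" "F * 1 = F" "F * G * H = F * (G * H)" by simp_all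
  show "F - G = F + - G" by (simp add: minus_oper_def)
  show "F * (G + H) = F * G + F * H" "(G + H) * F = G * F + H * F" by simp_all
qed

end

lift_definition scalar :: "'k::field_char_0 \<Rightarrow> 'k oper" is scale_fam
  by (auto simp: scale_fam_add_right scale_fam_mult[symmetric] mult.commute)

lemma scalar_add: "scalar (a + b) = scalar a + scalar b"
  by transfer (auto simp: scale_fam_add_left)
lemma scalar_mult: "scalar (a * b) = scalar a * scalar b"
  by transfer (auto simp: scale_fam_mult)
lemma scalar_one [simp]: "scalar 1 = 1"
  by transfer (auto simp: scale_fam_one)
lemma scalar_zero [simp]: "scalar 0 = 0"
  by transfer (auto simp: scale_fam_zero)
lemma scalar_commute: "x * scalar c = scalar c * x"
  by transfer auto
lemma scalar_left_commute: "x * (scalar c * y) = scalar c * (x * y)"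
  by (metis mult.assoc scalar_commute)
lemma scalar_minus: "scalar (- a) = - scalar a"
  by (metis add.right_inverse add_eq_0_iff scalar_add scalar_zero)

lift_definition op_of :: "'k::field_char_0 diag \<Rightarrow> 'k oper" is act
proof (intro conjI allI)
  fix f :: "'k diag" and x y and c :: 'k
  show "act f (x + y) = act f x + act f y"
  proof transfer
    fix f :: "'k diag" and x y :: "word \<Rightarrow> word \<Rightarrow> 'k diag"
    assume *: "fam_eq x x" "fam_eq y y"
    show "fam_eq (\<lambda>u v. if wt f \<and> tgt f = v then f \<bullet> Plus (x u (src f)) (y u (src f)) else ZeroD u v)
      (\<lambda>u v. Plus (if wt f \<and> tgt f = v then f \<bullet> x u (src f) else ZeroD u v)
        (if wt f \<and> tgt f = v then f \<bullet> y u (src f) else ZeroD u v))"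
      unfolding fam_eq_def
      using diag_eq.compose_plus_right[OF fam_eq_typed(1)[OF *(1)] fam_eq_typed(1)[OF *(2)] wt_typed]
      by (auto simp: diag_eq.sym[OF diag_eq.plus_zero] typed.intros)
  qed
  show "act f (scale_fam c x) = scale_fam c (act f x)"
  proof transfer
    fix f :: "'k diag" and c :: 'k and x :: "word \<Rightarrow> word \<Rightarrow> 'k diag"
    assume *: "fam_eq x x"
    from * show "fam_eq (\<lambda>u v.
      if wt f \<and> tgt f = v then f \<bullet> Scale c (x u (src f)) else ZeroD u v)
      (\<lambda>u v. Scale c (if wt f \<and> tgt f = v then f \<bullet> x u (src f) else ZeroD u v))"
      unfolding fam_eq_def
      using diag_eq.compose_scale_right[OF fam_eq_typed(1)[OF *] wt_typed]
      by (auto simp: ZeroD_eq_Scale')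
  qed
qed

lemma op_of_compose: "op_of (g \<bullet> f) = op_of g * op_of (f :: 'k::field_char_0 diag)"
proof (transfer, rule ext)
  fix g f :: "'k diag" and x
  show "act (g \<bullet> f) x = act g (act f x)"
  proof transfer
    fix g f :: "'k diag" and x :: "word \<Rightarrow> word \<Rightarrow> 'k diag"
    assume *: "fam_eq x x"
    show "fam_eq (\<lambda>u v. if wt (g \<bullet> f) \<and> tgt (g \<bullet> f) = v then (g \<bullet> f) \<bullet> x u (src (g \<bullet> f)) else ZeroD u v)
      (\<lambda>u v. if wt g \<and> tgt g = v then g \<bullet> (if wt f \<and> tgt f = src g then f \<bullet> x u (src f) else ZeroD u (src g))
        else ZeroD u v)"
      unfolding fam_eq_def using fam_eq_typed(1)[OF *]
      by (auto intro!: diag_eq.compose_assoc wt_typed diag_eq.refl diag_eq.sym[OF compose_ZeroD]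
        typed.intros(5))
  qed
qed

lemma ZeroD_compose:
  assumes "typed (f :: 'k::field_char_0 diag) w u"
  shows "diag_eq w v (ZeroD u v \<bullet> f) (ZeroD w v)"
proof -
  have "diag_eq w v (ZeroD u v \<bullet> f) (Scale 0 (ZeroD u v) \<bullet> f)"
    by (rule diag_eq.cong_compose[OF diag_eq.refl[OF assms] ZeroD_eq_Scale])
  also have "diag_eq w v \<dots> (Scale 0 (ZeroD u v \<bullet> f))"
    by (rule diag_eq.compose_scale_left[OF assms]) (rule typed.intros)
  also have "diag_eq w v \<dots> (ZeroD w v)"
    using assms by (intro diag_eq.scale_zero) (auto simp: typed_iff)
  finally show ?thesis .
qed

lemma op_of_ZeroD [simp]: "op_of (ZeroD u v) = 0"
proof (transfer, rule ext)
  fix u v and x :: "'a fam"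
  show "act (ZeroD u v) x = 0"
  proof transfer
    fix u v and x :: "word \<Rightarrow> word \<Rightarrow> 'a diag"
    assume *: "fam_eq x x"
    show "fam_eq (\<lambda>w z. if wt (ZeroD u v :: 'a diag) \<and> tgt (ZeroD u v :: 'a diag) = z
        then ZeroD u v \<bullet> x w (src (ZeroD u v :: 'a diag)) else ZeroD w z) ZeroD"
      unfolding fam_eq_def using ZeroD_compose[OF fam_eq_typed(1)[OF *]]
      by (auto intro: diag_eq.refl typed.intros)
  qed
qed

lemma op_of_eq:
  assumes "diag_eq u v f (g :: 'k::field_char_0 diag)"
  shows "op_of f = op_of g"
  using assms
proof (transfer, intro ext)
  fix u v and f g :: "'k diag" and x
  assume eq: "diag_eq u v f g"
  note * = diag_eq_typed[OF eq, unfolded typed_iff]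
  show "act f x = act g x"
    using eq *
  proof transfer
    fix u v and f g :: "'k diag" and x :: "word \<Rightarrow> word \<Rightarrow> 'k diag"
    assume x: "fam_eq x x" and eq: "diag_eq u v f g"
      and *: "(wt f \<and> src f = u \<and> tgt f = v) \<and> wt g \<and> src g = u \<and> tgt g = v"
    show "fam_eq (\<lambda>u v. if wt f \<and> tgt f = v then f \<bullet> x u (src f) else ZeroD u v)
      (\<lambda>u v. if wt g \<and> tgt g = v then g \<bullet> x u (src g) else ZeroD u v)"
      unfolding fam_eq_def using * diag_eq.cong_compose[OF fam_eqD[OF x] eq]
      by (simp add: diag_eq.refl typed.intros)
  qed
qed

lift_definition unit_fam :: "word \<Rightarrow> 'k::field_char_0 fam" is
  "\<lambda>w u v. if u = w \<and> v = w then Ident w else ZeroD u v"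
  unfolding fam_eq_def by (auto intro: diag_eq.refl typed.intros)

text \<open>Faithfulness: the family whose only entry other than \<open>ZeroD\<close> is the
  identity of \<open>u\<close> is sent to a family containing \<open>f \<bullet> Ident u\<close>,
  from which \<open>f\<close> is recovered.\<close>

lemma op_of_eqD:
  assumes "op_of f = op_of (g :: 'k::field_char_0 diag)" and "typed f u v" "typed g u v"
  shows "diag_eq u v f g"
proof -
  have "act f (unit_fam u) = act g (unit_fam u)"
    using assms(1) by (metis op_of.rep_eq)
  hence "diag_eq u v (f \<bullet> Ident u) (g \<bullet> Ident u)"
    using assms(2,3)
  proof transfer
    fix f g :: "'k diag" and u v
    let ?x = "\<lambda>a b. if a = u \<and> b = u then Ident u else ZeroD a b"
    assume "fam_eq (\<lambda>a b. if wt f \<and> tgt f = b then f \<bullet> ?x a (src f) else ZeroD a b)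
       (\<lambda>a b. if wt g \<and> tgt g = b then g \<bullet> ?x a (src g) else ZeroD a b)"
      and "typed f u v" "typed g u v"
    from fam_eqD[OF this(1), of u v] this(2,3) show "diag_eq u v (f \<bullet> Ident u) (g \<bullet> Ident u)"
      by (simp add: typed_iff)
  qed
  thus ?thesis
    using assms(2,3) by (meson diag_eq.compose_id_right diag_eq.sym diag_eq.trans)
qed

lemma op_of_Plus:
  assumes "wt f" "wt g" "src f = src g" "tgt f = tgt g"
  shows "op_of (Plus f g) = op_of f + op_of g"
  using assms
proof (transfer, intro ext)
  fix f g :: "'a diag" and x
  assume *: "wt f" "wt g" "src f = src g" "tgt f = tgt g"
  show "act (Plus f g) x = act f x + act g x"
    using *
  proof transfer
    fix f g :: "'a diag" and x :: "word \<Rightarrow> word \<Rightarrow> 'a diag"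
    assume x: "fam_eq x x" and *: "wt f" "wt g" "src f = src g" "tgt f = tgt g"
    show "fam_eq (\<lambda>u v. if wt (Plus f g) \<and> tgt (Plus f g) = v
        then Plus f g \<bullet> x u (src (Plus f g)) else ZeroD u v)
      (\<lambda>u v. Plus (if wt f \<and> tgt f = v then f \<bullet> x u (src f) else ZeroD u v)
        (if wt g \<and> tgt g = v then g \<bullet> x u (src g) else ZeroD u v))"
      unfolding fam_eq_def
      using * diag_eq.compose_plus_left[OF fam_eq_typed(1)[OF x] wt_typed[OF *(1)], of g] wt_typed[OF *(2)]
      by (auto intro!: diag_eq.sym[OF diag_eq.plus_zero] typed.intros(5))
  qed
qed

lemma op_of_ill_typed: "\<not> wt f \<Longrightarrow> op_of f = 0"
proof (transfer, rule ext)
  fix f :: "'a diag" and x assume "\<not> wt f"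
  thus "act f x = 0"
    by transfer (auto intro: diag_eq.refl typed.intros simp: fam_eq_def)
qed

lemma op_of_Scale: "op_of (Scale c f) = scalar c * op_of (f :: 'k::field_char_0 diag)"
proof (cases "wt f")
  case True
  have "act (Scale c f) x = scale_fam c (act f x)" for x
    using True
  proof transfer
    fix f :: "'k diag" and c :: 'k and x :: "word \<Rightarrow> word \<Rightarrow> 'k diag"
    assume *: "fam_eq x x" "wt f"
    from * show "fam_eq (\<lambda>u v.
      if wt (Scale c f) \<and> tgt (Scale c f) = v then Scale c f \<bullet> x u (src (Scale c f)) else ZeroD u v)
      (\<lambda>u v. Scale c (if wt f \<and> tgt f = v then f \<bullet> x u (src f) else ZeroD u v))"
      unfolding fam_eq_def
      using diag_eq.compose_scale_left[OF fam_eq_typed(1)[OF *(1)] wt_typed[OF *(2)]]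
      by (auto simp: ZeroD_eq_Scale')
  qed
  thus ?thesis
    by (simp add: Rep_oper_inject[symmetric] fun_eq_iff op_of.rep_eq times_oper.rep_eq scalar.rep_eq)
next
  case False
  thus ?thesis by (simp add: op_of_ill_typed)
qed

section \<open>Whiskering\<close>

text \<open>Operators have no tensor product, so diagrams are cut into horizontal slices with a
  single nonidentity factor.\<close>

definition whisk :: "word \<Rightarrow> 'k::field_char_0 diag \<Rightarrow> word \<Rightarrow> 'k oper" where
  "whisk a f b = op_of (Ident a \<diamondop> f \<diamondop> Ident b)"

text \<open>An identity diagram is a projection and not the unit of the ring, since operators act on
  the hom spaces of all words at once.\<close>

abbreviation proj :: "word \<Rightarrow> 'k::field_char_0 oper" where
  "proj u \<equiv> op_of (Ident u)"

lemma op_of_id_left: "wt f \<Longrightarrow> tgt f = v \<Longrightarrow> proj v * op_of f = op_of f"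
  using op_of_eq[OF diag_eq.compose_id_left[OF wt_typed]] by (metis op_of_compose)

lemma op_of_id_right: "wt f \<Longrightarrow> src f = u \<Longrightarrow> op_of f * proj u = op_of f"
  using op_of_eq[OF diag_eq.compose_id_right[OF wt_typed]] by (metis op_of_compose)

text \<open>The congruence rule for tensor products lives on diagrams, so the equations are pulled
  back by faithfulness; this is where the typing hypotheses come from.\<close>

lemma op_of_tensor_cong:
  assumes "op_of f = op_of f'" "op_of g = op_of g'" "wt f" "wt f'" "wt g" "wt g'"
    "src f = src f'" "tgt f = tgt f'" "src g = src g'" "tgt g = tgt g'"
  shows "op_of (f \<diamondop> g) = op_of (f' \<diamondop> g')"
  by (rule op_of_eq[OF diag_eq.cong_tensor[OF op_of_eqD[OF assms(1)] op_of_eqD[OF assms(2)]]])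
    (use assms in \<open>auto simp: typed_iff\<close>)

lemma op_of_tensor_cong_right:
  assumes "op_of g = op_of g'" "wt f" "wt g" "wt g'" "src g = src g'" "tgt g = tgt g'"
  shows "op_of (f \<diamondop> g) = op_of (f \<diamondop> g')"
  by (rule op_of_tensor_cong) (use assms in auto)

lemma op_of_tensor_compose:
  assumes "wt f" "wt g" "wt f'" "wt g'" "tgt f = src g" "tgt f' = src g'"
  shows "op_of ((g \<bullet> f) \<diamondop> (g' \<bullet> f')) = op_of (g \<diamondop> g') * op_of (f \<diamondop> f')"
  using op_of_eq[OF diag_eq.interchange[of f "src f" "tgt f" g "tgt g" f' "src f'" "tgt f'" g' "tgt g'"]]
  assms by (simp add: op_of_compose typed_iff)

lemma op_of_tensor1:
  assumes "wt f" "wt g"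
  shows "op_of (f \<diamondop> g) = op_of (Ident (tgt f) \<diamondop> g) * op_of (f \<diamondop> Ident (src g))"
proof -
  have "op_of (f \<diamondop> g) = op_of ((Ident (tgt f) \<bullet> f) \<diamondop> (g \<bullet> Ident (src g)))"
    by (rule op_of_tensor_cong) (use assms in \<open>auto simp: op_of_compose op_of_id_left op_of_id_right\<close>)
  thus ?thesis
    using assms by (subst (asm) op_of_tensor_compose) auto
qed

lemma op_of_tensor2:
  assumes "wt f" "wt g"
  shows "op_of (f \<diamondop> g) = op_of (f \<diamondop> Ident (tgt g)) * op_of (Ident (src f) \<diamondop> g)"
proof -
  have "op_of (f \<diamondop> g) = op_of ((f \<bullet> Ident (src f)) \<diamondop> (Ident (tgt g) \<bullet> g))"
    by (rule op_of_tensor_cong) (use assms in \<open>auto simp: op_of_compose op_of_id_left op_of_id_right\<close>)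
  thus ?thesis
    using assms by (subst (asm) op_of_tensor_compose) auto
qed

lemma op_of_tensor_assoc:
  assumes "wt f" "wt g" "wt h"
  shows "op_of ((f \<diamondop> g) \<diamondop> h) = op_of (f \<diamondop> g \<diamondop> h)"
  by (rule op_of_eq, rule diag_eq.tensor_assoc) (rule wt_typed, fact assms)+

lemma op_of_Ident_tensor: "op_of (Ident u \<diamondop> Ident v) = (proj (u @ v) :: 'k::field_char_0 oper)"
  by (rule op_of_eq[OF diag_eq.tensor_id])

lemma op_of_tensor_unit: "wt f \<Longrightarrow> op_of (f \<diamondop> Ident []) = op_of f" "wt f \<Longrightarrow> op_of (Ident [] \<diamondop> f) = op_of f"
  using op_of_eq[OF diag_eq.tensor_unit_right[OF wt_typed]]
    op_of_eq[OF diag_eq.tensor_unit_left[OF wt_typed]] by auto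

lemma whisk_Ident: "whisk a (Ident u) b = proj (a @ u @ b)"
proof -
  have "op_of (Ident a \<diamondop> Ident u \<diamondop> Ident b) = op_of (Ident a \<diamondop> Ident (u @ b) :: 'a diag)"
    by (rule op_of_tensor_cong) (auto simp: op_of_Ident_tensor)
  thus ?thesis by (simp add: whisk_def op_of_Ident_tensor)
qed

lemma whisk_eq:
  assumes "op_of f = op_of g" "wt f" "wt g" "src f = src g" "tgt f = tgt g"
  shows "whisk a f b = whisk a g b"
  unfolding whisk_def by (rule op_of_tensor_cong, simp, rule op_of_tensor_cong) (use assms in auto)

lemma whisk_local_rel:
  assumes "local_rel f g" "wt f" "wt g" "src f = src g" "tgt f = tgt g"
  shows "whisk a f b = whisk a g b"
  by (rule whisk_eq, rule op_of_eq[OF diag_eq.relation]) (use assms in \<open>auto simp: typed_iff\<close>)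

lemma whisk_Nil: "wt f \<Longrightarrow> whisk [] f [] = op_of f"
  by (simp add: whisk_def op_of_tensor_unit)

lemma whisk_Nil_left: "wt f \<Longrightarrow> whisk [] f b = op_of (f \<diamondop> Ident b)"
  by (simp add: whisk_def op_of_tensor_unit)

lemma whisk_Nil_right: "wt f \<Longrightarrow> whisk a f [] = op_of (Ident a \<diamondop> f)"
  unfolding whisk_def by (rule op_of_tensor_cong) (auto simp: op_of_tensor_unit)

lemma whisk_id_left: "wt f \<Longrightarrow> v = a @ tgt f @ b \<Longrightarrow> proj v * whisk a f b = whisk a f b"
  unfolding whisk_def by (intro op_of_id_left) auto

lemma whisk_id_right: "wt f \<Longrightarrow> u = a @ src f @ b \<Longrightarrow> whisk a f b * proj u = whisk a f b"
  unfolding whisk_def by (intro op_of_id_right) auto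

lemma whisk_whisk:
  assumes "wt f"
  shows "whisk a (Ident u \<diamondop> f \<diamondop> Ident v) b = whisk (a @ u) f (v @ b)"
proof -
  have "op_of ((Ident u \<diamondop> f \<diamondop> Ident v) \<diamondop> Ident b) = op_of (Ident u \<diamondop> (f \<diamondop> Ident v) \<diamondop> Ident b)"
    using assms by (subst op_of_tensor_assoc) auto
  also have "\<dots> = op_of (Ident u \<diamondop> f \<diamondop> Ident v \<diamondop> Ident b)"
    by (rule op_of_tensor_cong) (use assms in \<open>auto simp: op_of_tensor_assoc\<close>)
  also have "\<dots> = op_of (Ident u \<diamondop> f \<diamondop> Ident (v @ b))"
    by (rule op_of_tensor_cong, simp, rule op_of_tensor_cong)
      (use assms in \<open>auto simp: op_of_Ident_tensor\<close>)
  finally have "whisk a (Ident u \<diamondop> f \<diamondop> Ident v) b = op_of (Ident a \<diamondop> Ident u \<diamondop> f \<diamondop> Ident (v @ b))"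
    unfolding whisk_def by (rule op_of_tensor_cong_right) (use assms in auto)
  also have "\<dots> = op_of ((Ident a \<diamondop> Ident u) \<diamondop> f \<diamondop> Ident (v @ b))"
    using assms by (subst op_of_tensor_assoc) auto
  also have "\<dots> = op_of (Ident (a @ u) \<diamondop> f \<diamondop> Ident (v @ b))"
    by (rule op_of_tensor_cong) (use assms in \<open>auto simp: op_of_Ident_tensor\<close>)
  finally show ?thesis by (simp add: whisk_def)
qed

lemma whisk_compose:
  assumes "wt f" "wt g" "tgt f = src g"
  shows "whisk a (g \<bullet> f) b = whisk a g b * whisk a f b"
proof -
  have "op_of (Ident a \<diamondop> (g \<bullet> f) \<diamondop> Ident b)
      = op_of ((Ident a \<bullet> Ident a) \<diamondop> (g \<bullet> f) \<diamondop> (Ident b \<bullet> Ident b))"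
    by (rule op_of_tensor_cong, simp add: op_of_compose op_of_id_left, rule op_of_tensor_cong_right)
      (use assms in \<open>auto simp: op_of_compose op_of_id_left\<close>)
  also have "op_of ((g \<bullet> f) \<diamondop> (Ident b \<bullet> Ident b)) = op_of ((g \<diamondop> Ident b) \<bullet> (f \<diamondop> Ident b))"
    using assms by (simp add: op_of_compose op_of_tensor_compose)
  hence "op_of ((Ident a \<bullet> Ident a) \<diamondop> (g \<bullet> f) \<diamondop> (Ident b \<bullet> Ident b))
      = op_of ((Ident a \<bullet> Ident a) \<diamondop> ((g \<diamondop> Ident b) \<bullet> (f \<diamondop> Ident b)))"
    by (rule op_of_tensor_cong_right) (use assms in auto)
  also have "\<dots> = whisk a g b * whisk a f b"
    using assms by (subst op_of_tensor_compose) (auto simp: whisk_def)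
  finally show ?thesis by (simp add: whisk_def)
qed

lemma whisk_tensor_Ident:
  assumes "wt f"
  shows "whisk a (f \<diamondop> Ident v) b = whisk a f (v @ b)" "whisk a (Ident v \<diamondop> f) b = whisk (a @ v) f b"
proof -
  have "whisk a (f \<diamondop> Ident v) b = whisk a (Ident [] \<diamondop> f \<diamondop> Ident v) b"
    by (rule whisk_eq) (use assms in \<open>auto simp: op_of_tensor_unit\<close>)
  thus "whisk a (f \<diamondop> Ident v) b = whisk a f (v @ b)"
    using whisk_whisk[OF assms, of a "[]" v b] by simp
  have "op_of (Ident v \<diamondop> f) = op_of (Ident v \<diamondop> f \<diamondop> Ident [])"
    by (rule op_of_tensor_cong_right) (use assms in \<open>auto simp: op_of_tensor_unit\<close>)
  hence "whisk a (Ident v \<diamondop> f) b = whisk a (Ident v \<diamondop> f \<diamondop> Ident []) b"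
    by (rule whisk_eq) (use assms in auto)
  thus "whisk a (Ident v \<diamondop> f) b = whisk (a @ v) f b"
    using whisk_whisk[OF assms, of a v "[]" b] by simp
qed

lemma whisk_tensor:
  assumes "wt f" "wt g"
  shows "whisk a (f \<diamondop> g) b = whisk (a @ tgt f) g b * whisk a f (src g @ b)"
proof -
  have "whisk a (f \<diamondop> g) b = whisk a ((Ident (tgt f) \<diamondop> g) \<bullet> (f \<diamondop> Ident (src g))) b"
    using op_of_tensor1[OF assms] assms by (intro whisk_eq) (auto simp only: op_of_compose wt.simps src.simps tgt.simps)
  thus ?thesis using assms by (simp add: whisk_compose whisk_tensor_Ident)
qed

lemma whisk_tensor':
  assumes "wt f" "wt g"
  shows "whisk a (f \<diamondop> g) b = whisk a f (tgt g @ b) * whisk (a @ src f) g b"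
proof -
  have "whisk a (f \<diamondop> g) b = whisk a ((f \<diamondop> Ident (tgt g)) \<bullet> (Ident (src f) \<diamondop> g)) b"
    using op_of_tensor2[OF assms] assms by (intro whisk_eq) (auto simp only: op_of_compose wt.simps src.simps tgt.simps)
  thus ?thesis using assms by (simp add: whisk_compose whisk_tensor_Ident)
qed

text \<open>Two disjoint pieces of a diagram exchange their heights, with the strands
  \<open>b\<close> running between them. The sliding arguments below are instances.\<close>

lemma whisk_interchange:
  assumes "wt f" "wt g"
  shows "whisk (a @ tgt f @ b) g c * whisk a f (b @ src g @ c)
       = whisk a f (b @ tgt g @ c) * whisk (a @ src f @ b) g c"
  using whisk_tensor[of f "Ident b \<diamondop> g" a c] whisk_tensor'[of f "Ident b \<diamondop> g" a c] assms
  by (simp add: whisk_tensor_Ident)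

lemma whisk_Plus:
  assumes "wt f" "wt g" "src f = src g" "tgt f = tgt g"
  shows "whisk a (Plus f g) b = whisk a f b + (whisk a g b :: 'k::field_char_0 oper)"
proof -
  have "op_of (Plus f g \<diamondop> Ident b) = op_of (Plus (f \<diamondop> Ident b) (g \<diamondop> Ident b) :: 'k diag)"
    by (rule op_of_eq[OF diag_eq.tensor_plus_left]) (use assms in \<open>auto simp: typed_iff\<close>)
  hence "whisk a (Plus f g) b = op_of (Ident a \<diamondop> (Plus (f \<diamondop> Ident b) (g \<diamondop> Ident b)))"
    unfolding whisk_def by (rule op_of_tensor_cong_right) (use assms in auto)
  also have "\<dots> = op_of (Plus (Ident a \<diamondop> f \<diamondop> Ident b) (Ident a \<diamondop> g \<diamondop> Ident b))"
    by (rule op_of_eq[OF diag_eq.tensor_plus_right]) (use assms in \<open>auto simp: typed_iff\<close>)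
  finally show ?thesis using assms by (simp add: whisk_def op_of_Plus)
qed

lemma whisk_Scale:
  assumes "wt f"
  shows "whisk a (Scale c f) b = scalar c * (whisk a f b :: 'k::field_char_0 oper)"
proof -
  have "op_of (Scale c f \<diamondop> Ident b) = op_of (Scale c (f \<diamondop> Ident b) :: 'k diag)"
    by (rule op_of_eq[OF diag_eq.tensor_scale_left]) (use assms in \<open>auto simp: typed_iff\<close>)
  hence "whisk a (Scale c f) b = op_of (Ident a \<diamondop> (Scale c (f \<diamondop> Ident b)))"
    unfolding whisk_def by (rule op_of_tensor_cong_right) (use assms in auto)
  also have "\<dots> = op_of (Scale c (Ident a \<diamondop> f \<diamondop> Ident b))"
    by (rule op_of_eq[OF diag_eq.tensor_scale_right]) (use assms in \<open>auto simp: typed_iff\<close>)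
  finally show ?thesis by (simp add: whisk_def op_of_Scale)
qed

section \<open>The Coxeter presentation of the symmetric group\<close>

definition swaps :: "nat list \<Rightarrow> nat \<Rightarrow> nat" where
  "swaps ks = foldr (\<lambda>k p. transpose k (Suc k) \<circ> p) ks id"

lemma swaps_simps [simp]: "swaps [] = id" "swaps (k # ks) = transpose k (Suc k) \<circ> swaps ks"
  by (simp_all add: swaps_def)

lemma swaps_append: "swaps (ks @ ls) = swaps ks \<circ> swaps ls"
  by (induction ks) (simp_all add: o_assoc)

lemma swaps_permutes: "\<forall>k\<in>set ks. Suc k < n \<Longrightarrow> swaps ks permutes {..<n}"
proof (induction ks)
  case (Cons k ks)
  thus ?case
    unfolding swaps_simps by (intro permutes_compose permutes_swap_id) auto
qed (simp only: swaps_simps permutes_id)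

lemma inj_swaps: "inj (swaps ks)"
proof -
  have "\<forall>k\<in>set ks. Suc k < Suc (Suc (Max (insert 0 (set ks))))" by (auto simp: less_Suc_eq_le)
  from permutes_inj[OF swaps_permutes[OF this]] show ?thesis .
qed

lemma swaps_rev: "swaps ks \<circ> swaps (rev ks) = id"
proof (induction ks)
  case (Cons k ks)
  have "swaps (k # ks) \<circ> swaps (rev (k # ks))
      = transpose k (Suc k) \<circ> (swaps ks \<circ> swaps (rev ks)) \<circ> transpose k (Suc k)"
    by (simp only: swaps_append swaps_simps rev.simps o_assoc o_id)
  thus ?case by (simp only: Cons.IH o_id id_o transpose_comp_involutory)
qed simp

lemma swaps_fixes: "\<forall>k\<in>set ks. Suc k < n \<Longrightarrow> n \<le> x \<Longrightarrow> swaps ks x = x"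
  by (induction ks) auto

lemma swaps_upt: "j \<le> n \<Longrightarrow> swaps [j..<n] n = j"
proof (induction "n - j" arbitrary: j)
  case (Suc d)
  hence "swaps [Suc j..<n] n = Suc j" by auto
  thus ?case using Suc by (subst upt_conv_Cons) auto
qed simp

text \<open>No symmetry rule is needed, and \<open>word_red\<close> never introduces new letters.\<close>

inductive word_red :: "nat list \<Rightarrow> nat list \<Rightarrow> bool" where
  word_red_refl: "word_red ks ks"
| word_red_trans: "word_red ks ls \<Longrightarrow> word_red ls ms \<Longrightarrow> word_red ks ms"
| word_red_Cons: "word_red ks ls \<Longrightarrow> word_red (k # ks) (k # ls)"
| word_red_cancel: "word_red (k # k # ks) ks"
| word_red_commute: "Suc i < j \<or> Suc j < i \<Longrightarrow> word_red (i # j # ks) (j # i # ks)"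
| word_red_braid: "word_red (Suc k # k # Suc k # ks) (k # Suc k # k # ks)"

lemma word_red_append: "word_red ks ls \<Longrightarrow> word_red (ms @ ks) (ms @ ls)"
  by (induction ms) (auto intro: word_red_Cons)

lemma word_red_move: "\<forall>x\<in>set xs. Suc i < x \<or> Suc x < i \<Longrightarrow> word_red (i # xs @ ks) (xs @ i # ks)"
proof (induction xs)
  case (Cons x xs)
  have "word_red (i # x # xs @ ks) (x # i # xs @ ks)"
    using Cons.prems by (intro word_red_commute) auto
  moreover have "word_red (x # i # xs @ ks) (x # xs @ i # ks)"
    using Cons by (auto intro: word_red_Cons)
  ultimately show ?case unfolding append_Cons by (rule word_red_trans)
qed (auto intro: word_red_refl)

text \<open>Multiplying a run on the left by a letter i has four outcomes: i commutes past the run,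
  lengthens it, shortens it, or passes through it and leaves as i - 1.\<close>

lemma word_red_run:
  assumes "i < n" "j \<le> n" "set ks \<subseteq> {..<n - 1}"
  shows "\<exists>j'\<le>n. \<exists>ks'. set ks' \<subseteq> {..<n - 1} \<and> word_red (i # [j..<n] @ ks) ([j'..<n] @ ks')"
proof -
  consider "Suc i < j" | "Suc i = j" | "i = j" | "j < i" by linarith
  thus ?thesis
  proof cases
    case 1
    hence "word_red (i # [j..<n] @ ks) ([j..<n] @ i # ks)"
      by (intro word_red_move) auto
    thus ?thesis using assms 1 by (intro exI[of _ j] exI[of _ "i # ks"] conjI) auto
  next
    case 2
    hence "i # [j..<n] = [i..<n]" using assms by (simp add: upt_conv_Cons)
    hence "word_red (i # [j..<n] @ ks) ([i..<n] @ ks)" by (metis append_Cons word_red_refl)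
    thus ?thesis using assms by (intro exI[of _ i] exI[of _ ks] conjI) auto
  next
    case 3
    hence "word_red (i # [j..<n] @ ks) ([Suc j..<n] @ ks)"
      using assms by (auto simp: upt_conv_Cons intro: word_red_cancel)
    thus ?thesis using assms 3 by (intro exI[of _ "Suc j"] exI[of _ ks] conjI) auto
  next
    case 4
    \<comment> \<open>The letter i = k + 1 commutes with the run up to k, the braid relation turns i
      k i into k i k, and the last k commutes with the rest.\<close>
    then obtain k where k: "i = Suc k" "j \<le> k" by (cases i) auto
    have upt: "[j..<n] = [j..<k] @ k # Suc k # [Suc (Suc k)..<n]"
      using assms k upt_add_eq_append[of j k "n - k"] by (simp add: upt_conv_Cons)
    have 1: "word_red (i # [j..<n] @ ks) ([j..<k] @ i # k # Suc k # [Suc (Suc k)..<n] @ ks)"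
      unfolding upt using word_red_move[of "[j..<k]" i "k # Suc k # [Suc (Suc k)..<n] @ ks"] k by simp
    have 2: "word_red ([j..<k] @ i # k # Suc k # [Suc (Suc k)..<n] @ ks)
        ([j..<k] @ k # Suc k # k # [Suc (Suc k)..<n] @ ks)"
      unfolding k by (intro word_red_append word_red_braid)
    have 3: "word_red ([j..<k] @ k # Suc k # k # [Suc (Suc k)..<n] @ ks)
        ([j..<k] @ k # Suc k # [Suc (Suc k)..<n] @ k # ks)"
      by (intro word_red_append word_red_Cons word_red_move) auto
    have "word_red (i # [j..<n] @ ks) ([j..<n] @ k # ks)"
      using word_red_trans[OF word_red_trans[OF 1 2] 3] by (simp add: upt)
    thus ?thesis using assms k by (intro exI[of _ j] exI[of _ "k # ks"] conjI) auto
  qed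
qed

text \<open>The runs \<open>[j..<n]\<close> represent the left cosets of the stabilizer of the point
  n, which the letters below n - 1 generate.\<close>

lemma word_red_normal_form:
  assumes "set ks \<subseteq> {..<n}"
  shows "\<exists>j\<le>n. \<exists>ks'. set ks' \<subseteq> {..<n - 1} \<and> word_red ks ([j..<n] @ ks')"
  using assms
proof (induction ks)
  case Nil
  show ?case by (intro exI[of _ n] conjI exI[of _ "[]"]) (auto intro: word_red_refl)
next
  case (Cons i ks)
  then obtain j ks' where "j \<le> n" "set ks' \<subseteq> {..<n - 1}" "word_red ks ([j..<n] @ ks')" by auto
  moreover from this Cons.prems obtain j' ls where "j' \<le> n" "set ls \<subseteq> {..<n - 1}"
    "word_red (i # [j..<n] @ ks') ([j'..<n] @ ls)"
    using word_red_run[of i n j ks'] by auto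
  ultimately show ?case by (meson word_red_trans word_red_Cons)
qed

text \<open>The locale below assumes its relations only for letters \<open>k\<close> with
  \<open>Suc k < m\<close>; a reduction must not leave this range.\<close>

lemma word_red_subset: "word_red ks ls \<Longrightarrow> set ls \<subseteq> set ks"
  by (induction rule: word_red.induct) auto

lemma word_red_swaps: "word_red ks ls \<Longrightarrow> swaps ks = swaps ls"
proof (induction rule: word_red.induct)
  case (word_red_Cons ks ls k)
  thus ?case by (simp only: swaps_simps)
next
  case (word_red_cancel k ks)
  show ?case by (simp only: swaps_simps o_assoc transpose_comp_involutory id_o)
next
  case (word_red_commute i j ks)
  hence "transpose i (Suc i) \<circ> transpose j (Suc j) = transpose j (Suc j) \<circ> transpose i (Suc i)"
    by (intro ext) (auto simp: transpose_def)
  thus ?case by (simp only: swaps_simps o_assoc)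
next
  case (word_red_braid k ks)
  have "transpose (Suc k) (Suc (Suc k)) \<circ> transpose k (Suc k) \<circ> transpose (Suc k) (Suc (Suc k))
      = transpose k (Suc k) \<circ> transpose (Suc k) (Suc (Suc k)) \<circ> transpose k (Suc k)"
  proof
    fix x
    show "(transpose (Suc k) (Suc (Suc k)) \<circ> transpose k (Suc k) \<circ> transpose (Suc k) (Suc (Suc k))) x
      = (transpose k (Suc k) \<circ> transpose (Suc k) (Suc (Suc k)) \<circ> transpose k (Suc k)) x"
      using transpose_triple[of "Suc (Suc k)" k "Suc k" x] transpose_triple[of k "Suc (Suc k)" "Suc k" x]
      by (simp only: o_apply transpose_commute[of "Suc (Suc k)"] transpose_commute[of "Suc k" k])
  qed
  thus ?case by (simp only: swaps_simps o_assoc)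
qed simp_all

lemma ex_swaps: "w permutes {..<n} \<Longrightarrow> \<exists>ks. (\<forall>k\<in>set ks. Suc k < n) \<and> w = swaps ks"
proof (induction n arbitrary: w)
  case 0
  thus ?case by (intro exI[of _ "[]"]) auto
next
  case (Suc n)
  define j where "j = w n"
  have j: "j \<le> n" using permutes_in_image[OF Suc.prems, of n] by (auto simp: j_def)
  have run: "swaps [j..<n] permutes {..<Suc n}" by (rule swaps_permutes) auto
  have inv: "swaps (rev [j..<n]) \<circ> swaps [j..<n] = id"
    using swaps_rev[of "rev [j..<n]"] by simp
  \<comment> \<open>The run starting at w n carries n to w n, so stripping it from w leaves a
    permutation that fixes n.\<close>
  define v where "v = swaps (rev [j..<n]) \<circ> w"
  have "v permutes {..<Suc n}"
    unfolding v_def by (intro permutes_compose[OF Suc.prems] swaps_permutes) auto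
  moreover have "v n = n"
    using fun_cong[OF inv, of n] swaps_upt[OF j] by (simp add: v_def j_def)
  ultimately have "v permutes {..<n}"
    using permutes_superset[of v "{..<Suc n}" "{..<n}"] by (auto simp: less_Suc_eq)
  then obtain ks where ks: "\<forall>k\<in>set ks. Suc k < n" "v = swaps ks" using Suc.IH by auto
  have "w = (swaps [j..<n] \<circ> swaps (rev [j..<n])) \<circ> w" by (simp add: swaps_rev)
  also have "\<dots> = swaps ([j..<n] @ ks)" by (simp add: swaps_append ks(2)[symmetric] v_def o_assoc)
  finally show ?case using ks by (intro exI[of _ "[j..<n] @ ks"]) auto
qed

lemma simple_word:
  assumes "w permutes {..<n}"
  shows "\<forall>k\<in>set (simple_word n w). Suc k < n" "swaps (simple_word n w) = w"
proof -
  have "\<exists>ks. (\<forall>k\<in>set ks. Suc k < n) \<and> w = foldr (\<lambda>k p. transpose k (Suc k) \<circ> p) ks id"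
    using ex_swaps[OF assms] by (simp add: swaps_def)
  from someI_ex[OF this] show "\<forall>k\<in>set (simple_word n w). Suc k < n" "swaps (simple_word n w) = w"
    by (auto simp: simple_word_def swaps_def)
qed

text \<open>The neutral element is an idempotent \<open>e\<close>, because the symmetric groups will
  act in corners of the operator ring cut out by projections \<open>proj (PQ m)\<close>.\<close>

locale coxeter =
  fixes t :: "nat \<Rightarrow> 'a::semigroup_mult" and e :: 'a and m :: nat
  assumes e_e: "e * e = e"
    and e_t: "Suc k < m \<Longrightarrow> e * t k = t k"
    and t_e: "Suc k < m \<Longrightarrow> t k * e = t k"
    and t_t: "Suc k < m \<Longrightarrow> t k * t k = e"
    and t_commute: "Suc i < j \<Longrightarrow> Suc j < m \<Longrightarrow> t i * t j = t j * t i"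
    and t_braid: "Suc (Suc k) < m \<Longrightarrow> t k * (t (Suc k) * t k) = t (Suc k) * (t k * t (Suc k))"
begin

definition prodw :: "nat list \<Rightarrow> 'a" where
  "prodw ks = foldr (\<lambda>k x. t k * x) ks e"

lemma prodw_simps [simp]: "prodw [] = e" "prodw (k # ks) = t k * prodw ks"
  by (simp_all add: prodw_def)

lemma prodw_e: "\<forall>k\<in>set ks. Suc k < m \<Longrightarrow> e * prodw ks = prodw ks"
  by (cases ks) (auto simp: e_e e_t mult.assoc[symmetric])

lemma prodw_append: "\<forall>k\<in>set (ks @ ls). Suc k < m \<Longrightarrow> prodw (ks @ ls) = prodw ks * prodw ls"
  by (induction ks) (auto simp: prodw_e mult.assoc)

lemma prodw_word_red: "word_red ks ls \<Longrightarrow> \<forall>k\<in>set ks. Suc k < m \<Longrightarrow> prodw ks = prodw ls"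
proof (induction rule: word_red.induct)
  case (word_red_trans ks ls ms)
  thus ?case using word_red_subset[OF word_red_trans.hyps(1)] by auto
next
  case (word_red_cancel k ks)
  thus ?case by (simp add: mult.assoc[symmetric] t_t) (simp add: prodw_e)
next
  case (word_red_commute i j ks)
  hence "t i * t j = t j * t i" using t_commute[of i j] t_commute[of j i] by auto
  thus ?case by (simp add: mult.assoc[symmetric])
next
  case (word_red_braid k ks)
  have "t (Suc k) * (t k * (t (Suc k) * prodw ks)) = (t (Suc k) * (t k * t (Suc k))) * prodw ks"
    by (simp add: mult.assoc)
  also have "\<dots> = (t k * (t (Suc k) * t k)) * prodw ks" using word_red_braid t_braid[of k] by auto
  finally show ?case by (simp add: mult.assoc)
qed auto

text \<open>In normal form the image of the largest point reveals the start of the run. Equal runs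
  cancel by injectivity, and induction handles what remains.\<close>

lemma prodw_cong:
  assumes "set ks \<subseteq> {..<n}" "set ls \<subseteq> {..<n}" "n < m" "swaps ks = swaps ls"
  shows "prodw ks = prodw ls"
  using assms
proof (induction n arbitrary: ks ls)
  case (Suc n)
  obtain j ks' where ks: "j \<le> Suc n" "set ks' \<subseteq> {..<n}" "word_red ks ([j..<Suc n] @ ks')"
    using word_red_normal_form[OF Suc.prems(1)] by auto
  obtain i ls' where ls: "i \<le> Suc n" "set ls' \<subseteq> {..<n}" "word_red ls ([i..<Suc n] @ ls')"
    using word_red_normal_form[OF Suc.prems(2)] by auto
  have sw: "swaps [j..<Suc n] \<circ> swaps ks' = swaps [i..<Suc n] \<circ> swaps ls'"
    using word_red_swaps[OF ks(3)] word_red_swaps[OF ls(3)] Suc.prems(4)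
    by (simp only: swaps_append)
  have "swaps ks' (Suc n) = Suc n" "swaps ls' (Suc n) = Suc n"
    using ks(2) ls(2) swaps_fixes[of ks' "Suc n" "Suc n"] swaps_fixes[of ls' "Suc n" "Suc n"] by auto
  hence ij: "i = j"
    using fun_cong[OF sw, of "Suc n"] swaps_upt[OF ks(1)] swaps_upt[OF ls(1)] by (simp del: upt_Suc)
  have "swaps ks' = swaps ls'"
  proof
    fix x
    show "swaps ks' x = swaps ls' x"
      using fun_cong[OF sw, of x] unfolding ij o_apply by (rule injD[OF inj_swaps])
  qed
  hence eq: "prodw ks' = prodw ls'" using Suc.prems(3) Suc.IH[OF ks(2) ls(2)] by simp
  have "prodw ks = prodw ([j..<Suc n] @ ks')"
    by (rule prodw_word_red[OF ks(3)]) (use Suc.prems in auto)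
  also have "\<dots> = prodw [j..<Suc n] * prodw ks'"
    by (rule prodw_append) (use ks(2) Suc.prems(3) in auto)
  also have "\<dots> = prodw [i..<Suc n] * prodw ls'"
    by (simp only: ij eq)
  also have "\<dots> = prodw ([i..<Suc n] @ ls')"
    by (rule prodw_append[symmetric]) (use ls(2) Suc.prems(3) in auto)
  also have "\<dots> = prodw ls"
    by (rule prodw_word_red[OF ls(3), symmetric]) (use Suc.prems in auto)
  finally show ?case .
qed auto

lemma prodw_eqI:
  assumes "\<forall>k\<in>set ks. Suc k < m" "\<forall>k\<in>set ls. Suc k < m" "swaps ks = swaps ls"
  shows "prodw ks = prodw ls"
proof (cases m)
  case 0
  with assms have "ks = []" "ls = []" by (cases ks; cases ls; auto)+
  thus ?thesis by simp
next
  case (Suc n)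
  with assms show ?thesis by (intro prodw_cong[of _ n]) auto
qed

text \<open>\<open>simple_word\<close> is an arbitrary choice, made harmless by
  \<open>prodw_eqI\<close>.\<close>

definition rep :: "(nat \<Rightarrow> nat) \<Rightarrow> 'a" where
  "rep w = prodw (simple_word m w)"

lemma rep_swaps: "\<forall>k\<in>set ks. Suc k < m \<Longrightarrow> rep (swaps ks) = prodw ks"
  unfolding rep_def by (intro prodw_eqI) (use simple_word[OF swaps_permutes] in auto)

lemma rep_compose:
  assumes "v permutes {..<m}" "w permutes {..<m}"
  shows "rep (v \<circ> w) = rep v * rep w"
proof -
  have "rep (v \<circ> w) = rep (swaps (simple_word m v @ simple_word m w))"
    by (simp add: swaps_append simple_word assms)
  also have "\<dots> = prodw (simple_word m v @ simple_word m w)"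
    by (rule rep_swaps) (use simple_word(1)[OF assms(1)] simple_word(1)[OF assms(2)] in auto)
  also have "\<dots> = rep v * rep w"
    unfolding rep_def by (rule prodw_append) (use simple_word(1)[OF assms(1)] simple_word(1)[OF assms(2)] in auto)
  finally show ?thesis .
qed

lemma rep_id: "rep id = e"
  using rep_swaps[of "[]"] by simp

lemma rep_transpose: "Suc k < m \<Longrightarrow> rep (transpose k (Suc k)) = t k"
  using rep_swaps[of "[k]"] by (simp add: t_e)

end

section \<open>Antisymmetrizers\<close>

lemma sum_const_scalar: "finite A \<Longrightarrow> (\<Sum>x\<in>A. c) = scalar (of_nat (card A)) * (c :: 'k::field_char_0 oper)"
  by (induction rule: finite_induct) (simp_all add: scalar_add distrib_right)

lemma scalar_cancel: "a * b = 1 \<Longrightarrow> scalar a * (scalar b * x) = x"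
  by (simp add: mult.assoc[symmetric] scalar_mult[symmetric])

abbreviation sgn_op :: "(nat \<Rightarrow> nat) \<Rightarrow> 'k::field_char_0 oper" where
  "sgn_op w \<equiv> scalar (of_int (sign w))"

lemma sgn_op_compose:
  assumes "v permutes {..<m}" "w permutes {..<m}"
  shows "sgn_op (v \<circ> w) = sgn_op v * sgn_op w"
proof -
  have "sign (v \<circ> w) = sign v * sign w"
    using assms by (intro sign_compose permutes_imp_permutation[of "{..<m}"]) auto
  thus ?thesis by (simp add: scalar_mult)
qed

lemma sgn_op_square: "sgn_op w * (sgn_op w * x) = x"
  by (rule scalar_cancel) (simp only: of_int_mult[symmetric] sign_idempotent of_int_1)

locale coxeter_oper = coxeter t e m for t :: "nat \<Rightarrow> 'k::field_char_0 oper" and e m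
begin

definition asum :: "'k oper" where
  "asum = (\<Sum>w | w permutes {..<m}. sgn_op w * rep w)"

definition asym :: "'k oper" where
  "asym = scalar (1 / fact m) * asum"

lemma rep_asum:
  assumes "v permutes {..<m}"
  shows "rep v * asum = sgn_op v * asum"
proof -
  have "sgn_op v * asum = sgn_op v * (\<Sum>w | w permutes {..<m}. sgn_op (v \<circ> w) * rep (v \<circ> w))"
    unfolding asum_def by (subst setum_permutations_compose_left[OF assms]) simp
  also have "\<dots> = sgn_op v * (\<Sum>w | w permutes {..<m}. sgn_op v * (rep v * (sgn_op w * rep w)))"
    by (rule arg_cong2[where f = "(*)"], rule HOL.refl, rule sum.cong[OF HOL.refl])
      (use assms in \<open>simp_all add: sgn_op_compose rep_compose mult.assoc scalar_left_commute[of "rep v"]\<close>)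
  also have "\<dots> = rep v * asum"
    by (simp add: sum_distrib_left[symmetric] sgn_op_square asum_def)
  finally show ?thesis ..
qed

lemma asum_rep:
  assumes "v permutes {..<m}"
  shows "asum * rep v = sgn_op v * asum"
proof -
  have "sgn_op v * asum = sgn_op v * (\<Sum>w | w permutes {..<m}. sgn_op (w \<circ> v) * rep (w \<circ> v))"
    unfolding asum_def by (subst sum_permutations_compose_right[OF assms]) simp
  also have "\<dots> = sgn_op v * (\<Sum>w | w permutes {..<m}. sgn_op v * ((sgn_op w * rep w) * rep v))"
    by (rule arg_cong2[where f = "(*)"], rule HOL.refl, rule sum.cong[OF HOL.refl])
      (use assms in \<open>simp_all add: sgn_op_compose rep_compose mult.assoc scalar_left_commute[of "sgn_op v"]\<close>)
  also have "\<dots> = asum * rep v"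
    by (simp add: sum_distrib_left[symmetric] sum_distrib_right[symmetric] sgn_op_square asum_def)
  finally show ?thesis ..
qed

lemma rep_asym: "v permutes {..<m} \<Longrightarrow> rep v * asym = sgn_op v * asym"
  unfolding asym_def scalar_left_commute[of "rep v"] by (simp only: rep_asum) (rule scalar_left_commute)

lemma asym_rep: "v permutes {..<m} \<Longrightarrow> asym * rep v = sgn_op v * asym"
  unfolding asym_def mult.assoc by (simp only: asum_rep) (rule scalar_left_commute)

lemma permutes_simple: "Suc k < m \<Longrightarrow> transpose k (Suc k) permutes {..<m}"
  by (intro permutes_swap_id) auto

lemma t_asym: "Suc k < m \<Longrightarrow> t k * asym = - asym"
  using rep_asym[OF permutes_simple] by (simp add: rep_transpose sign_swap_id scalar_minus)

lemma asym_t: "Suc k < m \<Longrightarrow> asym * t k = - asym"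
  using asym_rep[OF permutes_simple] by (simp add: rep_transpose sign_swap_id scalar_minus)

lemma asum_absorb:
  assumes "\<And>w. w permutes {..<m} \<Longrightarrow> rep w * x = sgn_op w * x"
  shows "asum * x = scalar (fact m) * x"
proof -
  have "asum * x = (\<Sum>w | w permutes {..<m}. x)"
    unfolding asum_def sum_distrib_right
    by (intro sum.cong) (simp_all add: mult.assoc assms sgn_op_square)
  thus ?thesis
    by (simp add: sum_const_scalar finite_permutations card_permutations[OF HOL.refl])
qed

text \<open>The sum has m! equal terms. Idempotence and the absorption of the antisymmetrizer of a
  smaller group both follow.\<close>

lemma asym_absorb:
  assumes "\<And>w. w permutes {..<m} \<Longrightarrow> rep w * x = sgn_op w * x"
  shows "asym * x = x"
  by (simp add: asym_def mult.assoc asum_absorb[OF assms] scalar_cancel)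

lemma asym_idem: "asym * asym = asym"
  by (rule asym_absorb) (rule rep_asym)

lemma e_rep: "w permutes {..<m} \<Longrightarrow> e * rep w = rep w"
  unfolding rep_def using simple_word(1) by (intro prodw_e)

lemma rep_e: "w permutes {..<m} \<Longrightarrow> rep w * e = rep w"
  using rep_compose[of w id] by (simp add: rep_id permutes_id)

lemma e_asym: "e * asym = asym"
  unfolding asym_def asum_def scalar_left_commute[of e] sum_distrib_left[of e]
  by (rule arg_cong2[where f = "(*)"], rule HOL.refl, rule sum.cong[OF HOL.refl]) (simp_all add: scalar_left_commute[of e] e_rep)

lemma asym_e: "asym * e = asym"
  unfolding asym_def asum_def mult.assoc sum_distrib_right[of _ _ e]
  by (rule arg_cong2[where f = "(*)"], rule HOL.refl, rule sum.cong[OF HOL.refl]) (simp_all add: rep_e)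

end

text \<open>The inner group is the stabilizer of the last of the m + 1 points; both use the same
  generators and the same neutral element.\<close>

locale coxeter_oper_Suc =
  outer: coxeter_oper t e "Suc m" + inner: coxeter_oper t e m
  for t :: "nat \<Rightarrow> 'k::field_char_0 oper" and e m
begin

lemma permutes_Suc: "w permutes {..<m} \<Longrightarrow> w permutes {..<Suc m}"
  by (rule permutes_subset) auto

text \<open>The two representations may have chosen different words for the same
  permutation.\<close>

lemma rep_Suc: "w permutes {..<m} \<Longrightarrow> outer.rep w = inner.rep w"
  unfolding outer.rep_def inner.rep_def
  by (rule outer.prodw_eqI)
    (use simple_word[of w m] simple_word[OF permutes_Suc[of w]] in auto)

lemma inner_outer: "inner.asym * outer.asym = outer.asym"
  by (rule inner.asym_absorb) (simp add: rep_Suc[symmetric] outer.rep_asym permutes_Suc)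

lemma outer_inner: "outer.asym * inner.asym = outer.asym"
proof -
  have "outer.asym * inner.asym
      = scalar (1 / fact m) * (\<Sum>w | w permutes {..<m}. sgn_op w * (outer.asym * outer.rep w))"
    unfolding inner.asym_def inner.asum_def scalar_left_commute[of outer.asym] sum_distrib_left[of outer.asym]
    by (rule arg_cong2[where f = "(*)"], rule HOL.refl, rule sum.cong[OF HOL.refl]) (simp_all add: rep_Suc)
  also have "\<dots> = scalar (1 / fact m) * (\<Sum>w | w permutes {..<m}. outer.asym)"
    by (rule arg_cong2[where f = "(*)"], rule HOL.refl, rule sum.cong[OF HOL.refl])
      (simp_all add: outer.asym_rep permutes_Suc sgn_op_square)
  also have "\<dots> = outer.asym"
    by (simp add: sum_const_scalar finite_permutations card_permutations[OF HOL.refl] scalar_cancel)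
  finally show ?thesis .
qed

text \<open>Coset decomposition: a permutation of m + 1 points is uniquely the transposition of m
  and some b \<le> m after a permutation of the first m points. The case b = m is the identity and
  gives the first term; the others carry a sign.\<close>

lemma outer_conv_transpositions:
  "scalar (of_nat (Suc m)) * outer.asym
    = inner.asym - (\<Sum>b<m. outer.rep (transpose m b)) * inner.asym"
proof -
  let ?F = "\<lambda>w. sgn_op w * outer.rep w"
  have tr: "transpose m b permutes {..<Suc m}" if "b \<le> m" for b
    using that by (intro permutes_swap_id) auto
  have F: "?F (transpose m b \<circ> q) = ?F (transpose m b) * ?F q" if "b \<le> m" "q permutes {..<m}" for b q
    using tr[OF that(1)] permutes_Suc[OF that(2)]
    by (simp add: sgn_op_compose outer.rep_compose mult.assoc scalar_left_commute[of "outer.rep _"])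
  have "outer.asum = (\<Sum>w | w permutes insert m {..<m}. ?F w)"
    by (simp add: outer.asum_def lessThan_Suc)
  also have "\<dots> = (\<Sum>b\<in>insert m {..<m}. \<Sum>q | q permutes {..<m}. ?F (transpose m b \<circ> q))"
    by (rule sum_over_permutations_insert) auto
  also have "\<dots> = (\<Sum>b\<in>insert m {..<m}. ?F (transpose m b) * inner.asum)"
    unfolding inner.asum_def sum_distrib_left
    by (intro sum.cong HOL.refl, subst F) (auto simp: rep_Suc)
  also have "\<dots> = inner.asum - (\<Sum>b<m. outer.rep (transpose m b)) * inner.asum"
    using outer.rep_id inner.rep_asum[of id] inner.rep_id
    by (simp add: sum_distrib_right[symmetric] left_diff_distrib distrib_right sign_swap_id
        scalar_minus sum_negf permutes_id)
  finally have *: "outer.asum = inner.asum - (\<Sum>b<m. outer.rep (transpose m b)) * inner.asum" .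
  have "scalar (of_nat (Suc m)) * outer.asym = scalar (1 / fact m) * outer.asum"
    unfolding outer.asym_def mult.assoc[symmetric] scalar_mult[symmetric]
    by (simp add: fact_Suc del: of_nat_Suc)
  thus ?thesis
    unfolding * inner.asym_def right_diff_distrib
    by (simp only: scalar_left_commute[of "\<Sum>b<m. outer.rep (transpose m b)"])
qed

text \<open>A further antisymmetrizer on the left makes all nontrivial cosets contribute equally.
  For m = 0 the index \<open>m - 1\<close> is a default value, multiplied by zero.\<close>

lemma asym_Suc:
  "scalar (of_nat (Suc m)) * outer.asym
    = inner.asym - scalar (of_nat m) * (inner.asym * (t (m - 1) * inner.asym))"
proof -
  let ?A = inner.asym
  \<comment> \<open>With k = m - 1, the transposition of m and b is the conjugate by u = (b k) of
    the last simple one. Since u lies in the smaller group, the antisymmetrizers on both sides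
    absorb it, and its sign occurs twice.\<close>
  have conj: "?A * (outer.rep (transpose m b) * ?A) = ?A * (t (m - 1) * ?A)" if b: "b < m" for b
  proof -
    obtain k where k: "m = Suc k" using b by (cases m) auto
    let ?u = "transpose b k"
    have u: "?u permutes {..<m}" using b k by (intro permutes_swap_id) auto
    have "transpose m b = ?u \<circ> transpose k m \<circ> ?u"
      using b k by (auto simp: fun_eq_iff transpose_def)
    moreover have "transpose k m permutes {..<Suc m}" using k by (intro permutes_swap_id) auto
    moreover have "outer.rep (transpose k m) = t (m - 1)"
      using outer.rep_transpose[of k] k by simp
    ultimately have "outer.rep (transpose m b) = inner.rep ?u * t (m - 1) * inner.rep ?u"
      using permutes_Suc[OF u] by (simp add: outer.rep_compose permutes_compose rep_Suc[OF u])
    hence "?A * (outer.rep (transpose m b) * ?A)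
        = (?A * inner.rep ?u) * (t (m - 1) * (inner.rep ?u * ?A))"
      by (simp add: mult.assoc)
    also have "\<dots> = ?A * (t (m - 1) * ?A)"
      unfolding inner.asym_rep[OF u] inner.rep_asym[OF u]
      by (simp add: scalar_left_commute[of ?A] scalar_left_commute[of "t _"] mult.assoc sgn_op_square)
    finally show ?thesis .
  qed
  have "scalar (of_nat (Suc m)) * outer.asym = ?A * (scalar (of_nat (Suc m)) * outer.asym)"
    by (simp only: scalar_left_commute[of ?A] inner_outer)
  also have "\<dots> = ?A - (\<Sum>b<m. ?A * (outer.rep (transpose m b) * ?A))"
    unfolding outer_conv_transpositions
    by (simp add: right_diff_distrib inner.asym_idem sum_distrib_right sum_distrib_left)
  also have "(\<Sum>b<m. ?A * (outer.rep (transpose m b) * ?A)) = (\<Sum>b<m. ?A * (t (m - 1) * ?A))"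
    by (rule sum.cong) (simp_all add: conj)
  finally show ?thesis by (simp add: sum_const_scalar)
qed

end

section \<open>Calculus of caps, cups and crossings\<close>

lemma mult_eq_left: "x * y = z \<Longrightarrow> x * (y * t) = z * (t :: 'a::semigroup_mult)"
  by (simp add: mult.assoc[symmetric])

lemma mult_eq_left2: "x * y = z * w \<Longrightarrow> x * (y * t) = z * (w * (t :: 'a::semigroup_mult))"
  by (simp add: mult.assoc[symmetric])

text \<open>Nested caps and cups on two or three pairs of strands, the primed ones counterclockwise.
  Crossings slide around them, which relates upward to downward crossings.\<close>

definition cap2 :: "'k diag" where "cap2 = Gen CapPQ \<bullet> (idP \<diamondop> Gen CapPQ \<diamondop> idQ)"
definition cup2 :: "'k diag" where "cup2 = (idP \<diamondop> Gen CupPQ \<diamondop> idQ) \<bullet> Gen CupPQ"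
definition cap2' :: "'k diag" where "cap2' = Gen CapQP \<bullet> (idQ \<diamondop> Gen CapQP \<diamondop> idP)"
definition cup2' :: "'k diag" where "cup2' = (idQ \<diamondop> Gen CupQP \<diamondop> idP) \<bullet> Gen CupQP"
definition cap3' :: "'k diag" where "cap3' = cap2' \<bullet> (idQ \<diamondop> idQ \<diamondop> Gen CapQP \<diamondop> idP \<diamondop> idP)"
definition cup3 :: "'k diag" where "cup3 = (idP \<diamondop> cup2 \<diamondop> idQ) \<bullet> Gen CupPQ"

lemma typing_simps [simp]:
  "wt cap2" "src cap2 = [Up, Up, Down, Down]" "tgt cap2 = []"
  "wt cup2" "tgt cup2 = [Up, Up, Down, Down]" "src cup2 = []"
  "wt cap2'" "src cap2' = [Down, Down, Up, Up]" "tgt cap2' = []"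
  "wt cup2'" "tgt cup2' = [Down, Down, Up, Up]" "src cup2' = []"
  "wt cap3'" "src cap3' = [Down, Down, Down, Up, Up, Up]" "tgt cap3' = []"
  "wt cup3" "tgt cup3 = [Up, Up, Up, Down, Down, Down]" "src cup3 = []"
  "wt cross_down" "src cross_down = [Down, Down]" "tgt cross_down = [Down, Down]"
  "wt cross_down'" "src cross_down' = [Down, Down]" "tgt cross_down' = [Down, Down]"
  "wt cross_PQ_QP" "src cross_PQ_QP = [Up, Down]" "tgt cross_PQ_QP = [Down, Up]"
  "wt cross_QP_PQ" "src cross_QP_PQ = [Down, Up]" "tgt cross_QP_PQ = [Up, Down]"
  by (simp_all add: cap2_def cup2_def cap2'_def cup2'_def cap3'_def cup3_def cross_down_def
      cross_down'_def cross_PQ_QP_def cross_QP_PQ_def)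

text \<open>These rules cut a whiskered diagram into a right-nested product of slices; the
  \<open>mult_eq_left\<close> variants remove identities inside such a product.\<close>

lemmas whisk_expand = whisk_compose whisk_tensor_Ident whisk_tensor whisk_Ident
  whisk_id_left whisk_id_right mult.assoc
  whisk_id_left[THEN mult_eq_left] whisk_id_right[THEN mult_eq_left]

lemma replicate_left_commute:
  "replicate a x @ replicate b x @ r = replicate b x @ replicate a x @ r"
  "replicate a x @ replicate b x = replicate b x @ replicate a x"
  by (simp_all add: replicate_add[symmetric] add.commute flip: append_assoc)

lemmas word_simps = PQ_def replicate_add replicate_left_commute replicate_app_Cons_same

text \<open>\<open>perm_up\<close> with the chosen word made explicit, so that induction over the
  word is possible.\<close>

definition up_word :: "nat \<Rightarrow> nat list \<Rightarrow> 'k diag" where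
  "up_word m ks = foldr (\<lambda>k t. (Ident (Ppow k) \<diamondop> Gen Crossing \<diamondop> Ident (Ppow (m - k - 2))) \<bullet> t)
     ks (Ident (Ppow m))"
definition down_word :: "nat \<Rightarrow> nat list \<Rightarrow> 'k diag" where
  "down_word m ks = foldr (\<lambda>k t. (Ident (Qpow (m - k - 2)) \<diamondop> cross_down \<diamondop> Ident (Qpow k)) \<bullet> t)
     ks (Ident (Qpow m))"

lemma replicate_pair:
  assumes "Suc k < m"
  shows "replicate k x @ x # x # replicate (m - Suc (Suc k)) x = replicate m x"
    "replicate (m - Suc (Suc k)) x @ x # x # replicate k x = replicate m x"
proof -
  obtain r where "m = k + 2 + r" using assms le_Suc_ex[of "k + 2" m] by auto
  thus "replicate k x @ x # x # replicate (m - Suc (Suc k)) x = replicate m x"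
    "replicate (m - Suc (Suc k)) x @ x # x # replicate k x = replicate m x"
    by (simp_all add: replicate_add replicate_left_commute replicate_app_Cons_same)
qed

text \<open>The parameter of the following context only fixes the type of scalars.\<close>

context
  fixes tyk :: "'k::field_char_0 itself"
begin

abbreviation (input) wh :: "word \<Rightarrow> 'k diag \<Rightarrow> word \<Rightarrow> 'k oper" where "wh \<equiv> whisk"
abbreviation (input) pr :: "word \<Rightarrow> 'k oper" where "pr \<equiv> proj"
abbreviation (input) cr :: "word \<Rightarrow> word \<Rightarrow> 'k oper" where "cr a b \<equiv> whisk a (Gen Crossing) b"
abbreviation (input) cap :: "word \<Rightarrow> word \<Rightarrow> 'k oper" where "cap a b \<equiv> whisk a (Gen CapPQ) b"
abbreviation (input) cup :: "word \<Rightarrow> word \<Rightarrow> 'k oper" where "cup a b \<equiv> whisk a (Gen CupPQ) b"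
abbreviation (input) cap' :: "word \<Rightarrow> word \<Rightarrow> 'k oper" where "cap' a b \<equiv> whisk a (Gen CapQP) b"
abbreviation (input) cup' :: "word \<Rightarrow> word \<Rightarrow> 'k oper" where "cup' a b \<equiv> whisk a (Gen CupQP) b"
abbreviation (input) cd :: "word \<Rightarrow> word \<Rightarrow> 'k oper" where "cd a b \<equiv> whisk a cross_down b"

lemmas interchange = whisk_interchange[where ?'a = 'k]

lemma cap2_expand: "wh a cap2 b = cap a b * cap (a @ [Up]) (Down # b)"
  by (simp add: cap2_def whisk_expand)
lemma cup2_expand: "wh a cup2 b = cup (a @ [Up]) (Down # b) * cup a b"
  by (simp add: cup2_def whisk_expand)
lemma cap2'_expand: "wh a cap2' b = cap' a b * cap' (a @ [Down]) (Up # b)"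
  by (simp add: cap2'_def whisk_expand)
lemma cup2'_expand: "wh a cup2' b = cup' (a @ [Down]) (Up # b) * cup' a b"
  by (simp add: cup2'_def whisk_expand)
lemma cap3'_expand: "wh a cap3' b = wh a cap2' b * cap' (a @ [Down, Down]) (Up # Up # b)"
  by (simp add: cap3'_def whisk_expand)
lemma cup3_expand: "wh a cup3 b = wh (a @ [Up]) cup2 (Down # b) * cup a b"
  by (simp add: cup3_def whisk_expand)
lemma cd_expand: "cd a b = wh a cap2' (Down # Down # b) * cr (a @ [Down, Down]) (Down # Down # b)
    * wh (a @ [Down, Down]) cup2 b"
  unfolding cross_down_def cap2'_def[symmetric] cup2_def[symmetric]
  by (simp add: whisk_expand)
text \<open>Cyclicity lets the downward crossing be read as either rotation: the form in
  \<open>cd_expand\<close> is used against cups, the one in \<open>cd_expand'\<close> against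
  caps.\<close>

lemma cd_eq: "cd a b = wh a cross_down' b"
  by (rule whisk_local_rel) (simp_all add: cyclic)
lemma cd_expand': "cd a b = wh (a @ [Down, Down]) cap2 b * cr (a @ [Down, Down]) (Down # Down # b)
    * wh a cup2' (Down # Down # b)"
  unfolding cd_eq cross_down'_def cap2_def[symmetric] cup2'_def[symmetric]
  by (simp add: whisk_expand)
lemma PQ_QP_expand: "wh a cross_PQ_QP b
    = cap (a @ [Down, Up]) b * cr (a @ [Down]) (Down # b) * cup' a (Up # Down # b)"
  by (simp add: cross_PQ_QP_def whisk_expand)
lemma QP_PQ_expand: "wh a cross_QP_PQ b
    = cap' a (Up # Down # b) * cr (a @ [Down]) (Down # b) * cup (a @ [Down, Up]) b"
  by (simp add: cross_QP_PQ_def whisk_expand)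

section \<open>Straightening strands and rotating crossings\<close>

lemma zigzags:
  "cap a (Up # b) * cup' (a @ [Up]) b = pr (a @ Up # b)"
  "cap' (a @ [Up]) b * cup a (Up # b) = pr (a @ Up # b)"
  "cap' a (Down # b) * cup (a @ [Down]) b = pr (a @ Down # b)"
  "cap (a @ [Down]) b * cup' a (Down # b) = pr (a @ Down # b)"
  using whisk_local_rel[OF zigzag1, of a b] whisk_local_rel[OF zigzag2, of a b]
    whisk_local_rel[OF zigzag3, of a b] whisk_local_rel[OF zigzag4, of a b]
  by (simp_all add: whisk_expand)

lemma crossing_square: "cr a b * cr a b = pr (a @ Up # Up # b)"
  using whisk_local_rel[OF double_up, of a b] by (simp add: whisk_expand)

lemma crossing_braid: "cr a (Up # b) * (cr (a @ [Up]) b * cr a (Up # b))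
    = cr (a @ [Up]) b * (cr a (Up # b) * cr (a @ [Up]) b)"
  using whisk_local_rel[OF braid, of a b] by (simp add: whisk_expand)

lemma double_crossing_QP: "wh a cross_PQ_QP b * wh a cross_QP_PQ b
    = pr (a @ Down # Up # b) - cup' a b * cap' a b"
  using whisk_local_rel[OF double_QP, of a b]
  by (simp add: whisk_expand whisk_Plus whisk_Scale scalar_minus)

text \<open>The pattern of a nested zigzag: the inner cap and the inner cup exchange heights, and
  then each straightens against an outer partner.\<close>

lemma nested_cancel:
  fixes x1 :: "'a::semigroup_mult"
  assumes "x2 * y1 = y1' * x2'" "x2' * y2 = p" "y1' * p = y1'" "x1 * y1' = q"
  shows "(x1 * x2) * (y1 * y2) = q"
  using assms by (metis mult.assoc)

lemma zigzags2:
  "wh a cap2 (Up # Up # b) * wh (a @ [Up, Up]) cup2' b = pr (a @ Up # Up # b)"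
  "wh (a @ [Up, Up]) cap2' b * wh a cup2 (Up # Up # b) = pr (a @ Up # Up # b)"
  "wh a cap2' (Down # Down # b) * wh (a @ [Down, Down]) cup2 b = pr (a @ Down # Down # b)"
  subgoal
    unfolding cap2_expand cup2'_expand
    by (rule nested_cancel[OF _ zigzags(1)[of "a @ [Up]" b, simplified] _ zigzags(1)[of a "Up # b", simplified]])
      (use interchange[of "Gen CapPQ" "Gen CupQP" "a @ [Up]" "[]" "Up # b", symmetric] in
        \<open>simp_all add: whisk_id_right\<close>)
  subgoal
    unfolding cap2'_expand cup2_expand
    by (rule nested_cancel[OF _ zigzags(2)[of a "Up # b", simplified] _ zigzags(2)[of "a @ [Up]" b, simplified]])
      (use interchange[of "Gen CupPQ" "Gen CapQP" "a @ [Up]" "[]" "Up # b"] in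
        \<open>simp_all add: whisk_id_right\<close>)
  subgoal
    unfolding cap2'_expand cup2_expand
    by (rule nested_cancel[OF _ zigzags(3)[of "a @ [Down]" b, simplified] _ zigzags(3)[of a "Down # b", simplified]])
      (use interchange[of "Gen CapQP" "Gen CupPQ" "a @ [Down]" "[]" "Down # b"] in
        \<open>simp_all add: whisk_id_right\<close>)
  done

text \<open>Expanding the downward crossing creates a second nested cup. After the two cups exchange
  heights the crossing sits on the left legs of the original one, and a zigzag removes the
  rest.\<close>

lemma crossing_cup2: "cd (a @ [Up, Up]) b * wh a cup2 b = cr a (Down # Down # b) * wh a cup2 b"
proof -
  have "cd (a @ [Up, Up]) b * wh a cup2 b
      = wh (a @ [Up, Up]) cap2' (Down # Down # b) * cr (a @ [Up, Up, Down, Down]) (Down # Down # b)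
        * (wh (a @ [Up, Up, Down, Down]) cup2 b * wh a cup2 b)"
    by (simp add: cd_expand mult.assoc)
  also have "wh (a @ [Up, Up, Down, Down]) cup2 b * wh a cup2 b
      = wh a cup2 (Up # Up # Down # Down # b) * wh a cup2 b"
    using interchange[of "cup2" cup2 a "[]" b] by simp
  also have "wh (a @ [Up, Up]) cap2' (Down # Down # b) * cr (a @ [Up, Up, Down, Down]) (Down # Down # b)
        * (wh a cup2 (Up # Up # Down # Down # b) * wh a cup2 b)
      = wh (a @ [Up, Up]) cap2' (Down # Down # b) * (cr (a @ [Up, Up, Down, Down]) (Down # Down # b)
        * wh a cup2 (Up # Up # Down # Down # b)) * wh a cup2 b"
    by (simp add: mult.assoc)
  also have "cr (a @ [Up, Up, Down, Down]) (Down # Down # b) * wh a cup2 (Up # Up # Down # Down # b)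
      = wh a cup2 (Up # Up # Down # Down # b) * cr a (Down # Down # b)"
    using interchange[of "cup2" "Gen Crossing" a "[]" "Down # Down # b"] by simp
  also have "wh (a @ [Up, Up]) cap2' (Down # Down # b)
        * (wh a cup2 (Up # Up # Down # Down # b) * cr a (Down # Down # b)) * wh a cup2 b
      = (wh (a @ [Up, Up]) cap2' (Down # Down # b) * wh a cup2 (Up # Up # Down # Down # b))
        * cr a (Down # Down # b) * wh a cup2 b"
    by (simp add: mult.assoc)
  also have "\<dots> = cr a (Down # Down # b) * wh a cup2 b"
    by (simp add: zigzags2 whisk_id_left)
  finally show ?thesis .
qed

lemma crossing_cap2: "wh a cap2 b * cd (a @ [Up, Up]) b = wh a cap2 b * cr a (Down # Down # b)"
proof -
  have "wh a cap2 b * cd (a @ [Up, Up]) b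
      = (wh a cap2 b * wh (a @ [Up, Up, Down, Down]) cap2 b)
        * cr (a @ [Up, Up, Down, Down]) (Down # Down # b) * wh (a @ [Up, Up]) cup2' (Down # Down # b)"
    by (simp add: cd_expand' mult.assoc)
  also have "wh a cap2 b * wh (a @ [Up, Up, Down, Down]) cap2 b
      = wh a cap2 b * wh a cap2 (Up # Up # Down # Down # b)"
    using interchange[of "cap2" cap2 a "[]" b] by simp
  also have "\<dots> * cr (a @ [Up, Up, Down, Down]) (Down # Down # b) * wh (a @ [Up, Up]) cup2' (Down # Down # b)
      = wh a cap2 b * (wh a cap2 (Up # Up # Down # Down # b)
        * cr (a @ [Up, Up, Down, Down]) (Down # Down # b)) * wh (a @ [Up, Up]) cup2' (Down # Down # b)"
    by (simp add: mult.assoc)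
  also have "wh a cap2 (Up # Up # Down # Down # b) * cr (a @ [Up, Up, Down, Down]) (Down # Down # b)
      = cr a (Down # Down # b) * wh a cap2 (Up # Up # Down # Down # b)"
    using interchange[of "cap2" "Gen Crossing" a "[]" "Down # Down # b"] by simp
  also have "wh a cap2 b * (cr a (Down # Down # b) * wh a cap2 (Up # Up # Down # Down # b))
        * wh (a @ [Up, Up]) cup2' (Down # Down # b)
      = wh a cap2 b * (cr a (Down # Down # b) * (wh a cap2 (Up # Up # Down # Down # b)
        * wh (a @ [Up, Up]) cup2' (Down # Down # b)))"
    by (simp add: mult.assoc)
  also have "\<dots> = wh a cap2 b * cr a (Down # Down # b)"
    by (simp add: zigzags2 whisk_id_right)
  finally show ?thesis .
qed

text \<open>One factor is expanded as a rotation; the other slides down through its caps to its cup,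
  where it becomes a second upward crossing. The two cancel and a zigzag remains.\<close>

lemma cd_square: "cd a b * cd a b = pr (a @ Down # Down # b)"
proof -
  let ?k = "wh a cap2' (Down # Down # b)" and ?x = "cr (a @ [Down, Down]) (Down # Down # b)"
    and ?c = "wh (a @ [Down, Down]) cup2 b" and ?d = "cd (a @ [Down, Down, Up, Up]) b"
  have 1: "cd a b * ?k = ?k * ?d"
    using interchange[of cap2' cross_down a "[]" b] by simp
  have 2: "?d * ?x = ?x * ?d"
    using interchange[of "Gen Crossing" cross_down "a @ [Down, Down]" "[]" b] by simp
  have 3: "?d * ?c = ?x * ?c"
    using crossing_cup2[of "a @ [Down, Down]" b] by simp
  have "?x * ?x * ?c = ?c"
    unfolding crossing_square by (simp add: whisk_id_left)
  hence 4: "?x * (?x * ?c) = ?c"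
    by (simp only: mult.assoc)
  have 5: "cd a b = ?k * (?x * ?c)"
    by (simp only: cd_expand mult.assoc)
  have "cd a b * cd a b = cd a b * (?k * (?x * ?c))"
    using 5 by (rule arg_cong)
  also have "\<dots> = ?k * ?c"
    by (simp only: mult.assoc 1[THEN mult_eq_left2] 2[THEN mult_eq_left2] 3 4)
  finally show ?thesis by (simp add: zigzags2)
qed

lemma zigzag3: "wh a cap3' (Down # Down # Down # b) * wh (a @ [Down, Down, Down]) cup3 b
    = pr (a @ Down # Down # Down # b)"
  unfolding cap3'_expand cup3_expand
  by (rule nested_cancel[OF _ zigzags(3)[of "a @ [Down, Down]" b, simplified] _
        zigzags2(3)[of a "Down # b", simplified]])
    (use interchange[of "Gen CapQP" cup2 "a @ [Down, Down]" "[]" "Down # b"] in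
      \<open>simp_all add: whisk_id_right\<close>)

lemma cup3_expand': "wh a cup3 b = cup (a @ [Up, Up]) (Down # Down # b) * wh a cup2 b"
  by (simp add: cup3_expand cup2_expand mult.assoc)

lemma crossing_cup3:
  "cd (a @ [Up, Up, Up]) (Down # b) * wh a cup3 b = cr (a @ [Up]) (Down # Down # Down # b) * wh a cup3 b"
  "cd (a @ [Up, Up, Up, Down]) b * wh a cup3 b = cr a (Up # Down # Down # Down # b) * wh a cup3 b"
proof -
  show "cd (a @ [Up, Up, Up]) (Down # b) * wh a cup3 b = cr (a @ [Up]) (Down # Down # Down # b) * wh a cup3 b"
    using crossing_cup2[of "a @ [Up]" "Down # b"] by (simp add: cup3_expand mult.assoc[symmetric])
  have "cd (a @ [Up, Up, Up, Down]) b * wh a cup3 b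
      = cd (a @ [Up, Up, Up, Down]) b * cup (a @ [Up, Up]) (Down # Down # b) * wh a cup2 b"
    by (simp add: cup3_expand' mult.assoc)
  also have "cd (a @ [Up, Up, Up, Down]) b * cup (a @ [Up, Up]) (Down # Down # b)
      = cup (a @ [Up, Up]) (Down # Down # b) * cd (a @ [Up, Up]) b"
    using interchange[of "Gen CupPQ" cross_down "a @ [Up, Up]" "[]" b] by simp
  also have "\<dots> * wh a cup2 b = cup (a @ [Up, Up]) (Down # Down # b) * cr a (Down # Down # b) * wh a cup2 b"
    by (simp add: mult.assoc crossing_cup2)
  also have "cup (a @ [Up, Up]) (Down # Down # b) * cr a (Down # Down # b)
      = cr a (Up # Down # Down # Down # b) * cup (a @ [Up, Up]) (Down # Down # b)"
    using interchange[of "Gen Crossing" "Gen CupPQ" a "[]" "Down # Down # b"] by simp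
  finally show "cd (a @ [Up, Up, Up, Down]) b * wh a cup3 b = cr a (Up # Down # Down # Down # b) * wh a cup3 b"
    by (simp add: cup3_expand' mult.assoc)
qed

text \<open>The braid relation for downward strands: both sides are the rotation by a half turn of a
  side of the braid relation for upward strands.\<close>

lemma cd_braid: "cd a (Down # b) * (cd (a @ [Down]) b * cd a (Down # b))
    = cd (a @ [Down]) b * (cd a (Down # b) * cd (a @ [Down]) b)"
proof -
  let ?k = "wh a cap3' (Down # Down # Down # b)" and ?c = "wh (a @ [Down, Down, Down]) cup3 b"
  let ?w = "[Down, Down, Down, Up, Up, Up]"
  let ?D1 = "cd a (Down # b)" and ?D2 = "cd (a @ [Down]) b"
  let ?E1 = "cd (a @ ?w) (Down # b)" and ?E2 = "cd (a @ ?w @ [Down]) b"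
  let ?X1 = "cr (a @ [Down, Down, Down]) (Up # Down # Down # Down # b)"
  let ?X2 = "cr (a @ [Down, Down, Down, Up]) (Down # Down # Down # b)"
  have D: "?D1 * ?k = ?k * ?E1" "?D2 * ?k = ?k * ?E2"
    using interchange[of "cap3'" cross_down a "[]" "Down # b"]
      interchange[of "cap3'" cross_down a "[Down]" b] by simp_all
  have E: "?E1 * ?c = ?X2 * ?c" "?E2 * ?c = ?X1 * ?c"
    using crossing_cup3[of "a @ [Down, Down, Down]" b] by simp_all
  have C: "?E1 * ?X1 = ?X1 * ?E1" "?E1 * ?X2 = ?X2 * ?E1" "?E2 * ?X1 = ?X1 * ?E2" "?E2 * ?X2 = ?X2 * ?E2"
    using interchange[of "Gen Crossing" cross_down "a @ [Down, Down, Down]" "[Up]" "Down # b"]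
      interchange[of "Gen Crossing" cross_down "a @ [Down, Down, Down, Up]" "[]" "Down # b"]
      interchange[of "Gen Crossing" cross_down "a @ [Down, Down, Down]" "[Up, Down]" b]
      interchange[of "Gen Crossing" cross_down "a @ [Down, Down, Down, Up]" "[Down]" b]
    by simp_all
  have kc: "?k * ?c = pr (a @ Down # Down # Down # b)" by (rule zigzag3)
  note slide = D[THEN mult_eq_left2] C[THEN mult_eq_left2] E
  have "?D1 * (?D2 * ?D1) = ?D1 * (?D2 * ?D1) * (?k * ?c)"
    unfolding kc by (simp add: whisk_id_right mult.assoc)
  also have "\<dots> = ?k * (?X2 * (?X1 * ?X2)) * ?c"
    by (simp only: mult.assoc slide)
  finally have 1: "?D1 * (?D2 * ?D1) = ?k * (?X2 * (?X1 * ?X2)) * ?c" .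
  have "?D2 * (?D1 * ?D2) = ?D2 * (?D1 * ?D2) * (?k * ?c)"
    unfolding kc by (simp add: whisk_id_right mult.assoc)
  also have "\<dots> = ?k * (?X1 * (?X2 * ?X1)) * ?c"
    by (simp only: mult.assoc slide)
  finally have 2: "?D2 * (?D1 * ?D2) = ?k * (?X1 * (?X2 * ?X1)) * ?c" .
  show ?thesis
    unfolding 1 2 using crossing_braid[of "a @ [Down, Down, Down]" "Down # Down # Down # b"] by simp
qed

text \<open>The extra strand can enter the interior of the cup through either leg.
  \<open>cap_cd\<close> and \<open>cd_cup\<close> are the analogues for a downward strand.\<close>

lemma crossing_cup: "cr a (Down # b) * cup (a @ [Up]) b = wh (a @ [Up]) cross_QP_PQ b * cup a (Up # b)"
proof -
  have "wh (a @ [Up]) cross_QP_PQ b * cup a (Up # b)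
      = cap' (a @ [Up]) (Up # Down # b) * (cr (a @ [Up, Down]) (Down # b)
        * (cup (a @ [Up, Down, Up]) b * cup a (Up # b)))"
    by (simp add: QP_PQ_expand mult.assoc)
  also have "cup (a @ [Up, Down, Up]) b * cup a (Up # b) = cup a (Up # Up # Down # b) * cup (a @ [Up]) b"
    using interchange[of "Gen CupPQ" "Gen CupPQ" a "[Up]" b] by simp
  also have "cr (a @ [Up, Down]) (Down # b) * (cup a (Up # Up # Down # b) * cup (a @ [Up]) b)
      = cup a (Up # Up # Down # b) * (cr a (Down # b) * cup (a @ [Up]) b)"
    using interchange[of "Gen CupPQ" "Gen Crossing" a "[]" "Down # b"]
    by (simp add: mult.assoc[symmetric])
  also have "cap' (a @ [Up]) (Up # Down # b) * (cup a (Up # Up # Down # b) * (cr a (Down # b) * cup (a @ [Up]) b))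
      = cr a (Down # b) * cup (a @ [Up]) b"
    by (simp add: zigzags[THEN mult_eq_left] whisk_id_left whisk_id_left[THEN mult_eq_left])
  finally show ?thesis ..
qed

lemma cap_cd: "cap a (Down # b) * cd (a @ [Up]) b = cap (a @ [Down]) b * wh a cross_PQ_QP (Down # b)"
proof -
  have "cap a (Down # b) * cd (a @ [Up]) b
      = cap a (Down # b) * wh (a @ [Up, Down, Down]) cap2 b * cr (a @ [Up, Down, Down]) (Down # Down # b)
        * cup' (a @ [Up, Down]) (Up # Down # Down # b) * cup' (a @ [Up]) (Down # Down # b)"
    by (simp add: cd_expand' cup2'_expand mult.assoc)
  also have "cap a (Down # b) * wh (a @ [Up, Down, Down]) cap2 b
      = wh (a @ [Down]) cap2 b * cap a (Down # Up # Up # Down # Down # b)"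
    using interchange[of "Gen CapPQ" cap2 a "[Down]" b] by simp
  also have "\<dots> * cr (a @ [Up, Down, Down]) (Down # Down # b)
      = wh (a @ [Down]) cap2 b * cr (a @ [Down]) (Down # Down # b) * cap a (Down # Up # Up # Down # Down # b)"
    using interchange[of "Gen CapPQ" "Gen Crossing" a "[Down]" "Down # Down # b"]
    by (simp add: mult.assoc)
  also have "\<dots> * cup' (a @ [Up, Down]) (Up # Down # Down # b)
      = wh (a @ [Down]) cap2 b * cr (a @ [Down]) (Down # Down # b)
        * cup' a (Up # Down # Down # b) * cap a (Up # Down # Down # b)"
    using interchange[of "Gen CapPQ" "Gen CupQP" a "[]" "Up # Down # Down # b"]
    by (simp add: mult.assoc)
  also have "\<dots> * cup' (a @ [Up]) (Down # Down # b)
      = wh (a @ [Down]) cap2 b * cr (a @ [Down]) (Down # Down # b) * cup' a (Up # Down # Down # b)"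
    by (simp add: zigzags mult.assoc whisk_id_right)
  finally show ?thesis by (simp add: PQ_QP_expand cap2_expand mult.assoc)
qed

lemma cd_cup: "cd (a @ [Up]) b * cup a (Down # b) = wh a cross_QP_PQ (Down # b) * cup (a @ [Down]) b"
proof -
  have "cd (a @ [Up]) b * cup a (Down # b)
      = cap' (a @ [Up]) (Down # Down # b) * (cap' (a @ [Up, Down]) (Up # Down # Down # b)
        * (cr (a @ [Up, Down, Down]) (Down # Down # b)
        * (wh (a @ [Up, Down, Down]) cup2 b * cup a (Down # b))))"
    by (simp add: cd_expand cap2'_expand mult.assoc)
  also have "wh (a @ [Up, Down, Down]) cup2 b * cup a (Down # b)
      = cup a (Down # Up # Up # Down # Down # b) * wh (a @ [Down]) cup2 b"
    using interchange[of "Gen CupPQ" cup2 a "[Down]" b] by simp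
  also have "cr (a @ [Up, Down, Down]) (Down # Down # b) * \<dots>
      = cup a (Down # Up # Up # Down # Down # b) * (cr (a @ [Down]) (Down # Down # b) * wh (a @ [Down]) cup2 b)"
    using interchange[of "Gen CupPQ" "Gen Crossing" a "[Down]" "Down # Down # b"]
    by (simp add: mult.assoc[symmetric])
  also have "cap' (a @ [Up, Down]) (Up # Down # Down # b) * \<dots>
      = cup a (Up # Down # Down # b) * (cap' a (Up # Down # Down # b)
        * (cr (a @ [Down]) (Down # Down # b) * wh (a @ [Down]) cup2 b))"
    using interchange[of "Gen CupPQ" "Gen CapQP" a "[]" "Up # Down # Down # b"]
    by (simp add: mult.assoc[symmetric])
  also have "cap' (a @ [Up]) (Down # Down # b) * \<dots>
      = cap' a (Up # Down # Down # b) * (cr (a @ [Down]) (Down # Down # b) * wh (a @ [Down]) cup2 b)"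
    by (simp add: zigzags[THEN mult_eq_left] whisk_id_left[THEN mult_eq_left])
  finally show ?thesis by (simp add: QP_PQ_expand cup2_expand mult.assoc)
qed

text \<open>Pulling the cap and the cup across the crossings leaves a double crossing of Q P in the
  middle. Its identity part slides apart into a cup after a cap; its correction term straightens by
  two zigzags.\<close>

lemma cap_crossings_cup:
  "cap (a @ [Up]) (Down # b) * (cr a (Down # Down # b) * cd (a @ [Up, Up]) b) * cup (a @ [Up]) (Down # b)
    = cup a b * cap a b - pr (a @ Up # Down # b)"
proof -
  let ?r = "wh (a @ [Up]) cross_PQ_QP (Down # b)" and ?l = "wh (a @ [Up]) cross_QP_PQ (Down # b)"
  let ?K = "cap (a @ [Up, Down]) b" and ?C = "cup a (Up # Down # b)"
  have "cr a (Down # Down # b) * cd (a @ [Up, Up]) b = cd (a @ [Up, Up]) b * cr a (Down # Down # b)"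
    using interchange[of "Gen Crossing" cross_down a "[]" b] by simp
  hence "cap (a @ [Up]) (Down # b) * (cr a (Down # Down # b) * cd (a @ [Up, Up]) b) * cup (a @ [Up]) (Down # b)
      = (cap (a @ [Up]) (Down # b) * cd (a @ [Up, Up]) b) * (cr a (Down # Down # b) * cup (a @ [Up]) (Down # b))"
    by (simp only: mult.assoc)
  also have "cap (a @ [Up]) (Down # b) * cd (a @ [Up, Up]) b = ?K * ?r"
    using cap_cd[of "a @ [Up]" b] by simp
  also have "cr a (Down # Down # b) * cup (a @ [Up]) (Down # b) = ?l * ?C"
    by (rule crossing_cup)
  also have "?K * ?r * (?l * ?C) = ?K * (?r * ?l) * ?C"
    by (simp only: mult.assoc)
  also have "\<dots> = ?K * ?C - (?K * cup' (a @ [Up]) (Down # b)) * (cap' (a @ [Up]) (Down # b) * ?C)"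
    unfolding double_crossing_QP
    by (simp add: right_diff_distrib left_diff_distrib whisk_id_right, simp add: mult.assoc)
  also have "?K * cup' (a @ [Up]) (Down # b) = pr (a @ Up # Down # b)"
    using zigzags(4)[of "a @ [Up]" b] by simp
  also have "cap' (a @ [Up]) (Down # b) * ?C = pr (a @ Up # Down # b)"
    using zigzags(2)[of a "Down # b"] by simp
  also have "?K * ?C = cup a b * cap a b"
    using interchange[of "Gen CupPQ" "Gen CapPQ" a "[]" b]
    by simp
  finally show ?thesis by (simp add: op_of_id_left)
qed

text \<open>Between cup and cap, the identity of Q P is replaced by the double crossing plus cup
  after cap. The first summand becomes the circle on the left, once a double crossing of downward
  strands is undone; the second becomes a plain strand by two zigzags.\<close>

lemma circle_slide: "cap (a @ [Down]) b * cup (a @ [Down]) b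
    = cap a (Down # b) * cup a (Down # b) + pr (a @ Down # b)"
proof -
  let ?r = "wh a cross_PQ_QP (Down # b)" and ?l = "wh a cross_QP_PQ (Down # b)"
  have "cap (a @ [Down]) b * cup (a @ [Down]) b
      = cap (a @ [Down]) b * (?r * ?l + cup' a (Down # b) * cap' a (Down # b)) * cup (a @ [Down]) b"
    by (simp add: double_crossing_QP whisk_id_right)
  also have "\<dots> = (cap (a @ [Down]) b * ?r) * (?l * cup (a @ [Down]) b)
      + (cap (a @ [Down]) b * cup' a (Down # b)) * (cap' a (Down # b) * cup (a @ [Down]) b)"
    by (simp add: algebra_simps)
  also have "\<dots> = cap a (Down # b) * (cd (a @ [Up]) b * cd (a @ [Up]) b) * cup a (Down # b)
      + pr (a @ Down # b)"
    by (simp add: cap_cd[symmetric] cd_cup[symmetric] zigzags mult.assoc op_of_id_left)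
  finally show ?thesis
    by (simp add: cd_square whisk_id_right)
qed

section \<open>The differentials and their Laplacian\<close>

definition xop :: "nat \<Rightarrow> nat \<Rightarrow> 'k oper" where
  "xop m k = cr (Ppow k) (Ppow (m - k - 2) @ Qpow m)"
definition yop :: "nat \<Rightarrow> nat \<Rightarrow> 'k oper" where
  "yop m k = cd (Ppow m @ Qpow (m - k - 2)) (Qpow k)"
text \<open>The diagonal action of a simple transposition on the pairs of strands counted from the
  outside. With this numbering a cap or cup on the innermost pair leaves the other labels
  unchanged.\<close>

definition uop :: "nat \<Rightarrow> nat \<Rightarrow> 'k oper" where
  "uop m k = xop m k * yop m k"
definition kap :: "nat \<Rightarrow> 'k oper" where
  "kap m = cap (Ppow m) (Qpow m)"
definition eta :: "nat \<Rightarrow> 'k oper" where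
  "eta m = cup (Ppow m) (Qpow m)"
definition circ :: "nat \<Rightarrow> 'k oper" where
  "circ m = cap (PQ m) [] * cup (PQ m) []"

section \<open>Coxeter relations for the diagonal transpositions\<close>

lemma xop_square: "Suc k < m \<Longrightarrow> xop m k * xop m k = pr (PQ m)"
proof -
  assume "Suc k < m"
  then obtain r where "m = k + 2 + r" using le_Suc_ex[of "k + 2" m] by auto
  thus ?thesis by (simp add: xop_def crossing_square word_simps)
qed

lemma yop_square: "Suc k < m \<Longrightarrow> yop m k * yop m k = pr (PQ m)"
proof -
  assume "Suc k < m"
  then obtain r where "m = k + 2 + r" using le_Suc_ex[of "k + 2" m] by auto
  thus ?thesis by (simp add: yop_def cd_square word_simps)
qed

lemma xop_commute: "Suc i < j \<Longrightarrow> Suc j < m \<Longrightarrow> xop m i * xop m j = xop m j * xop m i"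
proof -
  assume "Suc i < j" "Suc j < m"
  then obtain d r where "j = i + 2 + d" "m = j + 2 + r"
    using le_Suc_ex[of "i + 2" j] le_Suc_ex[of "j + 2" m] by auto
  thus ?thesis
    using interchange[of "Gen Crossing" "Gen Crossing" "Ppow i" "Ppow d" "Ppow r @ Qpow m"]
    by (simp add: xop_def word_simps)
qed

lemma yop_commute: "Suc i < j \<Longrightarrow> Suc j < m \<Longrightarrow> yop m i * yop m j = yop m j * yop m i"
proof -
  assume "Suc i < j" "Suc j < m"
  then obtain d r where "j = i + 2 + d" "m = j + 2 + r"
    using le_Suc_ex[of "i + 2" j] le_Suc_ex[of "j + 2" m] by auto
  thus ?thesis
    using interchange[of cross_down cross_down "Ppow m @ Qpow r" "Qpow d" "Qpow i"]
    by (simp add: yop_def word_simps)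
qed

lemma xop_yop: "Suc i < m \<Longrightarrow> Suc j < m \<Longrightarrow> yop m j * xop m i = xop m i * yop m j"
proof -
  assume "Suc i < m" "Suc j < m"
  moreover from this obtain d r where m: "m = i + 2 + d" "m = j + 2 + r"
    by (metis le_Suc_ex add_2_eq_Suc' Suc_leI)
  ultimately have "m - i - 2 = d" "m - j - 2 = r" by simp_all
  moreover have "Ppow m = Ppow i @ Up # Up # Ppow d"
    by (simp add: m(1) word_simps)
  moreover have "Qpow m = Qpow r @ Down # Down # Qpow j"
    by (simp add: m(2) word_simps)
  ultimately show ?thesis
    using interchange[of "Gen Crossing" cross_down "Ppow i" "Ppow d @ Qpow r" "Qpow j"]
    by (simp add: xop_def yop_def)
qed

lemma xop_braid: "Suc (Suc k) < m \<Longrightarrow>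
  xop m k * (xop m (Suc k) * xop m k) = xop m (Suc k) * (xop m k * xop m (Suc k))"
proof -
  assume "Suc (Suc k) < m"
  then obtain r where "m = Suc (Suc (Suc (k + r)))" using le_Suc_ex[of "k + 3" m] by auto
  thus ?thesis
    using crossing_braid[of "Ppow k" "Ppow r @ Qpow m"] by (simp add: xop_def word_simps)
qed

lemma yop_braid: "Suc (Suc k) < m \<Longrightarrow>
  yop m k * (yop m (Suc k) * yop m k) = yop m (Suc k) * (yop m k * yop m (Suc k))"
proof -
  assume "Suc (Suc k) < m"
  then obtain r where "m = Suc (Suc (Suc (k + r)))" using le_Suc_ex[of "k + 3" m] by auto
  thus ?thesis
    using cd_braid[of "Ppow m @ Qpow r" "Qpow k"] by (simp add: yop_def word_simps)
qed

lemma pr_xop: "Suc k < m \<Longrightarrow> pr (PQ m) * xop m k = xop m k" "Suc k < m \<Longrightarrow> xop m k * pr (PQ m) = xop m k"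
proof -
  assume "Suc k < m"
  then obtain r where "m = k + 2 + r" using le_Suc_ex[of "k + 2" m] by auto
  thus "pr (PQ m) * xop m k = xop m k" "xop m k * pr (PQ m) = xop m k"
    unfolding xop_def by (intro whisk_id_left whisk_id_right; simp add: word_simps)+
qed

lemma pr_yop: "Suc k < m \<Longrightarrow> pr (PQ m) * yop m k = yop m k" "Suc k < m \<Longrightarrow> yop m k * pr (PQ m) = yop m k"
proof -
  assume "Suc k < m"
  then obtain r where "m = k + 2 + r" using le_Suc_ex[of "k + 2" m] by auto
  thus "pr (PQ m) * yop m k = yop m k" "yop m k * pr (PQ m) = yop m k"
    unfolding yop_def by (intro whisk_id_left whisk_id_right; simp add: word_simps)+
qed

lemma product_assoc:
  fixes x y :: "'k oper"
  assumes "y * x' = x' * y"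
  shows "x * y * (x' * y') = x * x' * (y * y')"
  using assms by (metis mult.assoc)

text \<open>The crossings on the P side commute with those on the Q side, so each relation splits
  into one for either side. The case n < m is wanted because the group of the outer m pairs also
  acts on P^(m+1) Q^(m+1).\<close>

lemma coxeter_uop:
  assumes "n \<le> m"
  shows "coxeter (uop m) (pr (PQ m)) n"
proof
  show "pr (PQ m) * pr (PQ m) = pr (PQ m)" by (simp add: op_of_id_left)
  fix k assume k: "Suc k < n"
  show "pr (PQ m) * uop m k = uop m k"
    using k assms by (simp add: uop_def mult.assoc[symmetric] pr_xop)
  show "uop m k * pr (PQ m) = uop m k"
    using k assms by (simp add: uop_def mult.assoc pr_yop)
  show "uop m k * uop m k = pr (PQ m)"
    unfolding uop_def using k assms
    by (subst product_assoc) (simp_all add: xop_yop xop_square yop_square op_of_id_left)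
next
  fix i j assume ij: "Suc i < j" "Suc j < n"
  show "uop m i * uop m j = uop m j * uop m i"
    unfolding uop_def using ij assms xop_commute[of i j m] yop_commute[of i j m]
    by (subst (1 2) product_assoc) (simp_all add: xop_yop)
next
  fix k assume k: "Suc (Suc k) < n"
  have 1: "uop m i * (uop m j * uop m i) = xop m i * (xop m j * xop m i) * (yop m i * (yop m j * yop m i))"
    if "Suc i < m" "Suc j < m" for i j
  proof -
    have "uop m j * uop m i = xop m j * xop m i * (yop m j * yop m i)"
      unfolding uop_def using that by (intro product_assoc xop_yop)
    moreover have "yop m i * (xop m j * xop m i) = (xop m j * xop m i) * yop m i"
      using that by (metis mult.assoc xop_yop)
    ultimately show ?thesis unfolding uop_def by (simp only: product_assoc)
  qed
  show "uop m k * (uop m (Suc k) * uop m k) = uop m (Suc k) * (uop m k * uop m (Suc k))"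
    using k assms by (simp only: 1 xop_braid yop_braid)
qed

lemma coxeter_oper_uop: "n \<le> m \<Longrightarrow> coxeter_oper (uop m) (pr (PQ m)) n"
  unfolding coxeter_oper_def by (rule coxeter_uop)

lemma uop_kap: "Suc k < m \<Longrightarrow> uop m k * kap m = kap m * uop (Suc m) k"
proof -
  assume "Suc k < m"
  then obtain r where r: "m = k + 2 + r" using le_Suc_ex[of "k + 2" m] by auto
  have "xop m k * kap m = kap m * xop (Suc m) k"
    using interchange[of "Gen Crossing" "Gen CapPQ" "Ppow k" "Ppow r" "Qpow m"] r
    by (simp add: xop_def kap_def word_simps)
  moreover have "yop m k * kap m = kap m * yop (Suc m) k"
    using interchange[of "Gen CapPQ" cross_down "Ppow m" "Qpow r" "Qpow k"] r
    by (simp add: yop_def kap_def word_simps)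
  ultimately show ?thesis unfolding uop_def by (metis mult.assoc)
qed

lemma uop_eta: "Suc k < m \<Longrightarrow> uop (Suc m) k * eta m = eta m * uop m k"
proof -
  assume "Suc k < m"
  then obtain r where r: "m = k + 2 + r" using le_Suc_ex[of "k + 2" m] by auto
  have "xop (Suc m) k * eta m = eta m * xop m k"
    using interchange[of "Gen Crossing" "Gen CupPQ" "Ppow k" "Ppow r" "Qpow m"] r
    by (simp add: xop_def eta_def word_simps)
  moreover have "yop (Suc m) k * eta m = eta m * yop m k"
    using interchange[of "Gen CupPQ" cross_down "Ppow m" "Qpow r" "Qpow k"] r
    by (simp add: yop_def eta_def word_simps)
  ultimately show ?thesis unfolding uop_def by (metis mult.assoc)
qed

text \<open>Slid around the nested caps, the crossing of the two P strands meets that of the two Q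
  strands and cancels it. Next to an antisymmetrizer, where the same transposition acts by -1, this
  makes the differential square to zero.\<close>

lemma kap_kap: "kap m * (kap (Suc m) * uop (Suc (Suc m)) m) = kap m * kap (Suc m)"
proof -
  have c: "kap m * kap (Suc m) = wh (Ppow m) cap2 (Qpow m)"
    by (simp add: kap_def cap2_expand replicate_append_same)
  have u: "uop (Suc (Suc m)) m = cr (Ppow m) (Down # Down # Qpow m) * cd (Ppow m @ [Up, Up]) (Qpow m)"
    by (simp add: uop_def xop_def yop_def word_simps)
  have "kap m * (kap (Suc m) * uop (Suc (Suc m)) m)
      = (wh (Ppow m) cap2 (Qpow m) * cr (Ppow m) (Down # Down # Qpow m)) * cd (Ppow m @ [Up, Up]) (Qpow m)"
    by (simp only: c[symmetric] u mult.assoc)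
  also have "\<dots> = wh (Ppow m) cap2 (Qpow m) * (cd (Ppow m @ [Up, Up]) (Qpow m) * cd (Ppow m @ [Up, Up]) (Qpow m))"
    by (simp only: crossing_cap2[symmetric] mult.assoc)
  also have "\<dots> = wh (Ppow m) cap2 (Qpow m)"
    unfolding cd_square by (rule whisk_id_right) simp_all
  finally show ?thesis by (simp only: c)
qed

lemma eta_eta: "uop (Suc (Suc m)) m * (eta (Suc m) * eta m) = eta (Suc m) * eta m"
proof -
  have c: "eta (Suc m) * eta m = wh (Ppow m) cup2 (Qpow m)"
    by (simp add: eta_def cup2_expand replicate_append_same)
  have "uop (Suc (Suc m)) m = yop (Suc (Suc m)) m * xop (Suc (Suc m)) m"
    by (simp add: uop_def xop_yop)
  hence u: "uop (Suc (Suc m)) m = cd (Ppow m @ [Up, Up]) (Qpow m) * cr (Ppow m) (Down # Down # Qpow m)"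
    by (simp add: xop_def yop_def word_simps)
  have "uop (Suc (Suc m)) m * (eta (Suc m) * eta m)
      = cd (Ppow m @ [Up, Up]) (Qpow m) * (cr (Ppow m) (Down # Down # Qpow m) * wh (Ppow m) cup2 (Qpow m))"
    by (simp only: c u mult.assoc)
  also have "\<dots> = (cd (Ppow m @ [Up, Up]) (Qpow m) * cd (Ppow m @ [Up, Up]) (Qpow m)) * wh (Ppow m) cup2 (Qpow m)"
    by (simp only: crossing_cup2[symmetric] mult.assoc)
  also have "\<dots> = wh (Ppow m) cup2 (Qpow m)"
    unfolding cd_square by (rule whisk_id_left) simp_all
  finally show ?thesis by (simp only: c)
qed

lemma kap_uop_eta: "kap (Suc m) * uop (Suc (Suc m)) m * eta (Suc m) = eta m * kap m - pr (PQ (Suc m))"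
  using cap_crossings_cup[of "Ppow m" "Qpow m"]
  by (simp add: kap_def eta_def uop_def xop_def yop_def word_simps)

lemma circle_slide_Qpow:
  "cap (a @ Qpow j) [] * cup (a @ Qpow j) []
    = cap a (Qpow j) * cup a (Qpow j) + scalar (of_nat j) * pr (a @ Qpow j)"
proof (induction j arbitrary: a)
  case (Suc j)
  have "cap (a @ Qpow (Suc j)) [] * cup (a @ Qpow (Suc j)) []
      = cap (a @ [Down]) (Qpow j) * cup (a @ [Down]) (Qpow j) + scalar (of_nat j) * pr (a @ Qpow (Suc j))"
    using Suc.IH[of "a @ [Down]"] by simp
  also have "cap (a @ [Down]) (Qpow j) * cup (a @ [Down]) (Qpow j)
      = cap a (Qpow (Suc j)) * cup a (Qpow (Suc j)) + pr (a @ Qpow (Suc j))"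
    using circle_slide[of a "Qpow j"] by simp
  finally show ?case by (simp add: scalar_add distrib_right)
qed simp

lemma circ_eq: "circ m = kap m * eta m + scalar (of_nat m) * pr (PQ m)"
  using circle_slide_Qpow[of "Ppow m" m] by (simp add: circ_def kap_def eta_def PQ_def)

lemma asym_intertwine:
  assumes "coxeter_oper t e m" "coxeter_oper t' e' m"
    and tx: "\<And>k. Suc k < m \<Longrightarrow> t' k * x = x * t k" and ex: "e' * x = x * (e :: 'k oper)"
  shows "coxeter_oper.asym t' e' m * x = x * coxeter_oper.asym t e m"
proof -
  interpret l: coxeter_oper t' e' m by fact
  interpret r: coxeter_oper t e m by fact
  have "l.prodw ks * x = x * r.prodw ks" if "\<forall>k\<in>set ks. Suc k < m" for ks
    using that
  proof (induction ks)
    case (Cons k ks)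
    hence "l.prodw (k # ks) * x = (t' k * x) * r.prodw ks" by (simp add: mult.assoc)
    also have "\<dots> = x * r.prodw (k # ks)" using Cons.prems by (simp add: tx mult.assoc)
    finally show ?case .
  qed (simp add: ex)
  hence rep: "l.rep w * x = x * r.rep w" if "w permutes {..<m}" for w
    unfolding l.rep_def r.rep_def using simple_word(1)[OF that] by blast
  have "l.asum * x = x * r.asum"
    unfolding l.asum_def r.asum_def sum_distrib_left sum_distrib_right
    by (rule sum.cong[OF HOL.refl]) (simp add: rep mult.assoc scalar_left_commute[of x])
  thus ?thesis
    unfolding l.asym_def r.asym_def mult.assoc scalar_left_commute[of x] by (rule arg_cong)
qed

definition Eop :: "nat \<Rightarrow> 'k oper" where
  "Eop m = coxeter_oper.asym (uop m) (pr (PQ m)) m"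
text \<open>The antisymmetrizer of the outer m pairs inside P^(m+1) Q^(m+1). Capping or creating the
  innermost pair exchanges it with \<open>Eop m\<close>.\<close>

definition Eop' :: "nat \<Rightarrow> 'k oper" where
  "Eop' m = coxeter_oper.asym (uop (Suc m)) (pr (PQ (Suc m))) m"

section \<open>Antisymmetrized caps and cups as differentials\<close>

lemma E_idem: "Eop m * Eop m = Eop m"
proof -
  interpret coxeter_oper "uop m" "pr (PQ m)" m by (rule coxeter_oper_uop) simp
  show ?thesis unfolding Eop_def by (rule asym_idem)
qed

lemma pr_E: "pr (PQ m) * Eop m = Eop m" "Eop m * pr (PQ m) = Eop m"
proof -
  interpret coxeter_oper "uop m" "pr (PQ m)" m by (rule coxeter_oper_uop) simp
  show "pr (PQ m) * Eop m = Eop m" "Eop m * pr (PQ m) = Eop m" unfolding Eop_def by (rule e_asym asym_e)+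
qed

lemma uop_E: "Suc k < m \<Longrightarrow> uop m k * Eop m = - Eop m" "Suc k < m \<Longrightarrow> Eop m * uop m k = - Eop m"
proof -
  interpret coxeter_oper "uop m" "pr (PQ m)" m by (rule coxeter_oper_uop) simp
  assume "Suc k < m"
  thus "uop m k * Eop m = - Eop m" "Eop m * uop m k = - Eop m"
    unfolding Eop_def by (rule t_asym asym_t)+
qed

lemma E'_E: "Eop' m * Eop (Suc m) = Eop (Suc m)" "Eop (Suc m) * Eop' m = Eop (Suc m)"
  and E_Suc: "scalar (of_nat (Suc m)) * Eop (Suc m) = Eop' m - scalar (of_nat m) * (Eop' m * (uop (Suc m) (m - 1) * Eop' m))"
proof -
  interpret coxeter_oper_Suc "uop (Suc m)" "pr (PQ (Suc m))" m
    unfolding coxeter_oper_Suc_def by (intro conjI coxeter_oper_uop) simp_all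
  show "Eop' m * Eop (Suc m) = Eop (Suc m)" "Eop (Suc m) * Eop' m = Eop (Suc m)"
    unfolding Eop_def Eop'_def by (rule inner_outer outer_inner)+
  show "scalar (of_nat (Suc m)) * Eop (Suc m) = Eop' m - scalar (of_nat m) * (Eop' m * (uop (Suc m) (m - 1) * Eop' m))"
    unfolding Eop_def Eop'_def by (rule asym_Suc)
qed

lemma pr_kap: "pr (PQ m) * kap m = kap m * pr (PQ (Suc m))"
  unfolding kap_def by (subst whisk_id_left whisk_id_right; simp add: word_simps)+

lemma pr_eta: "pr (PQ (Suc m)) * eta m = eta m * pr (PQ m)"
  unfolding eta_def by (subst whisk_id_left whisk_id_right; simp add: word_simps)+

lemma E_kap: "Eop m * kap m = kap m * Eop' m"
  unfolding Eop_def Eop'_def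
  by (rule asym_intertwine) (auto intro: coxeter_oper_uop uop_kap pr_kap)

lemma E'_eta: "Eop' m * eta m = eta m * Eop m"
  unfolding Eop_def Eop'_def
  by (rule asym_intertwine) (auto intro: coxeter_oper_uop uop_eta pr_eta)

definition dminus :: "nat \<Rightarrow> 'k oper" where
  "dminus m = Eop m * (kap m * Eop (Suc m))"
definition dplus :: "nat \<Rightarrow> 'k oper" where
  "dplus m = Eop (Suc m) * (eta m * Eop m)"

text \<open>\<open>Eop m\<close> passes through the cap as \<open>Eop' m\<close>, which the larger
  antisymmetrizer absorbs.\<close>

lemma dminus_eq: "dminus m = kap m * Eop (Suc m)"
  by (simp add: dminus_def mult.assoc[symmetric] E_kap) (simp add: mult.assoc E'_E)

lemma dplus_eq: "dplus m = Eop (Suc m) * eta m"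
  by (simp add: dplus_def E'_eta[symmetric]) (simp add: mult.assoc[symmetric] E'_E)

lemma eq_uminus_imp_zero:
  assumes "x = - (x :: 'k oper)"
  shows "x = 0"
proof -
  have "scalar 2 * x = x + x" using scalar_add[of "1 :: 'k" 1] by (simp add: distrib_right)
  also have "\<dots> = 0" using assms by (metis add.right_inverse)
  finally have "scalar (1/2) * (scalar 2 * x) = 0" by simp
  thus ?thesis by (simp add: scalar_cancel)
qed

lemma dminus_dminus: "dminus m * dminus (Suc m) = 0"
proof -
  let ?x = "kap m * (kap (Suc m) * Eop (Suc (Suc m)))"
  have "dminus m * dminus (Suc m) = kap m * (Eop (Suc m) * (kap (Suc m) * Eop (Suc (Suc m))))"
    unfolding dminus_eq[of m] dminus_def[of "Suc m"] by (simp add: mult.assoc mult_eq_left[OF E_idem])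
  also have "\<dots> = ?x"
    using dminus_eq[of "Suc m"] by (simp add: dminus_def)
  finally have 1: "dminus m * dminus (Suc m) = ?x" .
  have "?x = (kap m * (kap (Suc m) * uop (Suc (Suc m)) m)) * Eop (Suc (Suc m))"
    by (simp add: kap_kap mult.assoc)
  also have "\<dots> = - ?x"
    by (simp add: mult.assoc uop_E)
  finally show ?thesis unfolding 1 by (rule eq_uminus_imp_zero)
qed

lemma dplus_dplus: "dplus (Suc m) * dplus m = 0"
proof -
  let ?x = "Eop (Suc (Suc m)) * (eta (Suc m) * eta m)"
  have "dplus (Suc m) * dplus m = (Eop (Suc (Suc m)) * (eta (Suc m) * Eop (Suc m))) * eta m"
    unfolding dplus_eq[of m] dplus_def[of "Suc m"] by (simp add: mult.assoc mult_eq_left[OF E_idem])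
  also have "\<dots> = ?x"
    using dplus_eq[of "Suc m"] by (simp add: dplus_def mult.assoc[symmetric])
  finally have 1: "dplus (Suc m) * dplus m = ?x" .
  have "?x = Eop (Suc (Suc m)) * (uop (Suc (Suc m)) m * (eta (Suc m) * eta m))"
    by (simp only: eta_eta)
  also have "\<dots> = (Eop (Suc (Suc m)) * uop (Suc (Suc m)) m) * (eta (Suc m) * eta m)"
    by (simp only: mult.assoc)
  also have "\<dots> = - ?x"
    by (simp add: uop_E)
  finally show ?thesis unfolding 1 by (rule eq_uminus_imp_zero)
qed

text \<open>The recursion for the middle antisymmetrizer is inserted, and the copies of
  \<open>Eop' m\<close> leave through the cap and the cup.\<close>

lemma dminus_dplus:
  "scalar (of_nat (Suc m)) * (dminus m * dplus m)
    = Eop m * (kap m * eta m) - scalar (of_nat m) * (Eop m * (kap m * uop (Suc m) (m - 1) * eta m * Eop m))"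
proof -
  have "dminus m * dplus m = kap m * Eop (Suc m) * eta m"
    unfolding dminus_eq dplus_eq by (simp add: mult.assoc mult_eq_left[OF E_idem])
  hence "scalar (of_nat (Suc m)) * (dminus m * dplus m)
      = kap m * (scalar (of_nat (Suc m)) * Eop (Suc m)) * eta m"
    by (simp only: scalar_left_commute[of "kap m"] mult.assoc)
  also have "\<dots> = kap m * Eop' m * eta m
      - scalar (of_nat m) * (kap m * (Eop' m * (uop (Suc m) (m - 1) * (Eop' m * eta m))))"
    unfolding E_Suc
    by (simp add: right_diff_distrib left_diff_distrib scalar_left_commute[of "kap m"] mult.assoc)
  also have "kap m * Eop' m * eta m = Eop m * (kap m * eta m)"
    by (simp only: E_kap[symmetric] mult.assoc)
  also have "kap m * (Eop' m * (uop (Suc m) (m - 1) * (Eop' m * eta m)))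
      = Eop m * (kap m * uop (Suc m) (m - 1) * eta m * Eop m)"
    unfolding E'_eta by (simp only: E_kap[symmetric, THEN mult_eq_left2] mult.assoc)
  finally show ?thesis .
qed

lemma kap_eta: "kap m * eta m = circ m - scalar (of_nat m) * pr (PQ m)"
  by (simp add: circ_eq)

lemma laplacian_0: "dminus 0 * dplus 0 = Eop 0 * circ 0"
  using dminus_dplus[of 0] by (simp add: kap_eta)

text \<open>With these weights the multiples of \<open>Eop (Suc m)\<close> alone cancel: -(m + 1)
  from moving the circle to the right end, +(m + 1) from \<open>kap_uop_eta\<close>.\<close>

lemma laplacian_Suc:
  "scalar (of_nat (Suc (Suc m))) * (dminus (Suc m) * dplus (Suc m))
      + scalar (of_nat (Suc m)) * (dplus m * dminus m) = Eop (Suc m) * circ (Suc m)"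
proof -
  let ?s = "scalar (of_nat (Suc m)) :: 'k oper" and ?E = "Eop (Suc m)"
  have "dplus m * dminus m = ?E * (eta m * Eop m) * (kap m * ?E)"
    by (simp only: dplus_def dminus_eq)
  also have "\<dots> = ?E * (eta m * (Eop m * (kap m * ?E)))" by (simp only: mult.assoc)
  also have "Eop m * (kap m * ?E) = kap m * ?E" using dminus_eq[of m] by (simp add: dminus_def)
  finally have 1: "dplus m * dminus m = ?E * (eta m * (kap m * ?E))" .
  have "?E * (kap (Suc m) * uop (Suc (Suc m)) m * eta (Suc m) * ?E)
      = ?E * (eta m * (kap m * ?E)) - ?E"
    unfolding kap_uop_eta by (simp add: left_diff_distrib right_diff_distrib pr_E E_idem mult.assoc)
  hence "scalar (of_nat (Suc (Suc m))) * (dminus (Suc m) * dplus (Suc m))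
      = ?E * circ (Suc m) - ?s * ?E - ?s * (dplus m * dminus m - ?E)"
    unfolding dminus_dplus[of "Suc m"] 1 diff_Suc_1
    by (simp add: kap_eta right_diff_distrib scalar_left_commute[of ?E] pr_E del: of_nat_Suc)
  thus ?thesis by (simp add: right_diff_distrib del: of_nat_Suc)
qed

section \<open>The idempotents \<open>eps\<close> as operators\<close>

lemma typing_words:
  assumes "\<forall>k\<in>set ks. Suc k < m"
  shows "typed (up_word m ks :: 'k diag) (Ppow m) (Ppow m)"
    "typed (down_word m ks :: 'k diag) (Qpow m) (Qpow m)"
  using assms
  by (induction ks) (auto simp: up_word_def down_word_def replicate_pair typed_iff)

lemma op_of_words:
  assumes "\<forall>k\<in>set ks. Suc k < m"
  shows "op_of (up_word m ks \<diamondop> down_word m ks)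
    = (coxeter.prodw (uop m) (pr (PQ m)) ks :: 'k oper)"
proof -
  interpret coxeter_oper "uop m :: nat \<Rightarrow> 'k oper" "pr (PQ m)" m by (rule coxeter_oper_uop) simp
  show ?thesis
    using assms
  proof (induction ks)
    case Nil
    thus ?case by (simp add: up_word_def down_word_def op_of_Ident_tensor PQ_def[symmetric])
  next
    case (Cons k ks)
    let ?X = "Ident (Ppow k) \<diamondop> Gen Crossing \<diamondop> Ident (Ppow (m - k - 2)) :: 'k diag"
    let ?Y = "Ident (Qpow (m - k - 2)) \<diamondop> cross_down \<diamondop> Ident (Qpow k) :: 'k diag"
    have k: "Suc k < m" and ks: "\<forall>k\<in>set ks. Suc k < m" using Cons.prems by auto
    have "op_of (up_word m (k # ks) \<diamondop> down_word m (k # ks))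
        = op_of ((?X \<bullet> up_word m ks) \<diamondop> (?Y \<bullet> down_word m ks))"
      by (simp add: up_word_def down_word_def)
    also have "\<dots> = op_of (?X \<diamondop> ?Y) * op_of (up_word m ks \<diamondop> down_word m ks)"
      using typing_words[OF ks] k
      by (intro op_of_tensor_compose) (simp_all add: replicate_pair typed_iff)
    also have "op_of (?X \<diamondop> ?Y) = op_of (?X \<diamondop> Ident (Qpow m)) * op_of (Ident (Ppow m) \<diamondop> ?Y)"
      using op_of_tensor2[of ?X ?Y] k by (simp add: replicate_pair)
    also have "op_of (?X \<diamondop> Ident (Qpow m)) = xop m k"
      using whisk_Nil_left[of ?X "Qpow m"] whisk_whisk[of "Gen Crossing :: 'k diag" "[]" "Ppow k" "Ppow (m - k - 2)" "Qpow m"]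
      by (simp add: xop_def)
    also have "op_of (Ident (Ppow m) \<diamondop> ?Y) = yop m k"
      using whisk_Nil_right[of ?Y "Ppow m"] whisk_whisk[of "cross_down :: 'k diag" "Ppow m" "Qpow (m - k - 2)" "Qpow k" "[]"]
      by (simp add: yop_def)
    finally show ?case by (simp only: prodw_simps uop_def[of m k] Cons.IH[OF ks])
  qed
qed

lemma diag_sum_typing:
  assumes "finite A" "\<And>x. x \<in> A \<Longrightarrow> typed (F x) u v"
  shows "typed (diag_sum u v F A) u v \<and> op_of (diag_sum u v F A) = (\<Sum>x\<in>A. op_of (F x) :: 'k oper)"
proof -
  define xs where "xs = (SOME xs. distinct xs \<and> set xs = A)"
  have xs: "distinct xs \<and> set xs = A"
    unfolding xs_def by (rule someI_ex) (use finite_distinct_list[OF assms(1)] in blast)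
  have "typed (foldr (\<lambda>x. Plus (F x)) xs (ZeroD u v)) u v \<and>
      op_of (foldr (\<lambda>x. Plus (F x)) xs (ZeroD u v)) = (\<Sum>x\<leftarrow>xs. op_of (F x))"
    using assms(2) xs[THEN conjunct2, symmetric]
  proof (induction xs arbitrary: A)
    case (Cons x xs)
    from Cons.IH[of "set xs"] Cons.prems show ?case
      by (auto simp: typed_iff op_of_Plus)
  qed (auto simp: typed_iff)
  thus ?thesis using xs unfolding diag_sum_def xs_def[symmetric] by (auto simp: sum_list_distinct_conv_sum_set)
qed

text \<open>The unspecified words in \<open>perm_up\<close> and \<open>perm_down\<close> and the
  unspecified order in \<open>diag_sum\<close> all disappear on the level of operators.\<close>

lemma eps_typed_op: "typed (eps m :: 'k diag) (PQ m) (PQ m) \<and> op_of (eps m :: 'k diag) = Eop m"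
proof -
  interpret coxeter_oper "uop m :: nat \<Rightarrow> 'k oper" "pr (PQ m)" m by (rule coxeter_oper_uop) simp
  let ?F = "\<lambda>w. Scale (of_int (sign w)) (perm_up m w \<diamondop> perm_down m w) :: 'k diag"
  have F: "typed (?F w) (PQ m) (PQ m)" "op_of (?F w) = sgn_op w * rep w" if "w permutes {..<m}" for w
  proof -
    have eq: "perm_up m w = up_word m (simple_word m w)" "perm_down m w = down_word m (simple_word m w)"
      by (simp_all add: perm_up_def perm_down_def up_word_def down_word_def)
    show "typed (?F w) (PQ m) (PQ m)"
      unfolding eq using typing_words[OF simple_word(1)[OF that]] by (simp add: typed_iff PQ_def)
    show "op_of (?F w) = sgn_op w * rep w"
      unfolding eq by (simp add: op_of_Scale op_of_words[OF simple_word(1)[OF that]] rep_def)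
  qed
  have "typed (diag_sum (PQ m) (PQ m) ?F {w. w permutes {..<m}}) (PQ m) (PQ m) \<and>
      op_of (diag_sum (PQ m) (PQ m) ?F {w. w permutes {..<m}}) = asum"
    using diag_sum_typing[of "{w. w permutes {..<m}}" ?F "PQ m" "PQ m"] F
    by (simp add: finite_permutations asum_def)
  thus ?thesis by (simp add: eps_def typed_iff op_of_Scale asym_def Eop_def)
qed

lemma eps_simps [simp]: "wt (eps m :: 'k diag)" "src (eps m :: 'k diag) = PQ m" "tgt (eps m :: 'k diag) = PQ m"
  "op_of (eps m :: 'k diag) = Eop m"
  using eps_typed_op by (auto simp: typed_iff)

lemma E_0: "Eop 0 = pr []"
proof -
  interpret coxeter_oper "uop 0 :: nat \<Rightarrow> 'k oper" "pr (PQ 0)" 0 by (rule coxeter_oper_uop) simp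
  have "{w. w permutes {..<0::nat}} = {id}" by auto
  thus ?thesis by (simp add: Eop_def asym_def asum_def rep_id) (simp add: PQ_def)
qed

definition diffm :: "nat \<Rightarrow> 'k diag" where "diffm m = eps m \<bullet> inner_cap m \<bullet> eps (Suc m)"
definition diffp :: "nat \<Rightarrow> 'k diag" where "diffp m = eps (Suc m) \<bullet> inner_cup m \<bullet> eps m"

lemma diff_simps [simp]:
  "wt (diffm m)" "src (diffm m) = PQ (Suc m)" "tgt (diffm m) = PQ m" "op_of (diffm m) = dminus m"
  "wt (diffp m)" "tgt (diffp m) = PQ (Suc m)" "src (diffp m) = PQ m" "op_of (diffp m) = dplus m"
  by (simp_all add: diffm_def diffp_def inner_cap_def inner_cup_def op_of_compose dminus_def dplus_def
      kap_def eta_def whisk_def word_simps)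

section \<open>Polynomials in the clockwise circle\<close>

definition circle :: "'k diag" where "circle = Gen CapPQ \<bullet> Gen CupPQ"

lemma circle_simps [simp]: "wt circle" "src circle = []" "tgt circle = []"
  by (simp_all add: circle_def)

text \<open>\<open>epoly n\<close> is the product of \<open>1 - c / j\<close> over \<open>1 \<le> j \<le> n\<close>, where \<open>c\<close> is the circle, and
  \<open>qpoly n\<close> is \<open>(1 - epoly n) / c\<close>; \<open>falling s n\<close> is \<open>(c - s) \<dots> (c - (s + n - 1))\<close>.\<close>

primrec epoly :: "nat \<Rightarrow> 'k diag" where
  "epoly 0 = Ident []"
| "epoly (Suc n) = Plus (Ident []) (Scale (- (1 / of_nat (Suc n))) circle) \<bullet> epoly n"

primrec qpoly :: "nat \<Rightarrow> 'k diag" where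
  "qpoly 0 = ZeroD [] []"
| "qpoly (Suc n) = Plus (qpoly n) (Scale (1 / of_nat (Suc n)) (epoly n))"

primrec falling :: "nat \<Rightarrow> nat \<Rightarrow> 'k diag" where
  "falling s 0 = Ident []"
| "falling s (Suc n) = Plus circle (Scale (- of_nat (s + n)) (Ident [])) \<bullet> falling s n"

lemma poly_typing [simp]:
  "wt (epoly n)" "src (epoly n) = []" "tgt (epoly n) = []"
  "wt (qpoly n)" "src (qpoly n) = []" "tgt (qpoly n) = []"
  "wt (falling s n)" "src (falling s n) = []" "tgt (falling s n) = []"
  by (induction n) (simp_all)

declare epoly.simps [simp del] qpoly.simps [simp del] falling.simps [simp del]

lemma whisk_ZeroD [simp]: "whisk a (ZeroD u v) b = (0 :: 'k oper)"
  using whisk_eq[of "ZeroD u v :: 'k diag" "Scale 0 (ZeroD u v)" a b] whisk_Scale[of "ZeroD u v :: 'k diag" a 0 b]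
  by (simp add: op_of_Scale)

lemma whisk_poly:
  "whisk a (epoly 0) b = pr (a @ b)"
  "whisk a (epoly (Suc n)) b = (pr (a @ b) - scalar (1 / of_nat (Suc n)) * whisk a circle b) * whisk a (epoly n) b"
  "whisk a (qpoly (Suc n)) b = whisk a (qpoly n) b + scalar (1 / of_nat (Suc n)) * whisk a (epoly n) b"
  "whisk a (falling s 0) b = pr (a @ b)"
  "whisk a (falling s (Suc n)) b = (whisk a circle b - scalar (of_nat (s + n)) * pr (a @ b)) * whisk a (falling s n) b"
proof -
  have s: "scalar (- (1 / of_nat (Suc n))) = - scalar (1 / of_nat (Suc n) :: 'k)"
    "scalar (- of_nat (s + n)) = - scalar (of_nat (s + n) :: 'k)"
    by (simp_all only: scalar_minus)
  show "whisk a (epoly (Suc n)) b = (pr (a @ b) - scalar (1 / of_nat (Suc n)) * whisk a circle b) * whisk a (epoly n) b"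
    by (simp add: epoly.simps whisk_compose whisk_Plus whisk_Scale whisk_Ident s del: of_nat_Suc)
  show "whisk a (falling s (Suc n)) b = (whisk a circle b - scalar (of_nat (s + n)) * pr (a @ b)) * whisk a (falling s n) b"
    by (simp add: falling.simps whisk_compose whisk_Plus whisk_Scale whisk_Ident s del: of_nat_add)
  show "whisk a (qpoly (Suc n)) b = whisk a (qpoly n) b + scalar (1 / of_nat (Suc n)) * whisk a (epoly n) b"
    by (simp add: qpoly.simps whisk_Plus whisk_Scale del: of_nat_Suc)
qed (simp_all add: whisk_Ident epoly.simps falling.simps)

text \<open>Telescoping: the step from n to n + 1 subtracts c / (n + 1) times the old
  \<open>epoly\<close>.\<close>

lemma circle_qpoly: "whisk u circle [] * whisk u (qpoly n) [] = pr u - whisk u (epoly n) []"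
proof (induction n)
  case (Suc n)
  have "whisk u (epoly (Suc n)) [] = whisk u (epoly n) [] - scalar (1 / of_nat (Suc n)) * (whisk u circle [] * whisk u (epoly n) [])"
    unfolding whisk_poly by (simp add: left_diff_distrib whisk_id_left mult.assoc del: of_nat_Suc)
  thus ?case
    by (simp add: whisk_poly(3) distrib_left Suc scalar_left_commute[of "whisk u circle []"] del: of_nat_Suc)
qed (simp add: whisk_poly qpoly.simps)

text \<open>An endomorphism of the unit object, placed at the far right, shares no strand with
  \<open>g\<close>. Hence polynomials in the circle commute with the differentials.\<close>

lemma right_slide:
  assumes "wt g" "wt p" "src p = []" "tgt p = []"
  shows "whisk (tgt g) p [] * op_of g = op_of g * (whisk (src g) p [] :: 'k oper)"
  using whisk_interchange[of g p "[]" "[]" "[]"] assms by (simp add: whisk_Nil)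

section \<open>Moving circle polynomials through a downward strand\<close>

lemma circ_whisk: "circ m = whisk (PQ m) circle []"
  unfolding circ_def circle_def by (subst whisk_compose) simp_all

lemma circle_shift: "whisk (w @ [Down]) circle [] = whisk w circle [Down] + pr (w @ [Down])"
  using circle_slide[of w "[]"] by (simp add: circle_def whisk_compose)

lemma falling_shift: "whisk (w @ [Down]) (falling (Suc s) n) [] = whisk w (falling s n) [Down]"
proof (induction n)
  case (Suc n)
  show ?case
    unfolding whisk_poly(5) Suc circle_shift by (simp add: scalar_add distrib_right)
qed (simp add: whisk_poly)

text \<open>A factor 1 - c/j turns into 1 - (c + 1)/j = -(c - (j - 1))/j, so the constant is (-1)^n
  / n!.\<close>

lemma epoly_shift: "\<exists>\<kappa>. whisk (w @ [Down]) (epoly n) [] = scalar \<kappa> * whisk w (falling 0 n) [Down]"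
proof (induction n)
  case 0
  show ?case by (intro exI[of _ 1]) (simp add: whisk_poly)
next
  case (Suc n)
  then obtain \<kappa> where \<kappa>: "whisk (w @ [Down]) (epoly n) [] = scalar \<kappa> * whisk w (falling 0 n) [Down]" ..
  let ?c = "whisk w circle [Down]" and ?p = "pr (w @ [Down])" and ?f = "whisk w (falling 0 n) [Down]"
  let ?s = "scalar (1 / of_nat (Suc n)) :: 'k oper"
  have p: "?p = ?s * (scalar (of_nat (Suc n)) * ?p)"
    by (rule scalar_cancel[symmetric]) (simp del: of_nat_Suc)
  define x where "x = ?c - scalar (of_nat n) * ?p"
  have "scalar (of_nat (Suc n)) * ?p - (?c + ?p) = - x"
    by (simp add: x_def scalar_add distrib_right)
  hence "?p - ?s * (?c + ?p) = - (?s * x)"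
    by (subst p) (simp only: right_diff_distrib[symmetric] mult_minus_right)
  hence "whisk (w @ [Down]) (epoly (Suc n)) [] = - (?s * x) * (scalar \<kappa> * ?f)"
    unfolding whisk_poly(2) circle_shift \<kappa> by simp
  also have "\<dots> = - (?s * (scalar \<kappa> * (x * ?f)))"
    by (simp only: mult_minus_left mult.assoc scalar_left_commute[of x])
  also have "\<dots> = scalar (- (1 / of_nat (Suc n) * \<kappa>)) * (x * ?f)"
    by (simp only: scalar_minus scalar_mult mult_minus_left mult.assoc)
  also have "x * ?f = whisk w (falling 0 (Suc n)) [Down]"
    unfolding whisk_poly(5) x_def by simp
  finally show ?case by blast
qed

lemma shift_mult:
  fixes c :: "'k oper"
  assumes "c * p = c" "p * c = c" "p * p = p"
  shows "(c - scalar a * p) * (c - scalar b * p) = c * c - scalar (a + b) * c + scalar (a * b) * p"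
proof -
  have "(c - scalar a * p) * (c - scalar b * p)
      = c * c - scalar b * c - (scalar a * c - scalar a * (scalar b * p))"
    by (simp add: left_diff_distrib right_diff_distrib mult.assoc scalar_left_commute[of c]
        scalar_left_commute[of p] assms)
  thus ?thesis by (simp add: scalar_add scalar_mult distrib_right mult.assoc)
qed

text \<open>The recursion of \<open>falling\<close> puts the largest root in front, the nesting of
  circles needs the smallest there. The ring is not commutative, so two factors are exchanged by
  expanding both products with \<open>shift_mult\<close>.\<close>

lemma falling_front: "op_of (falling s (Suc n))
    = (op_of circle - scalar (of_nat s) * pr []) * op_of (falling (Suc s) n)"
proof (induction n)
  case (Suc n)
  let ?c = "op_of circle :: 'k oper"
  have f: "op_of (falling s (Suc n)) = (?c - scalar (of_nat (s + n)) * pr []) * op_of (falling s n)" for s n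
    using whisk_poly(5)[of "[]" s n "[]"] by (simp only: whisk_Nil circle_simps poly_typing append_Nil)
  have cp: "?c * pr [] = ?c" "pr [] * ?c = ?c" by (simp_all add: op_of_id_left op_of_id_right)
  have "op_of (falling s (Suc (Suc n))) = (?c - scalar (of_nat (s + Suc n)) * pr []) * op_of (falling s (Suc n))"
    by (rule f)
  also have "\<dots> = ((?c - scalar (of_nat (s + Suc n)) * pr []) * (?c - scalar (of_nat s) * pr []))
      * op_of (falling (Suc s) n)"
    unfolding Suc by (simp only: mult.assoc)
  also have "(?c - scalar (of_nat (s + Suc n)) * pr []) * (?c - scalar (of_nat s) * pr [])
      = (?c - scalar (of_nat s) * pr []) * (?c - scalar (of_nat (s + Suc n)) * pr [])"
    by (simp only: shift_mult[OF cp(1,2) op_of_id_left] wt.simps tgt.simps add.commute mult.commute)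
  also have "\<dots> * op_of (falling (Suc s) n) = (?c - scalar (of_nat s) * pr []) * op_of (falling (Suc s) (Suc n))"
    using f[of "Suc s" n] by (simp only: mult.assoc add_Suc add_Suc_right)
  finally show ?case .
qed (use whisk_poly(5)[of "[]" s 0 "[]"] in \<open>simp add: whisk_Nil falling.simps(1)\<close>)

text \<open>The diagram is a system of n nested circles, cut through the middle. In the step the n
  inner circles slide out through the descending strand of a new outer circle, which raises their
  roots by one and leaves the outer circle as the factor c.\<close>

lemma falling_factors: "\<exists>z a b. typed a [] (z @ Qpow n) \<and> typed b (z @ Qpow n) [] \<and>
    op_of (falling 0 n) = op_of b * (op_of a :: 'k oper)"
proof (induction n)
  case 0
  show ?case
    by (intro exI[of _ "[]"] exI[of _ "Ident []"]) (simp add: typed_iff op_of_id_left falling.simps)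
next
  case (Suc n)
  then obtain z a b where ab: "typed a [] (z @ Qpow n)" "typed b (z @ Qpow n) []"
    and f: "op_of (falling 0 n) = op_of b * (op_of a :: 'k oper)" by blast
  let ?a = "(idP \<diamondop> a \<diamondop> idQ) \<bullet> Gen CupPQ" and ?b = "Gen CapPQ \<bullet> (idP \<diamondop> b \<diamondop> idQ)"
  have "op_of ?b * op_of ?a
      = op_of (Gen CapPQ) * (whisk [Up] b [Down] * whisk [Up] a [Down]) * op_of (Gen CupPQ)"
    by (simp add: op_of_compose whisk_def mult.assoc)
  also have "whisk [Up] b [Down] * whisk [Up] a [Down] = whisk [Up] (b \<bullet> a) [Down]"
    using ab by (subst whisk_compose) (auto simp: typed_iff)
  also have "\<dots> = whisk [Up] (falling 0 n) [Down]"
    using ab f by (intro whisk_eq) (auto simp: typed_iff op_of_compose)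
  also have "\<dots> = whisk [Up, Down] (falling 1 n) []"
    using falling_shift[of "[Up]" 0 n] by simp
  also have "op_of (Gen CapPQ) * \<dots> * op_of (Gen CupPQ)
      = op_of (Gen CapPQ) * op_of (Gen CupPQ) * op_of (falling 1 n)"
    using right_slide[of "Gen CupPQ" "falling 1 n"] by (simp add: whisk_Nil mult.assoc)
  also have "\<dots> = op_of (falling 0 (Suc n))"
    using falling_front[of 0 n] by (simp add: circle_def op_of_compose)
  finally show ?case
    using ab by (intro exI[of _ "Up # z"] exI[of _ ?a] exI[of _ ?b] conjI)
      (auto simp: typed_iff replicate_append_same)
qed

text \<open>The nested circles provide n - 1 strands Q; the last strand of P^(m+1) Q^(m+1) is the
  n-th. It does not exist in degree 0, which is why that degree survives.\<close>

lemma epoly_factors: "\<exists>z a b. typed a (PQ (Suc m)) (z @ Qpow n) \<and> typed b (z @ Qpow n) (PQ (Suc m)) \<and>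
    whisk (PQ (Suc m)) (epoly (n - 1)) [] = op_of b * (op_of a :: 'k oper)"
proof -
  let ?w = "Ppow (Suc m) @ Qpow m"
  have w: "PQ (Suc m) = ?w @ [Down]" by (simp add: PQ_def replicate_append_same)
  obtain \<kappa> where \<kappa>: "whisk (?w @ [Down]) (epoly (n - 1)) [] = scalar \<kappa> * whisk ?w (falling 0 (n - 1)) [Down]"
    using epoly_shift by blast
  obtain z a b where ab: "typed a [] (z @ Qpow (n - 1))" "typed b (z @ Qpow (n - 1)) []"
    and f: "op_of (falling 0 (n - 1)) = op_of b * (op_of a :: 'k oper)" using falling_factors by blast
  \<comment> \<open>For n = 0 the word \<open>z'\<close> is the whole left-hand side.\<close>
  obtain z' where z': "?w @ z @ Qpow (n - 1) @ [Down] = z' @ Qpow n"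
    by (cases n) (auto simp: replicate_append_same[symmetric])
  let ?a = "Ident ?w \<diamondop> a \<diamondop> idQ" and ?b = "Scale \<kappa> (Ident ?w \<diamondop> b \<diamondop> idQ)"
  have "whisk ?w (falling 0 (n - 1)) [Down] = whisk ?w (b \<bullet> a) [Down]"
    using ab f by (intro whisk_eq) (auto simp: typed_iff op_of_compose)
  also have "\<dots> = whisk ?w b [Down] * whisk ?w a [Down]"
    using ab by (intro whisk_compose) (auto simp: typed_iff)
  finally have "whisk (PQ (Suc m)) (epoly (n - 1)) [] = op_of ?b * op_of ?a"
    unfolding w \<kappa> by (simp add: op_of_Scale whisk_def mult.assoc)
  moreover have "typed ?a (PQ (Suc m)) (z' @ Qpow n)" "typed ?b (z' @ Qpow n) (PQ (Suc m))"
    using ab z' by (auto simp: typed_iff w)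
  ultimately show ?thesis by blast
qed

section \<open>Morphisms between single words in \<open>heis_n\<close>\<close>

lemma heis_n_simps:
  "ob (heis_n n) = ob heis" "hom (heis_n n) = hom heis" "ident (heis_n n) = ident heis"
  "cmp (heis_n n) = cmp heis" "add (heis_n n) = add heis" "zero (heis_n n) = zero heis"
  by (simp_all add: heis_n_def quot_objects_def)

lemma eqv_heis_n: "eqv (heis_n n) X Y f g \<longleftrightarrow>
    (\<exists>M\<in>ob heis. \<exists>a\<in>hom heis X (tensor_Qpow M n). \<exists>b\<in>hom heis (tensor_Qpow M n) Y.
      eqv heis X Y f (add heis g (cmp heis X (tensor_Qpow M n) Y b a)))"
proof -
  have "eqv (heis_n n) X Y f g \<longleftrightarrow>
    (\<exists>Z\<in>{tensor_Qpow M n | M. M \<in> ob heis}. \<exists>a\<in>hom heis X Z. \<exists>b\<in>hom heis Z Y.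
      eqv heis X Y f (add heis g (cmp heis X Z Y b a)))"
    by (simp add: heis_n_def quot_objects_def)
  thus ?thesis by blast
qed

lemmas heis_simps = heis_def karoubi_def additive_hull_def diagrams_def

lemma cmp_single:
  "cmp heis ([u], e) ([v], e') ([w], e'') B A 0 0 = Plus (B 0 0 \<bullet> A 0 0 :: 'k diag) (ZeroD u w)"
  by (simp add: heis_simps)

lemma hom_singleI:
  assumes "typed (A 0 0 :: 'k diag) u v" "typed (e 0 0) u u" "typed (e' 0 0) v v"
    "op_of (e' 0 0) * op_of (A 0 0) * op_of (e 0 0) = op_of (A 0 0)"
  shows "A \<in> hom heis ([u], e) ([v], e')"
proof -
  have "diag_eq u v (Plus (e' 0 0 \<bullet> Plus (A 0 0 \<bullet> e 0 0) (ZeroD u v)) (ZeroD u v)) (A 0 0)"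
    by (rule op_of_eqD) (use assms in \<open>auto simp: typed_iff op_of_Plus op_of_compose mult.assoc\<close>)
  thus ?thesis using assms by (simp add: heis_simps)
qed

lemma ob_singleI:
  assumes "typed (e 0 0 :: 'k diag) u u" "op_of (e 0 0) * op_of (e 0 0) = op_of (e 0 0)"
  shows "([u], e) \<in> ob heis"
proof -
  have "diag_eq u u (Plus (e 0 0 \<bullet> e 0 0) (ZeroD u u)) (e 0 0)"
    by (rule op_of_eqD) (use assms in \<open>auto simp: typed_iff op_of_Plus op_of_compose\<close>)
  thus ?thesis using assms by (simp add: heis_simps)
qed

lemma sigma_obj_ob: "(sigma_obj m :: 'k heis_ob) \<in> ob heis"
  unfolding sigma_obj_def by (rule ob_singleI) (simp_all add: typed_iff E_idem)

lemma zero_obj_ob: "(zero_obj :: 'k heis_ob) \<in> ob heis"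
  by (simp add: zero_obj_def heis_simps)

lemma tensor_Qpow_single:
  "tensor_Qpow ([z], \<lambda>_ _. Ident z) n = ([z @ Qpow n], \<lambda>_ _. Ident z \<diamondop> Ident (Qpow n) :: 'k diag)"
  by (simp add: tensor_Qpow_def)

lemma hom_sigmaI:
  assumes "typed (A 0 0 :: 'k diag) (PQ m) (PQ m')" "Eop m' * op_of (A 0 0) = op_of (A 0 0)"
    "op_of (A 0 0) * Eop m = op_of (A 0 0)"
  shows "A \<in> hom heis (sigma_obj m) (sigma_obj m')"
  unfolding sigma_obj_def using assms by (intro hom_singleI) (simp_all add: typed_iff)

text \<open>Matrices without rows or columns satisfy every condition vacuously. At a zero object any
  value therefore represents the zero morphism, so one formula can serve in all degrees
  below.\<close>

lemma Nil_heis: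
  "A \<in> hom heis ([], e) Y" "A \<in> hom heis X ([], e :: 'k heis_mor)"
  "eqv heis ([], e) Y A B" "eqv heis X ([], e :: 'k heis_mor) A B"
  by (cases X; cases Y; simp add: heis_simps)+

lemma hom_zero: "A \<in> hom heis zero_obj Y" "A \<in> hom heis X (zero_obj :: 'k heis_ob)"
  unfolding zero_obj_def by (rule Nil_heis)+

lemma eqv_zero: "eqv (heis_n n) zero_obj Y f g" "eqv (heis_n n) X (zero_obj :: 'k heis_ob) f g"
proof -
  have t: "tensor_Qpow ([], \<lambda>_ _. ZeroD [] []) n = ([], \<lambda>_ _. ZeroD [] [] \<diamondop> Ident (Qpow n) :: 'k diag)"
    by (simp add: tensor_Qpow_def)
  show "eqv (heis_n n) zero_obj Y f g"
    unfolding eqv_heis_n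
    by (intro bexI[OF _ zero_obj_ob] bexI[of _ undefined]) (simp_all add: t zero_obj_def Nil_heis)
  show "eqv (heis_n n) X (zero_obj :: 'k heis_ob) f g"
    unfolding eqv_heis_n
    by (intro bexI[OF _ zero_obj_ob] bexI[of _ undefined]) (simp_all add: t zero_obj_def Nil_heis)
qed

lemma cmp_sigma:
  "cmp heis (sigma_obj m) (sigma_obj m') (sigma_obj m'') B A 0 0
    = Plus (B 0 0 \<bullet> A 0 0 :: 'k diag) (ZeroD (PQ m) (PQ m''))"
  "cmp heis (sigma_obj m) zero_obj (sigma_obj m'') B A 0 0 = (ZeroD (PQ m) (PQ m'') :: 'k diag)"
  "ident heis (sigma_obj m) 0 0 = (eps m :: 'k diag)"
  "add heis f g 0 0 = Plus (f 0 0) (g 0 0 :: 'k diag)"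
  "zero heis (sigma_obj m) (sigma_obj m') 0 0 = (ZeroD (PQ m) (PQ m') :: 'k diag)"
  by (simp_all add: sigma_obj_def zero_obj_def heis_simps)

text \<open>Sandwiching with \<open>eps\<close> turns arbitrary diagrams \<open>a\<close> and
  \<open>b\<close> into morphisms of the Karoubi envelope, so factorizations may be sought among
  plain diagrams.\<close>

lemma eqv_sigmaI:
  assumes A: "typed (A 0 0 :: 'k diag) (PQ m) (PQ m')" and B: "typed (B 0 0 :: 'k diag) (PQ m) (PQ m')"
    and a: "typed a (PQ m) (z @ Qpow n)" and b: "typed b (z @ Qpow n) (PQ m')"
    and eq: "op_of (A 0 0) = op_of (B 0 0) + Eop m' * (op_of b * (op_of a * Eop m))"
  shows "eqv (heis_n n) (sigma_obj m) (sigma_obj m') A B"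
proof -
  let ?Z = "([z], \<lambda>_ _. Ident z :: 'k diag)"
  let ?a = "\<lambda>_ _. a \<bullet> eps m" and ?b = "\<lambda>_ _. eps m' \<bullet> b"
  have Z: "?Z \<in> ob heis"
    by (rule ob_singleI) (simp_all add: typed_iff op_of_id_left)
  \<comment> \<open>The idempotent of \<open>tensor_Qpow\<close> is a tensor product of two
    identities, an identity only up to the congruence.\<close>
  have id: "op_of (Ident z \<diamondop> Ident (Qpow n)) = (proj (z @ Qpow n) :: 'k oper)"
    by (rule op_of_Ident_tensor)
  have a': "?a \<in> hom heis (sigma_obj m) (tensor_Qpow ?Z n)"
    unfolding tensor_Qpow_single sigma_obj_def
    by (rule hom_singleI) (use a in \<open>simp_all add: typed_iff op_of_compose id op_of_id_left mult.assoc E_idem,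
      simp add: mult.assoc[symmetric] op_of_id_left\<close>)
  have b': "?b \<in> hom heis (tensor_Qpow ?Z n) (sigma_obj m')"
    unfolding tensor_Qpow_single sigma_obj_def
    by (rule hom_singleI) (use b in \<open>simp_all add: typed_iff op_of_compose id op_of_id_right mult.assoc,
      simp add: mult.assoc[symmetric] E_idem\<close>)
  have c: "cmp heis (sigma_obj m) (tensor_Qpow ?Z n) (sigma_obj m') ?b ?a 0 0
      = Plus ((eps m' \<bullet> b) \<bullet> (a \<bullet> eps m)) (ZeroD (PQ m) (PQ m'))"
    unfolding tensor_Qpow_single sigma_obj_def cmp_single ..
  have "diag_eq (PQ m) (PQ m') (A 0 0)
      (add heis B (cmp heis (sigma_obj m) (tensor_Qpow ?Z n) (sigma_obj m') ?b ?a) 0 0)"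
    unfolding cmp_sigma(4) c
    by (rule op_of_eqD) (use A B a b eq in \<open>auto simp: typed_iff op_of_Plus op_of_compose mult.assoc\<close>)
  hence "eqv heis (sigma_obj m) (sigma_obj m') A
      (add heis B (cmp heis (sigma_obj m) (tensor_Qpow ?Z n) (sigma_obj m') ?b ?a))"
    by (simp add: sigma_obj_def heis_simps)
  thus ?thesis unfolding eqv_heis_n using Z a' b' by blast
qed

text \<open>The difference is the zero morphism, which factors through Q^n.\<close>

lemma eqv_sigmaI0:
  assumes "typed (A 0 0 :: 'k diag) (PQ m) (PQ m')" "typed (B 0 0 :: 'k diag) (PQ m) (PQ m')"
    and "op_of (A 0 0) = op_of (B 0 0)"
  shows "eqv (heis_n n) (sigma_obj m) (sigma_obj m') A B"
  by (rule eqv_sigmaI[of _ _ _ _ "ZeroD _ (Qpow n)" "[]" _ "ZeroD (Qpow n) _"])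
    (use assms in \<open>simp_all add: typed_iff\<close>)

section \<open>The homotopy equivalence\<close>

lemma sigma_minus_simps:
  "obj_at sigma_minus (int m) = (sigma_obj m :: 'k heis_ob)"
  "diff sigma_minus (int (Suc m)) = (\<lambda>_ _. diffm m :: 'k diag)"
  "i < 0 \<Longrightarrow> obj_at sigma_minus i = (zero_obj :: 'k heis_ob)"
  by (simp_all add: sigma_minus_def diffm_def nat_add_distrib)

lemma sigma_plus_simps:
  "obj_at sigma_plus (- int m) = (sigma_obj m :: 'k heis_ob)"
  "diff sigma_plus (- int m) = (\<lambda>_ _. diffp m :: 'k diag)"
  "i > 0 \<Longrightarrow> obj_at sigma_plus i = (zero_obj :: 'k heis_ob)"
  by (simp_all add: sigma_plus_def diffp_def)

lemma int_shift:
  "int (Suc m) - 1 = int m" "int m + 1 = int (Suc m)" "int (Suc (Suc m)) - 2 = int m"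
  "- int m - 1 = - int (Suc m)" "- int (Suc m) + 1 = - int m" "- int m - 2 = - int (Suc (Suc m))"
  by simp_all

lemma E_dminus: "Eop m * dminus m = dminus m" "dminus m * Eop (Suc m) = dminus m"
  unfolding dminus_def by (simp_all only: mult.assoc E_idem mult_eq_left[OF E_idem])

lemma E_dplus: "Eop (Suc m) * dplus m = dplus m" "dplus m * Eop m = dplus m"
  unfolding dplus_def by (simp_all only: mult.assoc E_idem mult_eq_left[OF E_idem])

section \<open>Both sequences are complexes\<close>

lemma is_complex_minus: "is_complex (heis_n n) (sigma_minus :: ('k heis_ob, 'k heis_mor) complexes)"
  unfolding is_complex_def heis_n_simps
proof (intro allI conjI)
  fix i :: int
  let ?S = "sigma_minus :: ('k heis_ob, 'k heis_mor) complexes"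
  show "obj_at ?S i \<in> ob heis"
    by (simp add: sigma_minus_def sigma_obj_ob zero_obj_ob)
  show "diff ?S i \<in> hom heis (obj_at ?S i) (obj_at ?S (i - 1))"
  proof (cases "i \<le> 0")
    case False
    then obtain m where "i = int (Suc m)" by (metis not0_implies_Suc of_nat_0 le_refl linorder_not_le zero_less_imp_eq_int)
    thus ?thesis
      by (simp only: int_shift sigma_minus_simps)
        (rule hom_sigmaI, simp_all add: typed_iff E_dminus)
  qed (simp add: sigma_minus_simps hom_zero)
  show "eqv (heis_n n) (obj_at ?S i) (obj_at ?S (i - 2))
       (cmp heis (obj_at ?S i) (obj_at ?S (i - 1)) (obj_at ?S (i - 2)) (diff ?S (i - 1)) (diff ?S i))
       (zero heis (obj_at ?S i) (obj_at ?S (i - 2)))"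
  proof (cases "i \<le> 1")
    case False
    then obtain m where i: "i = int (Suc (Suc m))"
      by (intro that[of "nat (i - 2)"]) simp
    have i': "i - 1 = int (Suc m)" "i - 2 = int m" unfolding i by simp_all
    show ?thesis
      unfolding i' sigma_minus_simps unfolding i sigma_minus_simps
      by (rule eqv_sigmaI0) (simp_all add: cmp_sigma typed_iff op_of_Plus op_of_compose dminus_dminus)
  qed (simp add: sigma_minus_simps eqv_zero)
qed

lemma is_complex_plus: "is_complex (heis_n n) (sigma_plus :: ('k heis_ob, 'k heis_mor) complexes)"
  unfolding is_complex_def heis_n_simps
proof (intro allI conjI)
  fix i :: int
  let ?S = "sigma_plus :: ('k heis_ob, 'k heis_mor) complexes"
  show "obj_at ?S i \<in> ob heis"
    by (simp add: sigma_plus_def sigma_obj_ob zero_obj_ob)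
  show "diff ?S i \<in> hom heis (obj_at ?S i) (obj_at ?S (i - 1))"
  proof (cases "i > 0")
    case False
    then obtain m where "i = - int m" by (intro that[of "nat (- i)"]) simp
    thus ?thesis
      by (simp only: int_shift sigma_plus_simps)
        (rule hom_sigmaI, simp_all add: typed_iff E_dplus)
  qed (simp add: sigma_plus_simps hom_zero)
  show "eqv (heis_n n) (obj_at ?S i) (obj_at ?S (i - 2))
       (cmp heis (obj_at ?S i) (obj_at ?S (i - 1)) (obj_at ?S (i - 2)) (diff ?S (i - 1)) (diff ?S i))
       (zero heis (obj_at ?S i) (obj_at ?S (i - 2)))"
  proof (cases "i > 0")
    case False
    then obtain m where i: "i = - int m"
      by (intro that[of "nat (- i)"]) simp
    have i': "i - 1 = - int (Suc m)" "i - 2 = - int (Suc (Suc m))" unfolding i by simp_all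
    show ?thesis
      unfolding i' sigma_plus_simps unfolding i sigma_plus_simps
      by (rule eqv_sigmaI0) (simp_all add: cmp_sigma typed_iff op_of_Plus op_of_compose dplus_dplus)
  qed (simp add: sigma_plus_simps eqv_zero)
qed

text \<open>For n = 0 truncated subtraction gives e = 1 and q = 0. This is consistent, since every
  word ends in Q^0.\<close>

definition epoly_op :: "nat \<Rightarrow> nat \<Rightarrow> 'k oper" where "epoly_op n m = whisk (PQ m) (epoly (n - 1)) []"
definition qpoly_op :: "nat \<Rightarrow> nat \<Rightarrow> 'k oper" where "qpoly_op n m = whisk (PQ m) (qpoly (n - 1)) []"

lemma slide_W: "epoly_op n m * Eop m = Eop m * epoly_op n m" "epoly_op n m * dminus m = dminus m * epoly_op n (Suc m)"
    "epoly_op n (Suc m) * dplus m = dplus m * epoly_op n m"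
  using right_slide[of "eps m :: 'k diag" "epoly (n - 1)"] right_slide[of "diffm m :: 'k diag" "epoly (n - 1)"]
    right_slide[of "diffp m :: 'k diag" "epoly (n - 1)"] by (simp_all add: epoly_op_def)

lemma slide_V: "qpoly_op n m * Eop m = Eop m * qpoly_op n m" "qpoly_op n m * dminus m = dminus m * qpoly_op n (Suc m)"
    "qpoly_op n (Suc m) * dplus m = dplus m * qpoly_op n m"
  using right_slide[of "eps m :: 'k diag" "qpoly (n - 1)"] right_slide[of "diffm m :: 'k diag" "qpoly (n - 1)"]
    right_slide[of "diffp m :: 'k diag" "qpoly (n - 1)"] by (simp_all add: qpoly_op_def)

lemma E_circ_V: "Eop m * circ m * qpoly_op n m = Eop m - Eop m * epoly_op n m"
  using circle_qpoly[of "PQ m" "n - 1"]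
  by (simp add: qpoly_op_def epoly_op_def circ_whisk mult.assoc right_diff_distrib pr_E)

text \<open>The term through P^(k+1) Q^(k+1) contains e there, which factors through Q^n and so
  vanishes in the quotient.\<close>

lemma eqv_killed:
  assumes A: "typed (A 0 0 :: 'k diag) (PQ m) (PQ m')" and B: "typed (B 0 0 :: 'k diag) (PQ m) (PQ m')"
    and f: "typed (f :: 'k diag) (PQ m) (PQ (Suc k))" "op_of f * Eop m = op_of f"
    and g: "typed (g :: 'k diag) (PQ (Suc k)) (PQ m')" "Eop m' * op_of g = op_of g"
    and eq: "op_of (A 0 0) = op_of (B 0 0) + op_of g * (epoly_op n (Suc k) * op_of f)"
  shows "eqv (heis_n n) (sigma_obj m) (sigma_obj m') A B"
proof -
  obtain z a b where ab: "typed a (PQ (Suc k)) (z @ Qpow n)" "typed b (z @ Qpow n) (PQ (Suc k))"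
    and W: "epoly_op n (Suc k) = op_of b * (op_of a :: 'k oper)"
    unfolding epoly_op_def using epoly_factors by blast
  show ?thesis
  proof (rule eqv_sigmaI[of _ _ _ _ "a \<bullet> f" z _ "g \<bullet> b"])
    show "op_of (A 0 0) = op_of (B 0 0) + Eop m' * (op_of (g \<bullet> b) * (op_of (a \<bullet> f) * Eop m))"
      unfolding eq W by (simp add: op_of_compose mult.assoc f g mult_eq_left[OF g(2)])
  qed (use A B f g ab in \<open>auto simp: typed_iff\<close>)
qed

text \<open>\<open>Suc m\<close> is the weight of the corresponding composite in the Laplacian; the
  sign makes the identity plus the boundary of the homotopy equal to e.\<close>

definition hplus :: "nat \<Rightarrow> nat \<Rightarrow> 'k diag" where
  "hplus n m = Scale (- of_nat (Suc m)) (diffm m \<bullet> (Ident (PQ (Suc m)) \<diamondop> qpoly (n - 1)))"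
definition hminus :: "nat \<Rightarrow> nat \<Rightarrow> 'k diag" where
  "hminus n m = Scale (- of_nat (Suc m)) (diffp m \<bullet> (Ident (PQ m) \<diamondop> qpoly (n - 1)))"

lemma h_simps [simp]:
  "wt (hplus n m)" "src (hplus n m) = PQ (Suc m)" "tgt (hplus n m) = PQ m"
  "wt (hminus n m)" "src (hminus n m) = PQ m" "tgt (hminus n m) = PQ (Suc m)"
  by (simp_all add: hplus_def hminus_def)

lemma op_of_h:
  "op_of (hplus n m) = - (scalar (of_nat (Suc m)) * (dminus m * qpoly_op n (Suc m)))"
  "op_of (hminus n m) = - (scalar (of_nat (Suc m)) * (dplus m * qpoly_op n m))"
  by (simp_all add: hplus_def hminus_def op_of_Scale op_of_compose qpoly_op_def whisk_Nil_right scalar_minus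
      del: of_nat_Suc)

text \<open>Because q slides past the differentials, both boundaries equal minus the Laplacian times
  q, which is E e - E.\<close>

lemma homotopy_Suc:
  "Eop (Suc m) + (dplus m * op_of (hplus n m) + op_of (hplus n (Suc m)) * dplus (Suc m))
    = Eop (Suc m) * epoly_op n (Suc m)"
  "Eop (Suc m) + (dminus (Suc m) * op_of (hminus n (Suc m)) + op_of (hminus n m) * dminus m)
    = Eop (Suc m) * epoly_op n (Suc m)"
proof -
  let ?s = "scalar (of_nat (Suc m)) :: 'k oper" and ?t = "scalar (of_nat (Suc (Suc m))) :: 'k oper"
  let ?L = "?t * (dminus (Suc m) * dplus (Suc m)) + ?s * (dplus m * dminus m)"
  have "Eop (Suc m) - ?L * qpoly_op n (Suc m) = Eop (Suc m) * epoly_op n (Suc m)"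
    unfolding laplacian_Suc E_circ_V by simp
  moreover have "dplus m * op_of (hplus n m) + op_of (hplus n (Suc m)) * dplus (Suc m) = - (?L * qpoly_op n (Suc m))"
    unfolding op_of_h by (simp add: scalar_left_commute[of "dplus m"] slide_V mult.assoc distrib_right del: of_nat_Suc)
  moreover have "dminus (Suc m) * op_of (hminus n (Suc m)) + op_of (hminus n m) * dminus m = - (?L * qpoly_op n (Suc m))"
    unfolding op_of_h by (simp add: scalar_left_commute[of "dminus (Suc m)"] slide_V mult.assoc distrib_right del: of_nat_Suc)
  ultimately show
    "Eop (Suc m) + (dplus m * op_of (hplus n m) + op_of (hplus n (Suc m)) * dplus (Suc m)) = Eop (Suc m) * epoly_op n (Suc m)"
    "Eop (Suc m) + (dminus (Suc m) * op_of (hminus n (Suc m)) + op_of (hminus n m) * dminus m) = Eop (Suc m) * epoly_op n (Suc m)"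
    by simp_all
qed

lemma PQ_0 [simp]: "PQ 0 = []"
  by (simp add: PQ_def)

lemma op_of_epoly: "op_of (epoly (n - 1)) = epoly_op n 0"
  by (simp add: epoly_op_def whisk_Nil)

lemma E_0_W: "Eop 0 * epoly_op n 0 = epoly_op n 0" "epoly_op n 0 * Eop 0 = epoly_op n 0"
  unfolding E_0 by (simp_all add: op_of_epoly[symmetric] op_of_id_left op_of_id_right)

lemma homotopy_0:
  "Eop 0 + op_of (hplus n 0) * dplus 0 = epoly_op n 0" "Eop 0 + dminus 0 * op_of (hminus n 0) = epoly_op n 0"
proof -
  have "Eop 0 - (dminus 0 * dplus 0) * qpoly_op n 0 = epoly_op n 0"
    unfolding laplacian_0 E_circ_V by (simp add: E_0_W)
  thus "Eop 0 + op_of (hplus n 0) * dplus 0 = epoly_op n 0" "Eop 0 + dminus 0 * op_of (hminus n 0) = epoly_op n 0"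
    by (simp_all add: op_of_h slide_V mult.assoc)
qed

lemma int_cases_sign:
  obtains "i > 0" | "i = (0::int)" | m where "i = - int (Suc m)"
proof -
  consider "i > 0" | "i = 0" | "i = - int (Suc (nat (- i) - 1))" by linarith
  thus ?thesis using that by cases
qed

section \<open>The two chain maps and the two homotopies\<close>

abbreviation (input) SP :: "('k heis_ob, 'k heis_mor) complexes" where "SP \<equiv> sigma_plus"
abbreviation (input) SM :: "('k heis_ob, 'k heis_mor) complexes" where "SM \<equiv> sigma_minus"

lemma sigma_at_0: "obj_at SP 0 = sigma_obj 0" "obj_at SM 0 = sigma_obj 0"
  "diff SP 0 = (\<lambda>_ _. diffp 0)" "diff SM 1 = (\<lambda>_ _. diffm 0)"
  "obj_at SP (- 1) = sigma_obj 1" "obj_at SM 1 = sigma_obj 1"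
  using sigma_plus_simps(1)[of 0] sigma_minus_simps(1)[of 0] sigma_plus_simps(2)[of 0] sigma_minus_simps(2)[of 0]
    sigma_plus_simps(1)[of 1] sigma_minus_simps(1)[of 1] by simp_all

text \<open>Outside degree 0 one of the two objects is zero and \<open>eps 0\<close> is a mere
  default. Every commuting square starts or ends at a zero object.\<close>

lemma chain_map_plus_minus: "chain_map (heis_n n) SP SM (\<lambda>i _ _. eps 0)"
  unfolding chain_map_def heis_n_simps
proof (intro allI conjI)
  fix i :: int
  show "(\<lambda>_ _. eps 0) \<in> hom heis (obj_at SP i) (obj_at SM i)"
  proof (cases "i = 0")
    case True
    show ?thesis unfolding True sigma_at_0
      by (rule hom_sigmaI) (simp_all add: typed_iff E_idem)
  next
    case False
    thus ?thesis by (cases "i > 0") (simp_all add: sigma_plus_simps sigma_minus_simps hom_zero)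
  qed
  show "eqv (heis_n n) (obj_at SP i) (obj_at SM (i - 1))
      (cmp heis (obj_at SP i) (obj_at SM i) (obj_at SM (i - 1)) (diff SM i) (\<lambda>_ _. eps 0))
      (cmp heis (obj_at SP i) (obj_at SP (i - 1)) (obj_at SM (i - 1)) (\<lambda>_ _. eps 0) (diff SP i))"
    by (cases "i > 0") (simp_all add: sigma_plus_simps sigma_minus_simps eqv_zero)
qed

text \<open>Two squares have content: d^+ e must vanish on degree 0 of \<open>SM\<close>, and e d^-
  on degree 1. Sliding e past the differential places it on P Q, where it is killed.\<close>

lemma chain_map_minus_plus: "chain_map (heis_n n) SM SP (\<lambda>i _ _. epoly (n - 1))"
  unfolding chain_map_def heis_n_simps
proof (intro allI conjI)
  fix i :: int
  let ?g = "\<lambda>_ _. epoly (n - 1) :: 'k diag"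
  show "?g \<in> hom heis (obj_at SM i) (obj_at SP i)"
  proof (cases "i = 0")
    case True
    show ?thesis unfolding True sigma_at_0
      by (rule hom_sigmaI) (simp_all add: typed_iff op_of_epoly[simplified] E_0_W)
  next
    case False
    thus ?thesis by (cases "i > 0") (simp_all add: sigma_plus_simps sigma_minus_simps hom_zero)
  qed
  consider "i < 0" | "i = 0" | "i = 1" | "i > 1" by linarith
  thus "eqv (heis_n n) (obj_at SM i) (obj_at SP (i - 1))
      (cmp heis (obj_at SM i) (obj_at SP i) (obj_at SP (i - 1)) (diff SP i) ?g)
      (cmp heis (obj_at SM i) (obj_at SM (i - 1)) (obj_at SP (i - 1)) ?g (diff SM i))"
  proof cases
    case 2
    have z: "obj_at SM (0 - 1) = zero_obj" by (simp add: sigma_minus_simps)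
    have o: "obj_at SP (0 - 1) = sigma_obj 1" by (simp add: sigma_at_0)
    show ?thesis unfolding 2 z o sigma_at_0
      by (rule eqv_killed[where f = "diffp 0" and g = "eps 1" and k = 0])
        (simp_all add: cmp_sigma typed_iff op_of_Plus op_of_compose E_dplus E_idem op_of_epoly[simplified]
          slide_W, simp_all add: mult.assoc[symmetric] E_dplus[simplified])
  next
    case 3
    have z: "obj_at SP 1 = zero_obj" by (simp add: sigma_plus_simps)
    have o: "obj_at SP (1 - 1) = sigma_obj 0" "obj_at SM (1 - 1) = sigma_obj 0" by (simp_all add: sigma_at_0)
    \<comment> \<open>Here the left-hand side is the composite through zero, hence the sign in
      \<open>g\<close>.\<close>
    show ?thesis unfolding 3 z o sigma_at_0
      by (rule eqv_killed[where f = "eps 1" and g = "Scale (- 1) (diffm 0)" and k = 0])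
        (simp_all add: cmp_sigma typed_iff op_of_Plus op_of_compose op_of_Scale E_dminus E_idem op_of_epoly[simplified]
          slide_W scalar_minus mult_eq_left[OF E_dminus(2)[of 0, simplified]])
  qed (simp_all add: sigma_plus_simps sigma_minus_simps eqv_zero)
qed

text \<open>In degree 0 the required equation holds exactly, on the level of operators. In negative
  degrees the composite of the chain maps is zero, and the identity plus the boundary is E e, which
  is killed.\<close>

lemma homotopic_plus:
  "homotopic (heis_n n) SP SP
    (\<lambda>i. cmp (heis_n n) (obj_at SP i) (obj_at SM i) (obj_at SP i) (\<lambda>_ _. epoly (n - 1)) (\<lambda>_ _. eps 0))
    (\<lambda>i. ident (heis_n n) (obj_at SP i))"
  unfolding homotopic_def heis_n_simps
proof (intro exI allI conjI)
  fix i :: int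
  \<comment> \<open>At i = 0 the truncated index is a default: the homotopy there ends in the zero
    object.\<close>
  let ?h = "\<lambda>i _ _. hplus n (nat (- i) - 1)"
  show "?h i \<in> hom heis (obj_at SP i) (obj_at SP (i + 1))"
  proof (cases i rule: int_cases_sign)
    case (3 m)
    show ?thesis unfolding 3 int_shift sigma_plus_simps
      by (rule hom_sigmaI) (simp_all add: typed_iff op_of_h E_dminus slide_V scalar_left_commute[of "Eop _"]
          mult.assoc mult_eq_left[OF E_dminus(1)] mult_eq_left[OF E_dminus(2)] nat_add_distrib del: of_nat_Suc)
  qed (simp_all add: sigma_plus_simps hom_zero)
  show "eqv (heis_n n) (obj_at SP i) (obj_at SP i)
      (cmp heis (obj_at SP i) (obj_at SM i) (obj_at SP i) (\<lambda>_ _. epoly (n - 1)) (\<lambda>_ _. eps 0))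
      (add heis (ident heis (obj_at SP i))
        (add heis (cmp heis (obj_at SP i) (obj_at SP (i + 1)) (obj_at SP i) (diff SP (i + 1)) (?h i))
          (cmp heis (obj_at SP i) (obj_at SP (i - 1)) (obj_at SP i) (?h (i - 1)) (diff SP i))))"
  proof (cases i rule: int_cases_sign)
    case 2
    have z: "obj_at SP (0 + 1) = zero_obj" by (simp add: sigma_plus_simps)
    have o: "obj_at SP (0 - 1) = sigma_obj 1" by (simp add: sigma_at_0)
    show ?thesis unfolding 2 z o sigma_at_0
      by (rule eqv_sigmaI0) (simp_all add: cmp_sigma typed_iff op_of_Plus op_of_compose homotopy_0
          op_of_epoly[simplified] E_0_W)
  next
    case (3 m)
    have z: "obj_at SM (- int (Suc m)) = zero_obj" by (simp add: sigma_minus_simps)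
    have n: "nat (- (- int (Suc m))) - 1 = m" "nat (- (- int (Suc (Suc m)))) - 1 = Suc m" by simp_all
    show ?thesis unfolding 3 int_shift z n sigma_plus_simps
      by (rule eqv_killed[where f = "eps (Suc m)" and g = "Scale (- 1) (eps (Suc m))" and k = m])
        (simp_all add: cmp_sigma typed_iff op_of_Plus op_of_compose op_of_Scale homotopy_Suc E_idem scalar_minus
          slide_W mult_eq_left[OF E_idem])
  qed (simp_all add: sigma_plus_simps eqv_zero)
qed

lemma homotopic_minus:
  "homotopic (heis_n n) SM SM
    (\<lambda>i. cmp (heis_n n) (obj_at SM i) (obj_at SP i) (obj_at SM i) (\<lambda>_ _. eps 0) (\<lambda>_ _. epoly (n - 1)))
    (\<lambda>i. ident (heis_n n) (obj_at SM i))"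
  unfolding homotopic_def heis_n_simps
proof (intro exI allI conjI)
  fix i :: int
  let ?h = "\<lambda>i _ _. hminus n (nat i)"
  show "?h i \<in> hom heis (obj_at SM i) (obj_at SM (i + 1))"
  proof (cases "i < 0")
    case False
    then obtain m where i: "i = int m" by (metis nonneg_int_cases not_less)
    show ?thesis unfolding i int_shift sigma_minus_simps
      by (rule hom_sigmaI) (simp_all add: typed_iff op_of_h E_dplus slide_V scalar_left_commute[of "Eop _"]
          mult.assoc mult_eq_left[OF E_dplus(1)] mult_eq_left[OF E_dplus(2)] del: of_nat_Suc)
  qed (simp_all add: sigma_minus_simps hom_zero)
  show "eqv (heis_n n) (obj_at SM i) (obj_at SM i)
      (cmp heis (obj_at SM i) (obj_at SP i) (obj_at SM i) (\<lambda>_ _. eps 0) (\<lambda>_ _. epoly (n - 1)))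
      (add heis (ident heis (obj_at SM i))
        (add heis (cmp heis (obj_at SM i) (obj_at SM (i + 1)) (obj_at SM i) (diff SM (i + 1)) (?h i))
          (cmp heis (obj_at SM i) (obj_at SM (i - 1)) (obj_at SM i) (?h (i - 1)) (diff SM i))))"
  proof (cases "- i" rule: int_cases_sign)
    case 1
    thus ?thesis by (simp add: sigma_minus_simps eqv_zero)
  next
    case 2
    hence i: "i = 0" by simp
    have z: "obj_at SM (0 - 1) = zero_obj" by (simp add: sigma_minus_simps)
    have o: "obj_at SM (0 + 1) = sigma_obj 1" "diff SM (0 + 1) = (\<lambda>_ _. diffm 0)" by (simp_all add: sigma_at_0)
    show ?thesis unfolding i z o sigma_at_0
      by (rule eqv_sigmaI0) (simp_all add: cmp_sigma typed_iff op_of_Plus op_of_compose homotopy_0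
          op_of_epoly[simplified] E_0_W)
  next
    case (3 m)
    hence i: "i = int (Suc m)" by simp
    have z: "obj_at SP (int (Suc m)) = zero_obj" by (simp add: sigma_plus_simps)
    show ?thesis unfolding i int_shift z nat_int sigma_minus_simps
      by (rule eqv_killed[where f = "eps (Suc m)" and g = "Scale (- 1) (eps (Suc m))" and k = m])
        (simp_all add: cmp_sigma typed_iff op_of_Plus op_of_compose op_of_Scale homotopy_Suc E_idem scalar_minus
          slide_W mult_eq_left[OF E_idem])
  qed
qed

end

theorem theorem7p5:
  fixes n :: nat
  shows "homotopy_equivalent (heis_n n)
    (sigma_plus :: ('k::field_char_0 heis_ob, 'k heis_mor) complexes) sigma_minus"
  unfolding homotopy_equivalent_def
  using is_complex_plus is_complex_minus chain_map_plus_minus chain_map_minus_plus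
    homotopic_plus homotopic_minus by blast

end
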